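(* Let $1<\alpha<2$, let $\xi=(\xi_t)_{t\in\mathbb{R}}$ be a symmetric $\alpha$-stable process satisfying (I) and (II) of the context, with associated random measure $d\xi$ and $F(A,B)=[d\xi(A),d\xi(B)]_{\alpha}$. Suppose that $d\xi$ satisfies the additivity condition $\mathcal{A}$ and that $F$ satisfies the bounded variation condition (BV) of the context. Let $f$ and $g$ be two bounded functions in $\Lambda_{\alpha}(d\xi)$. Then the pair $(f,g^{<\alpha-1>})$ is Morse–Transue integrable with respect to $F$, and $$\left[\int_{\mathbb{R}}f\,d\xi,\int_{\mathbb{R}}g\,d\xi\right]_{\alpha}=\int_{\mathbb{R}}\int_{\mathbb{R}}f(\lambda)\,\bigl(g(\lambda')\bigr)^{<\alpha-1>}F(d\lambda,d\lambda'),$$ where the right-hand side is the Morse–Transue integral with respect to the bimeasure $F$.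
   Context: A real random vector $(X_1,\dots,X_d)$ is symmetric $\alpha$-stable (S$\alpha$S) if its characteristic function is $\exp\{-\int_{\mathbb{S}_d}|\sum_i t_is_i|^{\alpha}d\Gamma(s)\}$ for a (unique) finite symmetric measure $\Gamma=\Gamma_{X^d}$ on the unit sphere $\mathbb{S}_d\subset\mathbb{R}^d$ (spectral measure). A complex vector with $X_j=X_j^1+\imath X_j^2$ is S$\alpha$S if $(X_1^1,X_1^2,\dots,X_d^1,X_d^2)$ is; $\Gamma_{X^d}$ is then the spectral measure of that real vector on $\mathbb{S}_{2d}\subset\mathbb{R}^{2d}$, and one writes $s_j=s_j^1+\imath s_j^2$. A process is S$\alpha$S if all its finite-dimensional vectors are. For $z\in\mathbb{C}$, $z^{<\beta>}=|z|^{\beta-1}\overline{z}$ ($0^{<\beta>}=0$). The covariation is $[X_1,X_2]_{\alpha}=\int s_1s_2^{<\alpha-1>}d\Gamma_{(X_1,X_2)}$ (over $\mathbb{S}_2$ in the real case, $\mathbb{S}_4$ in the complex case), and $\|X\|_{\alpha}=([X,X]_{\alpha})^{1/\alpha}$. Conditions on $\xi$: (I) $\xi$ is right continuous with respect to convergence in probability; (II) for every linear combination $\zeta$ of increments of $\xi$, the map $t\mapsto[\xi(t),\zeta]_{\alpha}$ is of bounded variation. Under (I) and (II), the map $d\xi([s,t[)=\xi_t-\xi_s$ extends to a complex S$\alpha$S random measure $d\xi$ on $\mathcal{B}(\mathbb{R})$ (all vectors $(d\xi(A_1),\dots,d\xi(A_n))$ are S$\alpha$S). Condition $\mathcal{A}$: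 for all $n\ge2$ and all pairwise disjoint Borel sets $A_1,\dots,A_n$, the S$\alpha$S vector $X^n=(d\xi(A_1),\dots,d\xi(A_n))$ satisfies: for all $i,j,k\in\{1,\dots,n\}$ not all equal, $\frac{\partial^3\phi}{\overline{\partial}\theta_i\overline{\partial}\theta_j\overline{\partial}\theta_k}\equiv0$, where $\phi(\theta)=\int_{\mathbb{S}_{2n}}\cos(\mathrm{Re}\sum_i\theta_i\overline{s_i})\,d\Gamma_{X^n}$, $\theta\in\mathbb{C}^n$, and $\frac{\partial}{\overline{\partial}\theta_j}=\frac{\partial}{\partial\theta_j^1}+\imath\frac{\partial}{\partial\theta_j^2}$ for $\theta_j=\theta_j^1+\imath\theta_j^2$ (in the real case: $\phi(\theta)=\int_{\mathbb{S}_n}\cos(\sum_i\theta_is_i)\,d\Gamma_{X^n}$, $\theta\in\mathbb{R}^n$, and usual partial derivatives). Under condition $\mathcal{A}$, $F$ is $\sigma$-additive in each variable separately (a bimeasure). Condition (BV): $\sup\{\sum_{i=1}^n\sum_{j=1}^n a_i(a_j)^{<\alpha-1>}F(A_i,A_j)\}<\infty$, the supremum being over $n$, pairwise disjoint $A_1,\dots,A_n\in\mathcal{B}(\mathbb{R})$ and complex $a_i$ with $|a_i|<1$. Then the complex measures $F_B:A\mapsto F(A,B)$ and $\tilde F_A:B\mapsto F(A,B)$ have finite total variation. Morse–Transue integral: for bounded $f,h$ put $\tilde I_1(f,B)=\int f\,dF_B$ and $\tilde I_2(A,h)=\int h\,d\tilde F_A$, which are complex measures of finite total variation in $B$ and $A$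 respectively, and $I_1(f,h)=\int h(\lambda)\,\tilde I_1(f,d\lambda)$, $I_2(f,h)=\int f(\lambda)\,\tilde I_2(d\lambda,h)$. The pair $(f,h)$ is Morse–Transue integrable if $I_1(f,h)=I_2(f,h)$; the common value is denoted $\int\int f(\lambda)h(\lambda')F(d\lambda,d\lambda')$. Total variation: $v(d\xi,A)=\sup\{\sum_{i\in I}|d\xi(A_i)|:\ I\text{ finite},\ (A_i)_{i\in I}\text{ a Borel partition of }A\}$, and $\nu$ is the positive measure $\nu(A)=\mathbb{E}(v(d\xi,A))$. $\Lambda_{\alpha}(d\xi)$ is the completion, for the $L^1(\nu)$ norm, of the complex simple functions with bounded support. For a simple function $f=\sum_if_i\mathbf{1}_{A_i}$, $\int f\,d\xi=\sum_if_i\,d\xi(A_i)$; for $f\in\Lambda_{\alpha}(d\xi)$, $\int f\,d\xi$ is the limit in $\|\cdot\|_{\alpha}$ (equivalently in probability) of $\int f_n\,d\xi$ for simple $f_n\to f$ in $L^1(\nu)$. *)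

theory Defs
  imports "HOL-Probability.Probability"
begin

section \<open>Symmetric stable vectors and their spectral measures\<close>

text \<open>Vectors of length \<open>d\<close> are functions on \<open>nat\<close> of which only the components
  \<open>i < d\<close> matter; points of the sphere are extensional on \<open>{..<d}\<close>.\<close>

definition unit_sphere :: "nat \<Rightarrow> (nat \<Rightarrow> real) set" where
  "unit_sphere d = {s \<in> space (Pi\<^sub>M {..<d} (\<lambda>_. borel)). (\<Sum>i<d. (s i)\<^sup>2) = 1}"

definition is_spectral_measure ::
  "'w measure \<Rightarrow> real \<Rightarrow> nat \<Rightarrow> (nat \<Rightarrow> 'w \<Rightarrow> real) \<Rightarrow> (nat \<Rightarrow> real) measure \<Rightarrow> bool" where
  "is_spectral_measure M \<alpha> d X \<Gamma> \<longleftrightarrow>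
     sets \<Gamma> = sets (restrict_space (Pi\<^sub>M {..<d} (\<lambda>_. borel)) (unit_sphere d)) \<and>
     finite_measure \<Gamma> \<and>
     distr \<Gamma> \<Gamma> (\<lambda>s. \<lambda>i\<in>{..<d}. - s i) = \<Gamma> \<and>
     (\<forall>t :: nat \<Rightarrow> real.
        (\<integral>\<omega>. iexp (\<Sum>i<d. t i * X i \<omega>) \<partial>M)
          = complex_of_real (exp (- (\<integral>s. \<bar>\<Sum>i<d. t i * s i\<bar> powr \<alpha> \<partial>\<Gamma>))))"

definition SaS_real_vector ::
  "'w measure \<Rightarrow> real \<Rightarrow> nat \<Rightarrow> (nat \<Rightarrow> 'w \<Rightarrow> real) \<Rightarrow> bool" where
  "SaS_real_vector M \<alpha> d X \<longleftrightarrow>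
     (\<forall>i<d. X i \<in> borel_measurable M) \<and> (\<exists>\<Gamma>. is_spectral_measure M \<alpha> d X \<Gamma>)"

text \<open>For \<open>0 < \<alpha> < 2\<close> the spectral measure is unique, so that the choice is immaterial.\<close>

definition spectral_measure ::
  "'w measure \<Rightarrow> real \<Rightarrow> nat \<Rightarrow> (nat \<Rightarrow> 'w \<Rightarrow> real) \<Rightarrow> (nat \<Rightarrow> real) measure" where
  "spectral_measure M \<alpha> d X = (SOME \<Gamma>. is_spectral_measure M \<alpha> d X \<Gamma>)"

text \<open>A complex vector \<open>(X\<^sub>0, \<dots>, X\<^sub>d\<^sub>-\<^sub>1)\<close> is identified with the real vector
  \<open>(Re X\<^sub>0, Im X\<^sub>0, \<dots>, Re X\<^sub>d\<^sub>-\<^sub>1, Im X\<^sub>d\<^sub>-\<^sub>1)\<close> of length \<open>2 * d\<close>; conversely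
  \<open>cx s j\<close> is the \<open>j\<close>-th complex coordinate of a real vector \<open>s\<close> of length \<open>2 * d\<close>.\<close>

definition real_parts :: "(nat \<Rightarrow> 'w \<Rightarrow> complex) \<Rightarrow> nat \<Rightarrow> 'w \<Rightarrow> real" where
  "real_parts X k \<omega> = (if even k then Re (X (k div 2) \<omega>) else Im (X (k div 2) \<omega>))"

definition cx :: "(nat \<Rightarrow> real) \<Rightarrow> nat \<Rightarrow> complex" where
  "cx s j = Complex (s (2 * j)) (s (2 * j + 1))"

definition SaS_vector ::
  "'w measure \<Rightarrow> real \<Rightarrow> nat \<Rightarrow> (nat \<Rightarrow> 'w \<Rightarrow> complex) \<Rightarrow> bool" where
  "SaS_vector M \<alpha> d X \<longleftrightarrow> SaS_real_vector M \<alpha> (2 * d) (real_parts X)"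

definition cspectral_measure ::
  "'w measure \<Rightarrow> real \<Rightarrow> nat \<Rightarrow> (nat \<Rightarrow> 'w \<Rightarrow> complex) \<Rightarrow> (nat \<Rightarrow> real) measure" where
  "cspectral_measure M \<alpha> d X = spectral_measure M \<alpha> (2 * d) (real_parts X)"

definition SaS_process :: "'w measure \<Rightarrow> real \<Rightarrow> (real \<Rightarrow> 'w \<Rightarrow> complex) \<Rightarrow> bool" where
  "SaS_process M \<alpha> \<xi> \<longleftrightarrow> (\<forall>n (t :: nat \<Rightarrow> real). SaS_vector M \<alpha> n (\<lambda>i. \<xi> (t i)))"


section \<open>Covariation\<close>

text \<open>The signed power \<open>z\<^sup><\<^sup>\<beta>\<^sup>>\<close>; note the complex conjugation.\<close>

definition spow :: "complex \<Rightarrow> real \<Rightarrow> complex" where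
  "spow z \<beta> = complex_of_real (cmod z powr (\<beta> - 1)) * cnj z"

definition covariation ::
  "'w measure \<Rightarrow> real \<Rightarrow> ('w \<Rightarrow> complex) \<Rightarrow> ('w \<Rightarrow> complex) \<Rightarrow> complex" where
  "covariation M \<alpha> X Y =
     (\<integral>s. cx s 0 * spow (cx s 1) (\<alpha> - 1)
        \<partial>cspectral_measure M \<alpha> 2 (\<lambda>i. if i = 0 then X else Y))"


section \<open>The conditions on the process\<close>

definition conv_in_prob ::
  "'w measure \<Rightarrow> ('i \<Rightarrow> 'w \<Rightarrow> complex) \<Rightarrow> ('w \<Rightarrow> complex) \<Rightarrow> 'i filter \<Rightarrow> bool" where
  "conv_in_prob M X Z F \<longleftrightarrow>
     (\<forall>\<epsilon>>0. ((\<lambda>i. measure M {\<omega> \<in> space M. cmod (X i \<omega> - Z \<omega>) > \<epsilon>}) \<longlongrightarrow> 0) F)"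

definition cond_I :: "'w measure \<Rightarrow> (real \<Rightarrow> 'w \<Rightarrow> complex) \<Rightarrow> bool" where
  "cond_I M \<xi> \<longleftrightarrow> (\<forall>t. conv_in_prob M \<xi> (\<xi> t) (at_right t))"

definition bounded_variation :: "(real \<Rightarrow> complex) \<Rightarrow> bool" where
  "bounded_variation u \<longleftrightarrow>
     (\<exists>C. \<forall>n (t :: nat \<Rightarrow> real). mono t \<longrightarrow> (\<Sum>i<n. cmod (u (t (Suc i)) - u (t i))) \<le> C)"

definition cond_II :: "'w measure \<Rightarrow> real \<Rightarrow> (real \<Rightarrow> 'w \<Rightarrow> complex) \<Rightarrow> bool" where
  "cond_II M \<alpha> \<xi> \<longleftrightarrow>
     (\<forall>m (c :: nat \<Rightarrow> complex) (a :: nat \<Rightarrow> real) (b :: nat \<Rightarrow> real).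
        bounded_variation
          (\<lambda>t. covariation M \<alpha> (\<xi> t) (\<lambda>\<omega>. \<Sum>k<m. c k * (\<xi> (b k) \<omega> - \<xi> (a k) \<omega>))))"


section \<open>The random measure and its bimeasure\<close>

definition SaS_random_measure :: "'w measure \<Rightarrow> real \<Rightarrow> (real set \<Rightarrow> 'w \<Rightarrow> complex) \<Rightarrow> bool" where
  "SaS_random_measure M \<alpha> D \<longleftrightarrow>
     (\<forall>n (A :: nat \<Rightarrow> real set). (\<forall>i<n. A i \<in> sets borel) \<longrightarrow> SaS_vector M \<alpha> n (\<lambda>i. D (A i))) \<and>
     (\<forall>A :: nat \<Rightarrow> real set. range A \<subseteq> sets borel \<longrightarrow> disjoint_family A \<longrightarrow>
        conv_in_prob M (\<lambda>n \<omega>. \<Sum>i<n. D (A i) \<omega>) (D (\<Union>i. A i)) sequentially)"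

definition associated_random_measure ::
  "'w measure \<Rightarrow> real \<Rightarrow> (real \<Rightarrow> 'w \<Rightarrow> complex) \<Rightarrow> (real set \<Rightarrow> 'w \<Rightarrow> complex) \<Rightarrow> bool" where
  "associated_random_measure M \<alpha> \<xi> D \<longleftrightarrow>
     SaS_random_measure M \<alpha> D \<and>
     (\<forall>s t. s \<le> t \<longrightarrow> (AE \<omega> in M. D {s..<t} \<omega> = \<xi> t \<omega> - \<xi> s \<omega>))"

definition bimeas ::
  "'w measure \<Rightarrow> real \<Rightarrow> (real set \<Rightarrow> 'w \<Rightarrow> complex) \<Rightarrow> real set \<Rightarrow> real set \<Rightarrow> complex" where
  "bimeas M \<alpha> D A B = covariation M \<alpha> (D A) (D B)"

text \<open>\<open>dbar j g\<close> is \<open>\<partial>g/\<partial>\<theta>\<^sub>j\<^sup>1 + \<i> \<partial>g/\<partial>\<theta>\<^sub>j\<^sup>2\<close> for \<open>\<theta>\<^sub>j = \<theta>\<^sub>j\<^sup>1 + \<i> \<theta>\<^sub>j\<^sup>2\<close>, without the usual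
  factor 1/2.\<close>

definition dbar :: "nat \<Rightarrow> ((nat \<Rightarrow> complex) \<Rightarrow> complex) \<Rightarrow> (nat \<Rightarrow> complex) \<Rightarrow> complex" where
  "dbar j g \<theta> =
     vector_derivative (\<lambda>x::real. g (\<theta>(j := \<theta> j + complex_of_real x))) (at 0) +
     \<i> * vector_derivative (\<lambda>y::real. g (\<theta>(j := \<theta> j + \<i> * complex_of_real y))) (at 0)"

definition phi ::
  "'w measure \<Rightarrow> real \<Rightarrow> nat \<Rightarrow> (nat \<Rightarrow> 'w \<Rightarrow> complex) \<Rightarrow> (nat \<Rightarrow> complex) \<Rightarrow> complex" where
  "phi M \<alpha> n X \<theta> =
     complex_of_real (\<integral>s. cos (Re (\<Sum>i<n. \<theta> i * cnj (cx s i))) \<partial>cspectral_measure M \<alpha> n X)"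

definition cond_A :: "'w measure \<Rightarrow> real \<Rightarrow> (real set \<Rightarrow> 'w \<Rightarrow> complex) \<Rightarrow> bool" where
  "cond_A M \<alpha> D \<longleftrightarrow>
     (\<forall>n\<ge>2. \<forall>A :: nat \<Rightarrow> real set.
        (\<forall>i<n. A i \<in> sets borel) \<longrightarrow> disjoint_family_on A {..<n} \<longrightarrow>
        (\<forall>i<n. \<forall>j<n. \<forall>k<n. \<not> (i = j \<and> j = k) \<longrightarrow>
           (\<forall>\<theta>. dbar i (dbar j (dbar k (phi M \<alpha> n (\<lambda>l. D (A l))))) \<theta> = 0)))"

text \<open>The double sums below are real whenever \<open>F\<close> is the bimeasure of a random measure
  satisfying \<^const>\<open>cond_A\<close>.\<close>

definition cond_BV :: "real \<Rightarrow> (real set \<Rightarrow> real set \<Rightarrow> complex) \<Rightarrow> bool" where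
  "cond_BV \<alpha> F \<longleftrightarrow>
     bdd_above {Re (\<Sum>i<n. \<Sum>j<n. a i * spow (a j) (\<alpha> - 1) * F (A i) (A j)) |
       (n :: nat) (A :: nat \<Rightarrow> real set) (a :: nat \<Rightarrow> complex).
       (\<forall>i<n. A i \<in> sets borel) \<and> disjoint_family_on A {..<n} \<and> (\<forall>i<n. cmod (a i) < 1)}"


section \<open>Morse--Transue integral\<close>

text \<open>The integral of \<open>f\<close> with respect to a complex measure \<open>\<mu>\<close>, given as a set function on the
  Borel sets, is defined through the Jordan decompositions of \<open>Re \<mu>\<close> and \<open>Im \<mu>\<close>; the positive
  variation of a signed measure \<open>\<mu>\<close> is \<open>A \<mapsto> sup {\<mu> B | B \<subseteq> A}\<close>, its negative variation is the
  positive variation of \<open>- \<mu>\<close>. Negative values are cut off by \<^const>\<open>ennreal\<close>, which is harmless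
  as \<open>\<mu> {} = 0\<close>.\<close>

definition pos_variation :: "(real set \<Rightarrow> real) \<Rightarrow> real measure" where
  "pos_variation \<mu> =
     measure_of UNIV (sets borel) (\<lambda>A. SUP B \<in> {B \<in> sets borel. B \<subseteq> A}. ennreal (\<mu> B))"

definition cm_integral :: "(real set \<Rightarrow> complex) \<Rightarrow> (real \<Rightarrow> complex) \<Rightarrow> complex" where
  "cm_integral \<mu> f =
     ((\<integral>x. f x \<partial>pos_variation (\<lambda>A. Re (\<mu> A))) - (\<integral>x. f x \<partial>pos_variation (\<lambda>A. - Re (\<mu> A)))) +
     \<i> * ((\<integral>x. f x \<partial>pos_variation (\<lambda>A. Im (\<mu> A))) - (\<integral>x. f x \<partial>pos_variation (\<lambda>A. - Im (\<mu> A))))"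

definition MT_I1 ::
  "(real set \<Rightarrow> real set \<Rightarrow> complex) \<Rightarrow> (real \<Rightarrow> complex) \<Rightarrow> (real \<Rightarrow> complex) \<Rightarrow> complex" where
  "MT_I1 F f h = cm_integral (\<lambda>B. cm_integral (\<lambda>A. F A B) f) h"

definition MT_I2 ::
  "(real set \<Rightarrow> real set \<Rightarrow> complex) \<Rightarrow> (real \<Rightarrow> complex) \<Rightarrow> (real \<Rightarrow> complex) \<Rightarrow> complex" where
  "MT_I2 F f h = cm_integral (\<lambda>A. cm_integral (\<lambda>B. F A B) h) f"

definition MT_integrable ::
  "(real set \<Rightarrow> real set \<Rightarrow> complex) \<Rightarrow> (real \<Rightarrow> complex) \<Rightarrow> (real \<Rightarrow> complex) \<Rightarrow> bool" where
  "MT_integrable F f h \<longleftrightarrow> MT_I1 F f h = MT_I2 F f h"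

definition MT_integral ::
  "(real set \<Rightarrow> real set \<Rightarrow> complex) \<Rightarrow> (real \<Rightarrow> complex) \<Rightarrow> (real \<Rightarrow> complex) \<Rightarrow> complex" where
  "MT_integral F f h = MT_I1 F f h"


section \<open>Integration with respect to the random measure\<close>

text \<open>As each \<open>D A\<close> is determined only almost surely, the supremum of the uncountable family
  defining the total variation is the supremum in the lattice of random variables modulo
  almost sure equality.\<close>

definition is_ess_sup :: "'w measure \<Rightarrow> ('w \<Rightarrow> ennreal) set \<Rightarrow> ('w \<Rightarrow> ennreal) \<Rightarrow> bool" where
  "is_ess_sup M S v \<longleftrightarrow>
     v \<in> borel_measurable M \<and>
     (\<forall>u\<in>S. AE \<omega> in M. u \<omega> \<le> v \<omega>) \<and>
     (\<forall>w \<in> borel_measurable M. (\<forall>u\<in>S. AE \<omega> in M. u \<omega> \<le> w \<omega>) \<longrightarrow> (AE \<omega> in M. v \<omega> \<le> w \<omega>))"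

definition tot_variation ::
  "'w measure \<Rightarrow> (real set \<Rightarrow> 'w \<Rightarrow> complex) \<Rightarrow> real set \<Rightarrow> 'w \<Rightarrow> ennreal" where
  "tot_variation M D A =
     (SOME v. is_ess_sup M
        {(\<lambda>\<omega>. ennreal (\<Sum>B\<in>P. cmod (D B \<omega>))) | P.
           finite P \<and> P \<subseteq> sets borel \<and> partition_on A P} v)"

definition nu :: "'w measure \<Rightarrow> (real set \<Rightarrow> 'w \<Rightarrow> complex) \<Rightarrow> real measure" where
  "nu M D = measure_of UNIV (sets borel) (\<lambda>A. \<integral>\<^sup>+\<omega>. tot_variation M D A \<omega> \<partial>M)"

definition bounded_support_simple :: "(real \<Rightarrow> complex) \<Rightarrow> bool" where
  "bounded_support_simple f \<longleftrightarrow> simple_function borel f \<and> bounded {x. f x \<noteq> 0}"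

definition simple_integral_rm ::
  "(real set \<Rightarrow> 'w \<Rightarrow> complex) \<Rightarrow> (real \<Rightarrow> complex) \<Rightarrow> 'w \<Rightarrow> complex" where
  "simple_integral_rm D f \<omega> = (\<Sum>z\<in>range f - {0}. z * D (f -` {z}) \<omega>)"

definition L1_approx ::
  "'w measure \<Rightarrow> (real set \<Rightarrow> 'w \<Rightarrow> complex) \<Rightarrow> (nat \<Rightarrow> real \<Rightarrow> complex) \<Rightarrow> (real \<Rightarrow> complex) \<Rightarrow> bool"
  where
  "L1_approx M D \<phi> f \<longleftrightarrow>
     (\<forall>n. bounded_support_simple (\<phi> n)) \<and>
     (\<lambda>n. \<integral>\<^sup>+x. ennreal (cmod (\<phi> n x - f x)) \<partial>nu M D) \<longlonglongrightarrow> 0"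

text \<open>The completion is realised by Borel representatives. Every simple function with bounded
  support belongs to it, also when its \<^const>\<open>nu\<close>-norm is infinite.\<close>

definition Lambda_space ::
  "'w measure \<Rightarrow> (real set \<Rightarrow> 'w \<Rightarrow> complex) \<Rightarrow> (real \<Rightarrow> complex) set" where
  "Lambda_space M D = {f \<in> borel_measurable borel. \<exists>\<phi>. L1_approx M D \<phi> f}"

definition rm_integral ::
  "'w measure \<Rightarrow> (real set \<Rightarrow> 'w \<Rightarrow> complex) \<Rightarrow> (real \<Rightarrow> complex) \<Rightarrow> 'w \<Rightarrow> complex" where
  "rm_integral M D f =
     (SOME Z. Z \<in> borel_measurable M \<and>
        (\<exists>\<phi>. L1_approx M D \<phi> f \<and>
           conv_in_prob M (\<lambda>n. simple_integral_rm D (\<phi> n)) Z sequentially))"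

end

theory Submission
  imports Defs
begin

text \<open>Condition \<open>\<A>\<close> with \<open>i = j \<noteq> k\<close> forces \<open>s\<^sub>i s\<^sub>k = 0\<close> almost everywhere for the spectral measure, so
  \<open>d\<xi>\<close> is independently scattered and \<open>F(A, B) = m(A \<inter> B)\<close> for a finite control measure \<open>m\<close>; both
  iterated integrals are then \<open>\<integral> f g\<^bsup><\<alpha>-1>\<^esup> dm\<close>. For the covariation, \<open>\<nu>\<close> is infinite on every set that
  carries an atomless part of \<open>m\<close>. Hence every \<open>f\<close> in \<open>\<Lambda>\<^sub>\<alpha>(d\<xi>)\<close> takes only countably many values off
  an \<open>m\<close>-null set, and the spectral measure of a pair of integrals is an explicit countable mixture
  of the spectral measures of the cells on which \<open>f\<close> and \<open>g\<close> are constant.\<close>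

section \<open>Rotation averages and the covariation\<close>

text \<open>The law of \<open>D A\<close> need not be invariant under rotation, so its
  characteristic exponent depends on the direction of the frequency and not only on its modulus.
  Hence additivity, homogeneity and limits are established for the exponent at a fixed frequency,
  and only an average over all directions yields m and the covariations. No covariation is ever
  passed to a limit: characteristic functions are, being continuous under convergence in
  probability, and the covariation is read off from them at the end. For a general integrand the
  exponent of the integral would call for a kernel giving a law of directions at m-almost every
  point, that is, for a disintegration of a measure on the line times the circle. The infinitude of
  \<nu> avoids this: with countably many cells, one probability measure of directions per cell is
  enough. The atoms of m are the reason for countably rather than finitely many values: away from
  them an integrand agrees m-almost everywhere with a simple function, while on them its values are
  arbitrary.\<close>

lemma Re_cnj_cis_mult: "Re (cnj (cis \<psi>) * z) = cmod z * cos (\<psi> - Arg2pi z)"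
proof -
  have "z = of_real (cmod z) * cis (Arg2pi z)"
    by (metis Arg2pi_eq cis_conv_exp)
  then have "Re (cnj (cis \<psi>) * z) = Re (cnj (cis \<psi>) * (of_real (cmod z) * cis (Arg2pi z)))"
    by simp
  also have "\<dots> = cmod z * cos (\<psi> - Arg2pi z)"
    by (simp add: cos_diff algebra_simps)
  finally show ?thesis .
qed

text \<open>Translation moves the window to [-\<beta>, 2 pi - \<beta>); its part below 0 is carried
  up by one period. The range of \<beta> is that of \<open>Arg2pi\<close>.\<close>

lemma nn_integral_periodic_shift:
  fixes h :: "real \<Rightarrow> ennreal"
  assumes \<beta>: "0 \<le> \<beta>" "\<beta> \<le> 2 * pi" and [measurable]: "h \<in> borel_measurable borel"
    and per: "\<And>x. h (x + 2 * pi) = h x"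
  shows "(\<integral>\<^sup>+\<psi>. indicator {0..<2 * pi} \<psi> * h (\<psi> - \<beta>) \<partial>lborel)
    = (\<integral>\<^sup>+\<psi>. indicator {0..<2 * pi} \<psi> * h \<psi> \<partial>lborel)"
proof -
  have "(\<integral>\<^sup>+\<psi>. indicator {0..<2 * pi} \<psi> * h (\<psi> - \<beta>) \<partial>lborel)
      = (\<integral>\<^sup>+\<psi>. indicator {0..<2 * pi} (\<beta> + 1 * \<psi>) * h ((\<beta> + 1 * \<psi>) - \<beta>) \<partial>lborel)"
    by (subst nn_integral_real_affine[where c=1 and t=\<beta>]) auto
  also have "\<dots> = (\<integral>\<^sup>+\<psi>. indicator {-\<beta>..<0} \<psi> * h \<psi> + indicator {0..<2 * pi - \<beta>} \<psi> * h \<psi> \<partial>lborel)"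
    using \<beta> by (intro nn_integral_cong) (auto simp: indicator_def)
  also have "\<dots> = (\<integral>\<^sup>+\<psi>. indicator {-\<beta>..<0} \<psi> * h \<psi> \<partial>lborel)
      + (\<integral>\<^sup>+\<psi>. indicator {0..<2 * pi - \<beta>} \<psi> * h \<psi> \<partial>lborel)"
    by (rule nn_integral_add) auto
  also have "(\<integral>\<^sup>+\<psi>. indicator {-\<beta>..<0} \<psi> * h \<psi> \<partial>lborel)
      = (\<integral>\<^sup>+\<psi>. indicator {-\<beta>..<0} (- (2 * pi) + 1 * \<psi>) * h (- (2 * pi) + 1 * \<psi>) \<partial>lborel)"
    by (subst nn_integral_real_affine[where c=1 and t="- (2 * pi)"]) auto
  also have "\<dots> = (\<integral>\<^sup>+\<psi>. indicator {2 * pi - \<beta>..<2 * pi} \<psi> * h \<psi> \<partial>lborel)"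
  proof (intro nn_integral_cong)
    fix \<psi> :: real
    show "indicator {-\<beta>..<0} (- (2 * pi) + 1 * \<psi>) * h (- (2 * pi) + 1 * \<psi>)
      = indicator {2 * pi - \<beta>..<2 * pi} \<psi> * h \<psi>"
      using per[of "\<psi> - 2 * pi"] by (auto simp: indicator_def)
  qed
  also have "\<dots> + (\<integral>\<^sup>+\<psi>. indicator {0..<2 * pi - \<beta>} \<psi> * h \<psi> \<partial>lborel)
     = (\<integral>\<^sup>+\<psi>. indicator {2 * pi - \<beta>..<2 * pi} \<psi> * h \<psi>
          + indicator {0..<2 * pi - \<beta>} \<psi> * h \<psi> \<partial>lborel)"
    by (rule nn_integral_add[symmetric]) auto
  also have "\<dots> = (\<integral>\<^sup>+\<psi>. indicator {0..<2 * pi} \<psi> * h \<psi> \<partial>lborel)"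
    using \<beta> by (intro nn_integral_cong) (auto simp: indicator_def)
  finally show ?thesis .
qed

text \<open>The factor by which averaging over directions turns \<alpha>-th powers of real
  projections into \<alpha>-th powers of moduli. It is cancelled several times in
  \<open>ennreal\<close>, for which it has to be positive and finite.\<close>

definition circle_const :: "real \<Rightarrow> ennreal" where
  "circle_const \<alpha> = (\<integral>\<^sup>+\<psi>. indicator {0..<2 * pi} \<psi> * ennreal (\<bar>cos \<psi>\<bar> powr \<alpha>) \<partial>lborel)"

text \<open>On [0, 1] the cosine is at least cos 1, which is positive because 1 < pi / 2.\<close>

lemma circle_const_pos: "0 < \<alpha> \<Longrightarrow> 0 < circle_const \<alpha>"
proof -
  assume "0 < \<alpha>"
  have c1: "0 < cos (1::real)"
    by (rule cos_gt_zero_pi) (use pi_gt3 in auto)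
  have "0 < (\<integral>\<^sup>+\<psi>. ennreal (cos 1 powr \<alpha>) * indicator {0..1::real} \<psi> \<partial>lborel)"
    using c1 by (subst nn_integral_cmult_indicator) (auto simp: ennreal_zero_less_mult_iff)
  also have "\<dots> \<le> circle_const \<alpha>"
    unfolding circle_const_def
  proof (intro nn_integral_mono)
    fix \<psi> :: real
    show "ennreal (cos 1 powr \<alpha>) * indicator {0..1} \<psi>
      \<le> indicator {0..<2 * pi} \<psi> * ennreal (\<bar>cos \<psi>\<bar> powr \<alpha>)"
    proof (cases "\<psi> \<in> {0..1}")
      case True
      then have "cos 1 \<le> cos \<psi>"
        using pi_gt3 by (intro cos_monotone_0_pi_le) auto
      then have "cos 1 powr \<alpha> \<le> \<bar>cos \<psi>\<bar> powr \<alpha>"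
        using c1 \<open>0 < \<alpha>\<close> by (intro powr_mono2) auto
      then show ?thesis
        using True pi_gt3 by (auto simp: indicator_def intro!: ennreal_leI)
    qed auto
  qed
  finally show ?thesis .
qed

lemma circle_const_finite: "0 < \<alpha> \<Longrightarrow> circle_const \<alpha> < \<infinity>"
proof -
  assume "0 < \<alpha>"
  have "circle_const \<alpha> \<le> (\<integral>\<^sup>+\<psi>. 1 * indicator {0..<2 * pi} \<psi> \<partial>lborel)"
    unfolding circle_const_def using \<open>0 < \<alpha>\<close>
    by (intro nn_integral_mono) (auto simp: indicator_def powr_le1)
  also have "\<dots> < \<infinity>"
    by (subst nn_integral_cmult_indicator) auto
  finally show ?thesis .
qed

text \<open>The projection of z on the direction \<psi> is |z| times a cosine shifted by the
  argument of z, and the shift disappears in the integral over a period.\<close>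

lemma circle_average:
  assumes "0 < \<alpha>"
  shows "(\<integral>\<^sup>+\<psi>. indicator {0..<2 * pi} \<psi> * ennreal (\<bar>Re (cnj (cis \<psi>) * z)\<bar> powr \<alpha>) \<partial>lborel)
    = circle_const \<alpha> * ennreal (cmod z powr \<alpha>)"
proof -
  have "(\<integral>\<^sup>+\<psi>. indicator {0..<2 * pi} \<psi> * ennreal (\<bar>Re (cnj (cis \<psi>) * z)\<bar> powr \<alpha>) \<partial>lborel)
      = (\<integral>\<^sup>+\<psi>. indicator {0..<2 * pi} \<psi>
          * (ennreal (cmod z powr \<alpha>) * ennreal (\<bar>cos (\<psi> - Arg2pi z)\<bar> powr \<alpha>)) \<partial>lborel)"
    unfolding Re_cnj_cis_mult by (simp add: abs_mult powr_mult ennreal_mult)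
  also have "\<dots> = (\<integral>\<^sup>+\<psi>. indicator {0..<2 * pi} \<psi>
          * (ennreal (cmod z powr \<alpha>) * ennreal (\<bar>cos \<psi>\<bar> powr \<alpha>)) \<partial>lborel)"
    using Arg2pi[of z]
    by (intro nn_integral_periodic_shift
        [where h="\<lambda>\<psi>. ennreal (cmod z powr \<alpha>) * ennreal (\<bar>cos \<psi>\<bar> powr \<alpha>)"]) auto
  also have "\<dots> = circle_const \<alpha> * ennreal (cmod z powr \<alpha>)"
    unfolding circle_const_def by (subst nn_integral_multc[symmetric]) (auto simp: ac_simps)
  finally show ?thesis .
qed

text \<open>Mean value theorem, as the dominating bound for the difference quotients in
  \<open>isotropic_derivative\<close>. The endpoint 0 is treated apart because the derivative rule
  for \<open>powr\<close> asks for a positive base.\<close>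

lemma powr_diff_bound:
  fixes a b C \<alpha> :: real
  assumes "1 < \<alpha>" "0 \<le> a" "0 \<le> b" "a \<le> C" "b \<le> C"
  shows "\<bar>a powr \<alpha> - b powr \<alpha>\<bar> \<le> \<alpha> * \<bar>a - b\<bar> * C powr (\<alpha> - 1)"
proof -
  have *: "\<bar>a powr \<alpha> - b powr \<alpha>\<bar> \<le> \<alpha> * \<bar>a - b\<bar> * C powr (\<alpha> - 1)"
    if "0 \<le> a" "a < b" "b \<le> C" for a b :: real
  proof (cases "a = 0")
    case True
    have "b powr \<alpha> = b * b powr (\<alpha> - 1)"
      using that by (simp add: powr_mult_base)
    also have "\<dots> \<le> b * C powr (\<alpha> - 1)"
      using that assms by (intro mult_left_mono powr_mono2) auto
    also have "\<dots> \<le> \<alpha> * b * C powr (\<alpha> - 1)"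
      using that assms by (intro mult_right_mono) auto
    finally show ?thesis using True that by simp
  next
    case False
    then have "0 < a" using that by simp
    have "\<exists>z. a < z \<and> z < b \<and> b powr \<alpha> - a powr \<alpha> = (b - a) * (\<alpha> * z powr (\<alpha> - 1))"
      using \<open>a < b\<close> \<open>0 < a\<close> by (intro MVT2) (auto intro!: has_real_derivative_powr)
    then obtain z where z: "a < z" "z < b" "b powr \<alpha> - a powr \<alpha> = (b - a) * (\<alpha> * z powr (\<alpha> - 1))"
      by blast
    have "z powr (\<alpha> - 1) \<le> C powr (\<alpha> - 1)"
      using z \<open>0 < a\<close> that assms by (intro powr_mono2) auto
    then have "(b - a) * (\<alpha> * z powr (\<alpha> - 1)) \<le> (b - a) * (\<alpha> * C powr (\<alpha> - 1))"
      using that assms by (intro mult_left_mono) auto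
    moreover have "0 \<le> (b - a) * (\<alpha> * z powr (\<alpha> - 1))"
      using that assms by simp
    ultimately show ?thesis using z that by (simp add: algebra_simps)
  qed
  consider "a < b" | "b < a" | "a = b" by linarith
  then show ?thesis
  proof cases
    case 1 then show ?thesis using *[of a b] assms by simp
  next
    case 2 then show ?thesis using *[of b a] assms by (simp add: abs_minus_commute)
  qed auto
qed

text \<open>The origin of the signed power: it is, up to the factor \<alpha>, the gradient of
  |z|^\<alpha>. At z = 0 the quotient has modulus |h|^(\<alpha> - 1) |u|^\<alpha>, which tends to 0
  because \<alpha> > 1.\<close>

lemma cmod_powr_has_derivative:
  assumes \<alpha>: "1 < \<alpha>"
  shows "((\<lambda>r. cmod (z + of_real r * u) powr \<alpha>) has_real_derivative \<alpha> * Re (u * spow z (\<alpha> - 1))) (at 0)"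
proof (cases "z = 0")
  case True
  have "(\<lambda>h::real. (cmod (z + of_real (0 + h) * u) powr \<alpha> - cmod (z + of_real 0 * u) powr \<alpha>) / h) \<midarrow>0\<rightarrow> 0"
  proof (rule tendsto_rabs_zero_cancel, rule Lim_transform_eventually)
    have "((\<lambda>h::real. \<bar>h\<bar> powr (\<alpha> - 1) * cmod u powr \<alpha>) \<longlongrightarrow> \<bar>0\<bar> powr (\<alpha> - 1) * cmod u powr \<alpha>) (at 0)"
      using \<alpha> by (intro tendsto_intros tendsto_powr2) auto
    then show "((\<lambda>h::real. \<bar>h\<bar> powr (\<alpha> - 1) * cmod u powr \<alpha>) \<longlongrightarrow> 0) (at 0)"
      by simp
    show "\<forall>\<^sub>F h::real in at 0. \<bar>h\<bar> powr (\<alpha> - 1) * cmod u powr \<alpha>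
      = \<bar>(cmod (z + of_real (0 + h) * u) powr \<alpha> - cmod (z + of_real 0 * u) powr \<alpha>) / h\<bar>"
      unfolding eventually_at_filter using True
      by (auto simp: norm_mult powr_mult powr_diff abs_mult)
  qed
  then show ?thesis
    using True by (simp add: DERIV_def spow_def)
next
  case False
  have "((\<lambda>r. cmod (z + of_real r * u)) has_derivative (\<lambda>r. (z \<bullet> (of_real r * u)) / cmod z)) (at 0)"
  proof -
    have "((\<lambda>r. norm (z + of_real r * u)) has_derivative
       (\<lambda>r. (of_real r * u) \<bullet> sgn (z + of_real 0 * u))) (at 0)"
      by (rule has_derivative_compose[where g=norm and f="\<lambda>r. z + of_real r * u" and s=UNIV,
            OF _ has_derivative_norm, simplified inner_commute])
         (use False in \<open>auto intro!: derivative_eq_intros\<close>)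
    moreover have "(of_real r * u) \<bullet> sgn z = (z \<bullet> (of_real r * u)) / cmod z" for r
      by (simp add: sgn_div_norm inner_commute divide_inverse)
    ultimately show ?thesis by simp
  qed
  then have d: "((\<lambda>r. cmod (z + of_real r * u)) has_real_derivative (Re (u * cnj z) / cmod z)) (at 0)"
    by (rule has_derivative_imp_has_field_derivative) (auto simp: inner_complex_def algebra_simps)
  have "((\<lambda>r. cmod (z + of_real r * u) powr \<alpha>) has_real_derivative
     \<alpha> * cmod z powr (\<alpha> - 1) * (Re (u * cnj z) / cmod z)) (at 0)"
    using False DERIV_fun_powr[OF d, of \<alpha>] by simp
  moreover have "cmod z powr (\<alpha> - 1) * (Re (u * cnj z) / cmod z) = Re (u * spow z (\<alpha> - 1))"
  proof -
    have "cmod z powr (\<alpha> - 1) / cmod z = cmod z powr (\<alpha> - 1 - 1)"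
      using False powr_diff[of "cmod z" "\<alpha> - 1" 1] by simp
    moreover have "Re (u * spow z (\<alpha> - 1)) = cmod z powr (\<alpha> - 1 - 1) * Re (u * cnj z)"
      unfolding spow_def by (simp add: algebra_simps)
    ultimately show ?thesis by (simp only: times_divide_eq_right times_divide_eq_left[symmetric])
  qed
  ultimately show ?thesis by (simp only: mult.assoc)
qed

section \<open>Algebra and measurability of the signed power\<close>

lemma cmod_spow: "cmod (spow z \<beta>) = cmod z powr \<beta>"
  by (cases "z = 0") (auto simp: spow_def norm_mult norm_divide powr_diff)

text \<open>The conjugation inside \<open>spow\<close> makes this product real. It turns the
  covariation of a variable with itself into a total mass and removes unimodular factors common to
  both arguments.\<close>

lemma mult_spow_self: "z * spow z (\<alpha> - 1) = of_real (cmod z powr \<alpha>)"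
proof (cases "z = 0")
  case False
  have "z * spow z (\<alpha> - 1) = of_real (cmod z powr (\<alpha> - 2)) * of_real ((cmod z)\<^sup>2)"
  proof -
    have "\<alpha> - 1 - 1 = \<alpha> - 2" by simp
    then show ?thesis by (simp only: spow_def complex_norm_square mult.left_commute)
  qed
  also have "\<dots> = of_real (cmod z powr (\<alpha> - 2) * cmod z powr 2)"
  proof -
    have "(cmod z)\<^sup>2 = cmod z powr 2" using False by simp
    then show ?thesis by (simp only: of_real_mult)
  qed
  also have "\<dots> = of_real (cmod z powr \<alpha>)"
    by (simp only: powr_add[symmetric]) simp
  finally show ?thesis .
qed (simp add: spow_def)

lemma spow_mult: "spow (z * w) \<beta> = spow z \<beta> * spow w \<beta>"
  by (simp add: spow_def norm_mult powr_mult)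

lemma cnj_measurable [measurable (raw)]:
  "f \<in> borel_measurable M \<Longrightarrow> (\<lambda>x. cnj (f x)) \<in> borel_measurable M"
  by (rule borel_measurable_continuous_on) (auto intro: continuous_intros)

lemma spow_measurable [measurable (raw)]:
  assumes [measurable]: "f \<in> borel_measurable M"
  shows "(\<lambda>x. spow (f x) \<beta>) \<in> borel_measurable M"
  unfolding spow_def by measurable

lemma cx_measurable [measurable]:
  assumes "2 * j + 1 < d"
  shows "(\<lambda>s. cx s j) \<in> borel_measurable (Pi\<^sub>M {..<d} (\<lambda>_. borel))"
proof -
  have [measurable]: "(\<lambda>s. s (2 * j)) \<in> borel_measurable (Pi\<^sub>M {..<d} (\<lambda>_. borel :: real measure))"
    "(\<lambda>s. s (2 * j + 1)) \<in> borel_measurable (Pi\<^sub>M {..<d} (\<lambda>_. borel :: real measure))"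
    using assms by (auto intro!: measurable_component_singleton)
  show ?thesis unfolding cx_def Complex_eq by measurable
qed

text \<open>\<open>circle_average\<close> under the integral, with the order of integration
  exchanged. The right side tests the pair (p, q) at the frequencies
  \<open>cnj u * cis \<psi>\<close> and \<open>cis \<psi>\<close> only, so the left side is
  determined by the logarithm of the joint characteristic function.\<close>

lemma isotropic_average:
  fixes p q :: "'e \<Rightarrow> complex"
  assumes \<alpha>: "0 < \<alpha>" and "finite_measure \<mu>"
    and [measurable]: "p \<in> borel_measurable \<mu>" "q \<in> borel_measurable \<mu>"
    and bd: "\<And>e. e \<in> space \<mu> \<Longrightarrow> cmod (p e) \<le> B" "\<And>e. e \<in> space \<mu> \<Longrightarrow> cmod (q e) \<le> B"
  shows "circle_const \<alpha> * ennreal (\<integral>e. cmod (q e + u * p e) powr \<alpha> \<partial>\<mu>)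
    = (\<integral>\<^sup>+\<psi>. indicator {0..<2 * pi} \<psi> * ennreal (\<integral>e. \<bar>Re (cnj (cnj u * cis \<psi>) * p e
         + cnj (cis \<psi>) * q e)\<bar> powr \<alpha> \<partial>\<mu>) \<partial>lborel)"
proof -
  interpret finite_measure \<mu> by fact
  interpret P: pair_sigma_finite \<mu> lborel
    by (intro pair_sigma_finite.intro sigma_finite_measure_axioms lborel.sigma_finite_measure_axioms)
  define K where "K = B + cmod u * B"
  have [measurable]: "cis \<in> borel_measurable borel"
    by (intro borel_measurable_continuous_onI continuous_intros)
  have K: "cmod (q e + u * p e) \<le> K" if "e \<in> space \<mu>" for e
    unfolding K_def using bd[OF that]
    by (intro norm_triangle_le add_mono) (auto simp: norm_mult intro!: mult_left_mono)
  have i1: "integrable \<mu> (\<lambda>e. cmod (q e + u * p e) powr \<alpha>)"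
    using K \<alpha> by (intro integrable_const_bound[where B="K powr \<alpha>"] AE_I2) (auto intro!: powr_mono2)
  have eq: "cnj (cnj u * cis \<psi>) * p e + cnj (cis \<psi>) * q e = cnj (cis \<psi>) * (q e + u * p e)" for \<psi> e
    by (simp add: algebra_simps)
  have K2: "\<bar>Re (cnj (cis \<psi>) * (q e + u * p e))\<bar> \<le> K" if "e \<in> space \<mu>" for e \<psi>
    using K[OF that] abs_Re_le_cmod[of "cnj (cis \<psi>) * (q e + u * p e)"] by (simp add: norm_mult)
  have i2: "integrable \<mu> (\<lambda>e. \<bar>Re (cnj (cis \<psi>) * (q e + u * p e))\<bar> powr \<alpha>)" for \<psi>
    using K2 \<alpha> by (intro integrable_const_bound[where B="K powr \<alpha>"] AE_I2) (auto intro!: powr_mono2)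
  have "circle_const \<alpha> * ennreal (\<integral>e. cmod (q e + u * p e) powr \<alpha> \<partial>\<mu>)
      = (\<integral>\<^sup>+e. circle_const \<alpha> * ennreal (cmod (q e + u * p e) powr \<alpha>) \<partial>\<mu>)"
    by (subst nn_integral_eq_integral[OF i1, symmetric]) (auto simp: nn_integral_cmult)
  also have "\<dots> = (\<integral>\<^sup>+e. \<integral>\<^sup>+\<psi>. indicator {0..<2 * pi} \<psi>
      * ennreal (\<bar>Re (cnj (cis \<psi>) * (q e + u * p e))\<bar> powr \<alpha>) \<partial>lborel \<partial>\<mu>)"
    by (simp only: circle_average[OF \<alpha>])
  also have "\<dots> = (\<integral>\<^sup>+\<psi>. \<integral>\<^sup>+e. indicator {0..<2 * pi} \<psi>
      * ennreal (\<bar>Re (cnj (cis \<psi>) * (q e + u * p e))\<bar> powr \<alpha>) \<partial>\<mu> \<partial>lborel)"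
    by (rule P.Fubini'[symmetric]) measurable
  also have "\<dots> = (\<integral>\<^sup>+\<psi>. indicator {0..<2 * pi} \<psi> * ennreal (\<integral>e. \<bar>Re (cnj (cnj u * cis \<psi>) * p e
         + cnj (cis \<psi>) * q e)\<bar> powr \<alpha> \<partial>\<mu>) \<partial>lborel)"
    unfolding eq
    by (intro nn_integral_cong, subst nn_integral_cmult, measurable)
       (subst nn_integral_eq_integral[OF i2], auto)
  finally show ?thesis .
qed

text \<open>Differentiation under the integral at u = 0 in the direction w. The increments are r w
  with r = 1 / (n + 1), so that dominated convergence for sequences applies; K bounds the modulus of
  both arguments of the power, and \<open>powr_diff_bound\<close> supplies the dominating
  constant.\<close>

lemma isotropic_derivative:
  fixes p q :: "'e \<Rightarrow> complex"
  assumes \<alpha>: "1 < \<alpha>" and "finite_measure \<mu>"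
    and [measurable]: "p \<in> borel_measurable \<mu>" "q \<in> borel_measurable \<mu>"
    and bd: "\<And>e. e \<in> space \<mu> \<Longrightarrow> cmod (p e) \<le> B" "\<And>e. e \<in> space \<mu> \<Longrightarrow> cmod (q e) \<le> B"
  shows "(\<lambda>n. real (Suc n) * ((\<integral>e. cmod (q e + (of_real (inverse (real (Suc n))) * w) * p e) powr \<alpha> \<partial>\<mu>)
      - (\<integral>e. cmod (q e) powr \<alpha> \<partial>\<mu>)))
    \<longlonglongrightarrow> \<alpha> * Re (w * (\<integral>e. p e * spow (q e) (\<alpha> - 1) \<partial>\<mu>))"
proof -
  interpret finite_measure \<mu> by fact
  define K where "K = B + cmod w * B"
  let ?r = "\<lambda>n. inverse (real (Suc n))"
  let ?h = "\<lambda>n e. real (Suc n) * (cmod (q e + of_real (?r n) * (w * p e)) powr \<alpha> - cmod (q e) powr \<alpha>)"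
  have K: "cmod (q e + of_real (?r n) * (w * p e)) \<le> K" "cmod (q e) \<le> K"
    if "e \<in> space \<mu>" for e n
  proof -
    have B: "0 \<le> B" using bd[OF that] norm_ge_zero order_trans by blast
    have "cmod (of_real (?r n) * (w * p e)) \<le> 1 * (cmod w * B)"
      unfolding norm_mult norm_of_real using bd[OF that]
      by (intro mult_mono) (auto simp: inverse_le_1_iff)
    then show "cmod (q e + of_real (?r n) * (w * p e)) \<le> K"
      unfolding K_def using bd[OF that] by (intro norm_triangle_le add_mono) auto
    show "cmod (q e) \<le> K" unfolding K_def using bd[OF that] B by (simp add: add_increasing2)
  qed
  have i1: "integrable \<mu> (\<lambda>e. cmod (q e + of_real (?r n) * (w * p e)) powr \<alpha>)" for n
    using K \<alpha> by (intro integrable_const_bound[where B="K powr \<alpha>"] AE_I2) (auto intro!: powr_mono2)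
  have i2: "integrable \<mu> (\<lambda>e. cmod (q e) powr \<alpha>)"
    using K \<alpha> by (intro integrable_const_bound[where B="K powr \<alpha>"] AE_I2) (auto intro!: powr_mono2)
  have i3: "integrable \<mu> (\<lambda>e. p e * spow (q e) (\<alpha> - 1))"
  proof (intro integrable_const_bound[where B="B * K powr (\<alpha> - 1)"] AE_I2)
    fix e assume e: "e \<in> space \<mu>"
    have B: "0 \<le> B" using bd[OF e] norm_ge_zero order_trans by blast
    show "cmod (p e * spow (q e) (\<alpha> - 1)) \<le> B * K powr (\<alpha> - 1)"
      unfolding norm_mult cmod_spow using bd[OF e] K[OF e] \<alpha> B by (intro mult_mono powr_mono2) auto
  qed auto
  have "(\<lambda>n. \<integral>e. ?h n e \<partial>\<mu>) \<longlonglongrightarrow> (\<integral>e. \<alpha> * Re ((w * p e) * spow (q e) (\<alpha> - 1)) \<partial>\<mu>)"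
  proof (rule integral_dominated_convergence[where w="\<lambda>_. \<alpha> * (cmod w * B) * K powr (\<alpha> - 1)"])
    show "AE e in \<mu>. (\<lambda>n. ?h n e) \<longlonglongrightarrow> \<alpha> * Re ((w * p e) * spow (q e) (\<alpha> - 1))"
    proof (rule AE_I2)
      fix e
      have "(\<lambda>h. (cmod (q e + of_real (0 + h) * (w * p e)) powr \<alpha> - cmod (q e + of_real 0 * (w * p e)) powr \<alpha>) / h)
         \<midarrow>0\<rightarrow> \<alpha> * Re ((w * p e) * spow (q e) (\<alpha> - 1))"
        using cmod_powr_has_derivative[OF \<alpha>, of "q e" "w * p e"] by (simp only: DERIV_def)
      then have "(\<lambda>n. (cmod (q e + of_real (0 + ?r n) * (w * p e)) powr \<alpha> - cmod (q e + of_real 0 * (w * p e)) powr \<alpha>) / ?r n)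
         \<longlonglongrightarrow> \<alpha> * Re ((w * p e) * spow (q e) (\<alpha> - 1))"
        by (rule filterlim_compose) (intro filterlim_atI LIMSEQ_inverse_real_of_nat, auto)
      then show "(\<lambda>n. ?h n e) \<longlonglongrightarrow> \<alpha> * Re ((w * p e) * spow (q e) (\<alpha> - 1))"
        by (simp add: divide_inverse mult.commute)
    qed
    show "AE e in \<mu>. norm (?h n e) \<le> \<alpha> * (cmod w * B) * K powr (\<alpha> - 1)" for n
    proof (rule AE_I2)
      fix e assume e: "e \<in> space \<mu>"
      have "\<bar>cmod (q e + of_real (?r n) * (w * p e)) powr \<alpha> - cmod (q e) powr \<alpha>\<bar>
        \<le> \<alpha> * \<bar>cmod (q e + of_real (?r n) * (w * p e)) - cmod (q e)\<bar> * K powr (\<alpha> - 1)"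
        by (intro powr_diff_bound) (use K[OF e] \<alpha> in auto)
      also have "\<dots> \<le> \<alpha> * (?r n * (cmod w * B)) * K powr (\<alpha> - 1)"
      proof (intro mult_right_mono mult_left_mono)
        have "\<bar>cmod (q e + of_real (?r n) * (w * p e)) - cmod (q e)\<bar>
          \<le> cmod (of_real (?r n) * (w * p e))"
          using norm_triangle_ineq3[of "q e + of_real (?r n) * (w * p e)" "q e"] by simp
        also have "\<dots> \<le> ?r n * (cmod w * B)"
          unfolding norm_mult norm_of_real using bd[OF e] by (intro mult_mono) auto
        finally show "\<bar>cmod (q e + of_real (?r n) * (w * p e)) - cmod (q e)\<bar> \<le> ?r n * (cmod w * B)" .
      qed (use \<alpha> in auto)
      finally have "\<bar>cmod (q e + of_real (?r n) * (w * p e)) powr \<alpha> - cmod (q e) powr \<alpha>\<bar>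
        \<le> ?r n * (\<alpha> * (cmod w * B) * K powr (\<alpha> - 1))" by (simp add: algebra_simps)
      moreover have "m * x \<le> y" if "0 < m" "x \<le> inverse m * y" for m x y :: real
        using that by (simp add: field_simps)
      ultimately show "norm (?h n e) \<le> \<alpha> * (cmod w * B) * K powr (\<alpha> - 1)"
        unfolding real_norm_def abs_mult by simp
    qed
  qed auto
  also have "(\<integral>e. \<alpha> * Re ((w * p e) * spow (q e) (\<alpha> - 1)) \<partial>\<mu>)
      = \<alpha> * Re (\<integral>e. w * (p e * spow (q e) (\<alpha> - 1)) \<partial>\<mu>)"
    using i3 by (simp only: mult.assoc integral_mult_right_zero integral_Re integrable_mult_right)
  also have "\<dots> = \<alpha> * Re (w * (\<integral>e. p e * spow (q e) (\<alpha> - 1) \<partial>\<mu>))"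
    using i3 by simp
  finally show ?thesis
    using i1 i2 by (simp add: mult.assoc)
qed

text \<open>The logarithm of the characteristic function determines the covariation: averaging it over
  rotations gives \<open>\<integral> |q + u p|\<^sup>\<alpha>\<close>, and the derivative at \<open>u = 0\<close> of the latter is the covariation.
  In particular the uniqueness of the spectral measure is never used.\<close>

lemma covariation_integral_unique:
  fixes p q :: "'e \<Rightarrow> complex" and p' q' :: "'f \<Rightarrow> complex"
  assumes \<alpha>: "1 < \<alpha>" and \<mu>: "finite_measure \<mu>" and \<mu>': "finite_measure \<mu>'"
    and pq: "p \<in> borel_measurable \<mu>" "q \<in> borel_measurable \<mu>"
    and pq': "p' \<in> borel_measurable \<mu>'" "q' \<in> borel_measurable \<mu>'"
    and bd: "\<And>e. e \<in> space \<mu> \<Longrightarrow> cmod (p e) \<le> B" "\<And>e. e \<in> space \<mu> \<Longrightarrow> cmod (q e) \<le> B"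
    and bd': "\<And>e. e \<in> space \<mu>' \<Longrightarrow> cmod (p' e) \<le> B'" "\<And>e. e \<in> space \<mu>' \<Longrightarrow> cmod (q' e) \<le> B'"
    and eq: "\<And>\<theta>1 \<theta>2. (\<integral>e. \<bar>Re (cnj \<theta>1 * p e + cnj \<theta>2 * q e)\<bar> powr \<alpha> \<partial>\<mu>)
      = (\<integral>e. \<bar>Re (cnj \<theta>1 * p' e + cnj \<theta>2 * q' e)\<bar> powr \<alpha> \<partial>\<mu>')"
  shows "(\<integral>e. p e * spow (q e) (\<alpha> - 1) \<partial>\<mu>) = (\<integral>e. p' e * spow (q' e) (\<alpha> - 1) \<partial>\<mu>')"
proof -
  have c: "circle_const \<alpha> * ennreal (\<integral>e. cmod (q e + u * p e) powr \<alpha> \<partial>\<mu>)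
     = circle_const \<alpha> * ennreal (\<integral>e. cmod (q' e + u * p' e) powr \<alpha> \<partial>\<mu>')" for u
    using isotropic_average[OF _ \<mu> pq bd, of \<alpha> u] isotropic_average[OF _ \<mu>' pq' bd', of \<alpha> u] \<alpha>
    by (simp only: eq)
  have I: "(\<integral>e. cmod (q e + u * p e) powr \<alpha> \<partial>\<mu>) = (\<integral>e. cmod (q' e + u * p' e) powr \<alpha> \<partial>\<mu>')" for u
    using c[of u] circle_const_pos[of \<alpha>] circle_const_finite[of \<alpha>] \<alpha>
    by (auto simp: ennreal_mult_cancel_left ennreal_inj)
  have R: "Re (w * (\<integral>e. p e * spow (q e) (\<alpha> - 1) \<partial>\<mu>)) = Re (w * (\<integral>e. p' e * spow (q' e) (\<alpha> - 1) \<partial>\<mu>'))" for w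
  proof -
    have "\<alpha> * Re (w * (\<integral>e. p e * spow (q e) (\<alpha> - 1) \<partial>\<mu>)) = \<alpha> * Re (w * (\<integral>e. p' e * spow (q' e) (\<alpha> - 1) \<partial>\<mu>'))"
      using isotropic_derivative[OF \<alpha> \<mu> pq bd, of w] isotropic_derivative[OF \<alpha> \<mu>' pq' bd', of w] I I[of 0]
      by (intro LIMSEQ_unique) auto
    then show ?thesis using \<alpha> by simp
  qed
  \<comment> \<open>The direction w = 1 compares the real parts, w = -\<i> the imaginary
    parts.\<close>
  show ?thesis using R[of 1] R[of "-\<i>"] by (simp add: complex_eq_iff)
qed

section \<open>Spectral measures of pairs\<close>

definition sphere_algebra :: "nat \<Rightarrow> (nat \<Rightarrow> real) measure" where
  "sphere_algebra d = restrict_space (Pi\<^sub>M {..<d} (\<lambda>_. borel)) (unit_sphere d)"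

lemma space_sphere_algebra: "space (sphere_algebra d) = unit_sphere d"
  unfolding sphere_algebra_def space_restrict_space by (auto simp: unit_sphere_def)

lemma cx_measurable_sphere:
  assumes "sets \<Gamma> = sets (sphere_algebra d)" "2 * j + 1 < d"
  shows "(\<lambda>s. cx s j) \<in> borel_measurable \<Gamma>"
proof -
  have "(\<lambda>s. cx s j) \<in> borel_measurable (sphere_algebra d)"
    unfolding sphere_algebra_def using assms(2) by (intro measurable_restrict_space1 cx_measurable)
  then show ?thesis by (simp only: measurable_cong_sets[OF assms(1) refl])
qed

lemma cmod_cx_le_1:
  assumes "s \<in> unit_sphere d" "2 * j + 1 < d"
  shows "cmod (cx s j) \<le> 1"
proof -
  have "(s (2 * j))\<^sup>2 + (s (2 * j + 1))\<^sup>2 = (\<Sum>i\<in>{2 * j, 2 * j + 1}. (s i)\<^sup>2)"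
    by simp
  also have "\<dots> \<le> (\<Sum>i<d. (s i)\<^sup>2)"
    using assms by (intro sum_mono2) auto
  also have "\<dots> = 1" using assms by (simp add: unit_sphere_def)
  finally show ?thesis by (simp add: cx_def cmod_def real_le_lsqrt)
qed

lemma sum_double: "(\<Sum>i<2 * n. f i) = (\<Sum>j<n. f (2 * j) + f (2 * j + 1 :: nat))"
  for f :: "nat \<Rightarrow> real"
  by (induction n) auto

text \<open>The dictionary between real frequencies t and complex frequencies \<open>cx t j\<close>.
  The real inner product becomes the real part of a Hermitian one, whence the conjugates on all
  frequencies below.\<close>

lemma sum_real_parts: "(\<Sum>i<2 * n. t i * real_parts X i \<omega>) = Re (\<Sum>j<n. cnj (cx t j) * X j \<omega>)"
  unfolding sum_double by (simp add: real_parts_def cx_def)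

lemma sum_sphere: "(\<Sum>i<2 * n. t i * s i) = Re (\<Sum>j<n. cnj (cx t j) * cx s j)"
  unfolding sum_double by (simp add: cx_def)

text \<open>The spectral measure of a pair of stable variables whose characteristic function is
  represented by functions \<open>p, q\<close> on an arbitrary measure space is the image of
  \<open>(|p|\<^sup>2 + |q|\<^sup>2)\<^bsup>\<alpha>/2\<^esup> \<mu>\<close> under the radial projection of \<open>(p, q)\<close>, made symmetric by a random sign.\<close>

lemma spectral_measure_pair_exists:
  fixes X Y :: "'w \<Rightarrow> complex" and p q :: "'e \<Rightarrow> complex"
  assumes \<alpha>: "1 < \<alpha>" and \<mu>: "finite_measure \<mu>"
    and [measurable]: "p \<in> borel_measurable \<mu>" "q \<in> borel_measurable \<mu>"
    and bd: "\<And>e. e \<in> space \<mu> \<Longrightarrow> cmod (p e) \<le> B" "\<And>e. e \<in> space \<mu> \<Longrightarrow> cmod (q e) \<le> B"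
    and cf: "\<And>\<theta>1 \<theta>2. (\<integral>\<omega>. iexp (Re (cnj \<theta>1 * X \<omega> + cnj \<theta>2 * Y \<omega>)) \<partial>M)
      = of_real (exp (- (\<integral>e. \<bar>Re (cnj \<theta>1 * p e + cnj \<theta>2 * q e)\<bar> powr \<alpha> \<partial>\<mu>)))"
  shows "\<exists>\<Gamma>. is_spectral_measure M \<alpha> 4 (real_parts (\<lambda>i. if i = 0 then X else Y)) \<Gamma>"
proof -
  interpret \<mu>: finite_measure \<mu> by fact
  define n where "n e = sqrt ((cmod (p e))\<^sup>2 + (cmod (q e))\<^sup>2)" for e
  \<comment> \<open>Where p and q both vanish there is no direction, and the first basis vector
    stands in so that \<open>\<sigma>\<close> always lies on the sphere. The density n^\<alpha>
    gives these points no weight.\<close>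
  define v where "v e i = (if n e = 0 then of_bool (i = 0) else
    (if i = 0 then Re (p e) else if i = 1 then Im (p e) else if i = 2 then Re (q e) else Im (q e)) / n e)"
    for e and i :: nat
  define S where "S = sphere_algebra 4"
  define B2 where "B2 = measure_pmf (pmf_of_set (UNIV :: bool set))"
  define sg where "sg b = (if b then 1 else - 1 :: real)" for b
  define \<sigma> where "\<sigma> x = (\<lambda>i\<in>{..<4}. sg (snd x) * v (fst x) i)" for x :: "'e \<times> bool"
  define D where "D = density (\<mu> \<Otimes>\<^sub>M B2) (\<lambda>x. ennreal (n (fst x) powr \<alpha>))"
  define \<Gamma> where "\<Gamma> = distr D S \<sigma>"
  have [measurable]: "n \<in> borel_measurable \<mu>"
    unfolding n_def by measurable
  have [measurable]: "(\<lambda>e. v e i) \<in> borel_measurable \<mu>" for i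
    unfolding v_def by measurable
  have [measurable]: "sg \<in> borel_measurable B2"
    by (simp add: B2_def)
  interpret B2: prob_space B2
    unfolding B2_def by (rule measure_pmf.prob_space_axioms)
  interpret P: pair_sigma_finite \<mu> B2
    by (intro pair_sigma_finite.intro \<mu>.sigma_finite_measure_axioms B2.sigma_finite_measure_axioms)
  have n_nz: "(\<Sum>i<4. (v e i)\<^sup>2) = 1" for e
  proof (cases "n e = 0")
    case False
    have n2: "(n e)\<^sup>2 = (Re (p e))\<^sup>2 + (Im (p e))\<^sup>2 + (Re (q e))\<^sup>2 + (Im (q e))\<^sup>2"
      by (simp add: n_def cmod_power2)
    have "(\<Sum>i<4. (v e i)\<^sup>2) = ((Re (p e))\<^sup>2 + (Im (p e))\<^sup>2 + (Re (q e))\<^sup>2 + (Im (q e))\<^sup>2) / (n e)\<^sup>2"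
      using False by (simp add: v_def numeral_eq_Suc power_divide add_divide_distrib)
    also have "\<dots> = 1" unfolding n2[symmetric] using False by simp
    finally show ?thesis .
  qed (simp add: v_def numeral_eq_Suc)
  have \<sigma>_sphere: "\<sigma> x \<in> unit_sphere 4" for x
  proof -
    have "(\<Sum>i<4. (\<sigma> x i)\<^sup>2) = (\<Sum>i<4. (v (fst x) i)\<^sup>2)"
      unfolding \<sigma>_def by (intro sum.cong) (auto simp: sg_def)
    then show ?thesis using n_nz by (simp add: unit_sphere_def \<sigma>_def space_PiM)
  qed
  have \<sigma>_meas [measurable]: "\<sigma> \<in> measurable (\<mu> \<Otimes>\<^sub>M B2) S"
    unfolding S_def sphere_algebra_def
  proof (rule measurable_restrict_space2)
    show "\<sigma> \<in> measurable (\<mu> \<Otimes>\<^sub>M B2) (Pi\<^sub>M {..<4} (\<lambda>_. borel))"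
      unfolding \<sigma>_def by (rule measurable_restrict) measurable
  qed (use \<sigma>_sphere in auto)
  have \<sigma>_meas_D [measurable]: "\<sigma> \<in> measurable D S"
    unfolding D_def by simp
  have n_bd: "n e \<le> 2 * B" if "e \<in> space \<mu>" for e
  proof -
    have "0 \<le> B" using bd[OF that] norm_ge_zero order_trans by blast
    have "n e \<le> cmod (p e) + cmod (q e)"
      unfolding n_def by (rule sqrt_sum_squares_le_sum) auto
    then show ?thesis using bd[OF that] by simp
  qed
  have n_nonneg: "0 \<le> n e" for e by (simp add: n_def)
  have fin: "finite_measure \<Gamma>"
  proof (rule finite_measureI)
    have "emeasure \<Gamma> (space \<Gamma>) = emeasure D (space D)"
      unfolding \<Gamma>_def by (subst emeasure_distr) (auto simp: space_PiM intro!: arg_cong2[where f=emeasure]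
         dest: measurable_space[OF \<sigma>_meas_D])
    also have "\<dots> = (\<integral>\<^sup>+x. ennreal (n (fst x) powr \<alpha>) \<partial>(\<mu> \<Otimes>\<^sub>M B2))"
      unfolding D_def by (subst emeasure_density) (auto intro!: nn_integral_cong)
    also have "\<dots> \<le> (\<integral>\<^sup>+x. ennreal ((2 * B) powr \<alpha>) \<partial>(\<mu> \<Otimes>\<^sub>M B2))"
      using n_bd n_nonneg \<alpha> by (intro nn_integral_mono) (auto simp: space_pair_measure intro!: ennreal_leI powr_mono2)
    also have "\<dots> = ennreal ((2 * B) powr \<alpha>) * emeasure \<mu> (space \<mu>)"
      by (simp add: space_pair_measure B2.emeasure_pair_measure_Times B2.emeasure_space_1)
    also have "\<dots> < \<infinity>" by (simp add: less_top[symmetric] ennreal_mult_eq_top_iff)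
    finally show "emeasure \<Gamma> (space \<Gamma>) \<noteq> \<infinity>" by simp
  qed
  have sets: "sets \<Gamma> = sets S" by (simp add: \<Gamma>_def)
  have neg_meas: "(\<lambda>s. \<lambda>i\<in>{..<4}. - s i) \<in> measurable S S"
    unfolding S_def sphere_algebra_def
  proof (intro measurable_restrict_space2 measurable_restrict_space1)
    show "(\<lambda>s. \<lambda>i\<in>{..<4}. - s i) \<in> measurable (Pi\<^sub>M {..<4} (\<lambda>_. borel :: real measure)) (Pi\<^sub>M {..<4} (\<lambda>_. borel))"
      by (rule measurable_restrict) measurable
  qed (auto simp: unit_sphere_def space_PiM space_restrict_space)
  \<comment> \<open>With the sign integrated out, the measure is an average of two terms, which
    negation of the sphere interchanges; symmetry is then commutativity of addition.\<close>
  have em: "emeasure \<Gamma> A = (\<integral>\<^sup>+e. ennreal (n e powr \<alpha>)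
        * ((indicator A (\<sigma> (e, True)) + indicator A (\<sigma> (e, False))) / 2) \<partial>\<mu>)"
    if A [measurable]: "A \<in> sets S" for A
  proof -
    have "emeasure \<Gamma> A = emeasure D (\<sigma> -` A \<inter> space D)"
      unfolding \<Gamma>_def by (rule emeasure_distr) measurable
    also have "\<dots> = (\<integral>\<^sup>+x. ennreal (n (fst x) powr \<alpha>) * indicator A (\<sigma> x) \<partial>(\<mu> \<Otimes>\<^sub>M B2))"
      unfolding D_def by (subst emeasure_density) (auto intro!: nn_integral_cong simp: indicator_def measurable_sets[OF \<sigma>_meas])
    also have "\<dots> = (\<integral>\<^sup>+e. \<integral>\<^sup>+b. ennreal (n e powr \<alpha>) * indicator A (\<sigma> (e, b)) \<partial>B2 \<partial>\<mu>)"
      by (subst B2.nn_integral_fst[symmetric]) auto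
    also have "\<dots> = (\<integral>\<^sup>+e. ennreal (n e powr \<alpha>)
        * ((indicator A (\<sigma> (e, True)) + indicator A (\<sigma> (e, False))) / 2) \<partial>\<mu>)"
      unfolding B2_def
      by (intro nn_integral_cong, subst nn_integral_cmult)
         (auto simp: nn_integral_pmf_of_set UNIV_bool add.commute)
    finally show ?thesis .
  qed
  have neg_\<sigma>: "(\<lambda>i\<in>{..<4}. - \<sigma> (e, b) i) = \<sigma> (e, \<not> b)" for e b
    by (auto simp: \<sigma>_def sg_def restrict_def)
  have sym: "distr \<Gamma> \<Gamma> (\<lambda>s. \<lambda>i\<in>{..<4}. - s i) = \<Gamma>"
  proof (rule measure_eqI)
    fix A assume "A \<in> sets (distr \<Gamma> \<Gamma> (\<lambda>s. \<lambda>i\<in>{..<4}. - s i))"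
    then have A [measurable]: "A \<in> sets S" by (simp add: sets)
    have nm: "(\<lambda>s. \<lambda>i\<in>{..<4}. - s i) \<in> measurable \<Gamma> \<Gamma>"
      using neg_meas by (simp only: measurable_cong_sets[OF sets sets])
    let ?A = "(\<lambda>s. \<lambda>i\<in>{..<4}. - s i) -` A \<inter> space S"
    have A': "?A \<in> sets S"
      by (rule measurable_sets[OF neg_meas A])
    have spc: "\<sigma> x \<in> space S" for x using \<sigma>_sphere by (simp add: S_def space_sphere_algebra)
    have ind: "indicator ?A (\<sigma> (e, b)) = (indicator A (\<sigma> (e, \<not> b)) :: ennreal)" for e b
      using spc by (simp add: indicator_def neg_\<sigma>)
    have "emeasure (distr \<Gamma> \<Gamma> (\<lambda>s. \<lambda>i\<in>{..<4}. - s i)) A = emeasure \<Gamma> ?A"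
      using A by (subst emeasure_distr[OF nm]) (auto simp: sets sets_eq_imp_space_eq[OF sets])
    also have "\<dots> = emeasure \<Gamma> A"
      unfolding em[OF A] em[OF A'] by (simp add: ind add.commute)
    finally show "emeasure (distr \<Gamma> \<Gamma> (\<lambda>s. \<lambda>i\<in>{..<4}. - s i)) A = emeasure \<Gamma> A" .
  qed simp
  have int: "(\<integral>s. \<bar>\<Sum>i<4. t i * s i\<bar> powr \<alpha> \<partial>\<Gamma>)
      = (\<integral>e. \<bar>Re (cnj (cx t 0) * p e + cnj (cx t 1) * q e)\<bar> powr \<alpha> \<partial>\<mu>)" for t
  proof -
    have [measurable]: "(\<lambda>s. \<bar>\<Sum>i<4. t i * s i\<bar> powr \<alpha>) \<in> borel_measurable S"
    proof -
      have "(\<lambda>s. s i) \<in> borel_measurable (Pi\<^sub>M {..<4} (\<lambda>_. borel :: real measure))" if "i \<in> {..<4}" for i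
        using that by (intro measurable_component_singleton)
      then have "(\<lambda>s. \<Sum>i<4. t i * s i) \<in> borel_measurable (Pi\<^sub>M {..<4} (\<lambda>_. borel :: real measure))"
        by (intro borel_measurable_sum borel_measurable_times) auto
      then have "(\<lambda>s. \<Sum>i<4. t i * s i) \<in> borel_measurable S"
        unfolding S_def sphere_algebra_def by (rule measurable_restrict_space1)
      then show ?thesis by measurable
    qed
    \<comment> \<open>By homogeneity of degree \<alpha>, the density cancels the normalization of
      the direction, and the sign is lost in the absolute value.\<close>
    have pt: "n e powr \<alpha> * \<bar>\<Sum>i<4. t i * \<sigma> (e, b) i\<bar> powr \<alpha>
        = \<bar>Re (cnj (cx t 0) * p e + cnj (cx t 1) * q e)\<bar> powr \<alpha>" for e b
    proof (cases "n e = 0")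
      case True
      then have "p e = 0 \<and> q e = 0"
        by (simp add: n_def add_nonneg_eq_0_iff)
      then show ?thesis using True by simp
    next
      case False
      then have np: "0 < n e" using n_nonneg[of e] by simp
      have "(\<Sum>i<4. t i * \<sigma> (e, b) i) = sg b * (Re (cnj (cx t 0) * p e + cnj (cx t 1) * q e) / n e)"
        using False
        by (simp add: \<sigma>_def v_def numeral_eq_Suc cx_def add_divide_distrib algebra_simps)
      then have "\<bar>\<Sum>i<4. t i * \<sigma> (e, b) i\<bar> = \<bar>Re (cnj (cx t 0) * p e + cnj (cx t 1) * q e)\<bar> / n e"
        using np by (simp add: abs_mult sg_def)
      then show ?thesis using np by (simp add: powr_divide)
    qed
    have "(\<integral>s. \<bar>\<Sum>i<4. t i * s i\<bar> powr \<alpha> \<partial>\<Gamma>) = (\<integral>x. \<bar>\<Sum>i<4. t i * \<sigma> x i\<bar> powr \<alpha> \<partial>D)"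
      unfolding \<Gamma>_def by (rule integral_distr) measurable
    also have "\<dots> = (\<integral>x. n (fst x) powr \<alpha> * \<bar>\<Sum>i<4. t i * \<sigma> x i\<bar> powr \<alpha> \<partial>(\<mu> \<Otimes>\<^sub>M B2))"
      unfolding D_def by (subst integral_density) (auto intro!: measurable_compose[OF \<sigma>_meas])
    also have "\<dots> = (\<integral>x. \<bar>Re (cnj (cx t 0) * p (fst x) + cnj (cx t 1) * q (fst x))\<bar> powr \<alpha> \<partial>(\<mu> \<Otimes>\<^sub>M B2))"
      using pt by (intro Bochner_Integration.integral_cong) (auto simp: split_paired_all)
    also have "\<dots> = (\<integral>e. \<bar>Re (cnj (cx t 0) * p e + cnj (cx t 1) * q e)\<bar> powr \<alpha> \<partial>distr (\<mu> \<Otimes>\<^sub>M B2) \<mu> fst)"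
      by (rule integral_distr[symmetric]) measurable
    also have "distr (\<mu> \<Otimes>\<^sub>M B2) \<mu> fst = \<mu>"
      by (rule B2.distr_pair_fst)
    finally show ?thesis .
  qed
  have sr: "(\<Sum>i<4. t i * real_parts (\<lambda>i. if i = 0 then X else Y) i \<omega>)
      = Re (cnj (cx t 0) * X \<omega> + cnj (cx t 1) * Y \<omega>)" for t \<omega>
    using sum_real_parts[of t "\<lambda>i. if i = 0 then X else Y" \<omega> 2] by (simp add: numeral_eq_Suc)
  have "is_spectral_measure M \<alpha> 4 (real_parts (\<lambda>i. if i = 0 then X else Y)) \<Gamma>"
    unfolding is_spectral_measure_def
  proof (intro conjI allI)
    show "sets \<Gamma> = sets (restrict_space (Pi\<^sub>M {..<4} (\<lambda>_. borel)) (unit_sphere 4))"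
      using sets by (simp add: S_def sphere_algebra_def)
    show "(\<integral>\<omega>. iexp (\<Sum>i<4. t i * real_parts (\<lambda>i. if i = 0 then X else Y) i \<omega>) \<partial>M)
      = of_real (exp (- (\<integral>s. \<bar>\<Sum>i<4. t i * s i\<bar> powr \<alpha> \<partial>\<Gamma>)))" for t
      unfolding sr int by (rule cf)
  qed (fact fin sym)+
  then show ?thesis by blast
qed

lemma is_spectral_measureD:
  assumes "is_spectral_measure M \<alpha> (2 * n) (real_parts X) \<Gamma>"
  shows "sets \<Gamma> = sets (sphere_algebra (2 * n))" "finite_measure \<Gamma>" "space \<Gamma> = unit_sphere (2 * n)"
    "(\<integral>\<omega>. iexp (Re (\<Sum>j<n. cnj (\<theta> j) * X j \<omega>)) \<partial>M)
      = of_real (exp (- (\<integral>s. \<bar>Re (\<Sum>j<n. cnj (\<theta> j) * cx s j)\<bar> powr \<alpha> \<partial>\<Gamma>)))"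
proof -
  show s: "sets \<Gamma> = sets (sphere_algebra (2 * n))" and "finite_measure \<Gamma>"
    using assms by (auto simp: is_spectral_measure_def sphere_algebra_def)
  show "space \<Gamma> = unit_sphere (2 * n)"
    using sets_eq_imp_space_eq[OF s] by (simp add: space_sphere_algebra)
  define t where "t k = (if even k then Re (\<theta> (k div 2)) else Im (\<theta> (k div 2)))" for k
  have t: "cx t j = \<theta> j" for j
    by (simp add: cx_def t_def)
  show "(\<integral>\<omega>. iexp (Re (\<Sum>j<n. cnj (\<theta> j) * X j \<omega>)) \<partial>M)
      = of_real (exp (- (\<integral>s. \<bar>Re (\<Sum>j<n. cnj (\<theta> j) * cx s j)\<bar> powr \<alpha> \<partial>\<Gamma>)))"
    using assms unfolding is_spectral_measure_def sum_real_parts sum_sphere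
    by (elim conjE allE[of _ t]) (simp add: t)
qed

text \<open>\<open>spectral_measure_pair_exists\<close> ensures that the \<open>SOME\<close> in the
  definition picks a genuine spectral measure. Whichever one it is, it has the same exponent as (p,
  q), and \<open>covariation_integral_unique\<close> concludes. Every covariation below is computed
  in this way, from a representation (p, q) suited to the case.\<close>

lemma covariation_eq_integral:
  fixes X Y :: "'w \<Rightarrow> complex" and p q :: "'e \<Rightarrow> complex"
  assumes \<alpha>: "1 < \<alpha>" and \<mu>: "finite_measure \<mu>"
    and pq: "p \<in> borel_measurable \<mu>" "q \<in> borel_measurable \<mu>"
    and bd: "\<And>e. e \<in> space \<mu> \<Longrightarrow> cmod (p e) \<le> B" "\<And>e. e \<in> space \<mu> \<Longrightarrow> cmod (q e) \<le> B"
    and cf: "\<And>\<theta>1 \<theta>2. (\<integral>\<omega>. iexp (Re (cnj \<theta>1 * X \<omega> + cnj \<theta>2 * Y \<omega>)) \<partial>M)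
      = of_real (exp (- (\<integral>e. \<bar>Re (cnj \<theta>1 * p e + cnj \<theta>2 * q e)\<bar> powr \<alpha> \<partial>\<mu>)))"
  shows "covariation M \<alpha> X Y = (\<integral>e. p e * spow (q e) (\<alpha> - 1) \<partial>\<mu>)"
proof -
  define Z where "Z i = (if i = 0 then X else Y)" for i :: nat
  define \<Gamma> where "\<Gamma> = cspectral_measure M \<alpha> 2 Z"
  have "\<exists>\<Gamma>. is_spectral_measure M \<alpha> (2 * 2) (real_parts Z) \<Gamma>"
    unfolding Z_def using spectral_measure_pair_exists[OF assms] by simp
  then have sp: "is_spectral_measure M \<alpha> (2 * 2) (real_parts Z) \<Gamma>"
    unfolding \<Gamma>_def cspectral_measure_def spectral_measure_def by (rule someI_ex)
  note D = is_spectral_measureD[OF sp]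
  have eq: "(\<integral>s. \<bar>Re (cnj \<theta>1 * cx s 0 + cnj \<theta>2 * cx s 1)\<bar> powr \<alpha> \<partial>\<Gamma>)
     = (\<integral>e. \<bar>Re (cnj \<theta>1 * p e + cnj \<theta>2 * q e)\<bar> powr \<alpha> \<partial>\<mu>)" for \<theta>1 \<theta>2
  proof -
    have "complex_of_real (exp (- (\<integral>s. \<bar>Re (cnj \<theta>1 * cx s 0 + cnj \<theta>2 * cx s 1)\<bar> powr \<alpha> \<partial>\<Gamma>)))
      = complex_of_real (exp (- (\<integral>e. \<bar>Re (cnj \<theta>1 * p e + cnj \<theta>2 * q e)\<bar> powr \<alpha> \<partial>\<mu>)))"
      unfolding cf[of \<theta>1 \<theta>2, symmetric] using D(4)[of "\<lambda>j. if j = 0 then \<theta>1 else \<theta>2"]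
      by (simp add: numeral_eq_Suc Z_def)
    then show ?thesis by (simp only: of_real_eq_iff exp_inj_iff neg_equal_iff_equal)
  qed
  have "covariation M \<alpha> X Y = (\<integral>s. cx s 0 * spow (cx s 1) (\<alpha> - 1) \<partial>\<Gamma>)"
    unfolding covariation_def \<Gamma>_def Z_def ..
  also have "\<dots> = (\<integral>e. p e * spow (q e) (\<alpha> - 1) \<partial>\<mu>)"
    using D(3) cmod_cx_le_1
    by (intro covariation_integral_unique[OF \<alpha> D(2) \<mu> _ _ pq _ _ bd eq, where B=1] cx_measurable_sphere[OF D(1)])
       auto
  finally show ?thesis .
qed

section \<open>Vanishing third derivatives\<close>

text \<open>The derivative of the cosine is written as a phase shift by pi / 2, so that repeated
  differentiation stays within cosines. The bound is the second-order remainder of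
  \<open>iexp h\<close>, rotated by \<open>cis a\<close>.\<close>

lemma cos_quadratic_bound:
  "\<bar>cos (a + h) - cos a - h * cos (a + pi / 2)\<bar> \<le> h\<^sup>2" for a h :: real
proof -
  have "cos (a + h) - cos a - h * cos (a + pi / 2) = Re (cis a * (iexp h - (1 + \<i> * h)))"
    by (simp add: cis_conv_exp[symmetric] cos_add algebra_simps)
  also have "\<bar>\<dots>\<bar> \<le> cmod (cis a * (iexp h - (1 + \<i> * h)))"
    by (rule abs_Re_le_cmod)
  also have "\<dots> = cmod (iexp h - (1 + \<i> * h))" by (simp add: norm_mult)
  also have "\<dots> \<le> 2 * cmod (iexp h - (1 + \<i> * h))" by simp
  also have "\<dots> \<le> h\<^sup>2" using iexp_approx1[of h 1] by (simp add: power2_eq_square mult.commute)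
  finally show ?thesis .
qed

text \<open>A family closed under \<open>dbar\<close> and under its conjugate: each derivative
  multiplies the weight c by a coordinate or by its conjugate and adds pi / 2 to the phase k. The
  function \<open>phi\<close> is the member with weight 1 and phase 0.\<close>

definition cos_integral ::
  "'e measure \<Rightarrow> nat \<Rightarrow> (nat \<Rightarrow> 'e \<Rightarrow> complex) \<Rightarrow> ('e \<Rightarrow> complex) \<Rightarrow> real \<Rightarrow> (nat \<Rightarrow> complex) \<Rightarrow> complex"
  where "cos_integral \<mu> n x c k \<theta>
    = (\<integral>e. c e * of_real (cos (Re (\<Sum>i<n. \<theta> i * cnj (x i e)) + k)) \<partial>\<mu>)"

text \<open>The directions w = 1 and w = \<i> are the two partial derivatives that make up
  \<open>dbar\<close>. Integrating \<open>cos_quadratic_bound\<close> bounds the error of the linear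
  approximation by a constant times the square of the increment.\<close>

lemma cos_integral_has_vector_derivative:
  assumes "finite_measure \<mu>" and x: "\<And>i. i < n \<Longrightarrow> x i \<in> borel_measurable \<mu>"
    and [measurable]: "c \<in> borel_measurable \<mu>"
    and bd: "\<And>i e. i < n \<Longrightarrow> e \<in> space \<mu> \<Longrightarrow> cmod (x i e) \<le> 1"
    and c: "\<And>e. e \<in> space \<mu> \<Longrightarrow> cmod (c e) \<le> 1"
    and j: "j < n"
  shows "((\<lambda>r. cos_integral \<mu> n x c k (\<theta>(j := \<theta> j + w * of_real r))) has_vector_derivative
    (\<integral>e. c e * of_real (Re (w * cnj (x j e))) * of_real (cos (Re (\<Sum>i<n. \<theta> i * cnj (x i e)) + (k + pi / 2))) \<partial>\<mu>)) (at 0)"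
proof -
  interpret finite_measure \<mu> by fact
  define L where "L e = Re (\<Sum>i<n. \<theta> i * cnj (x i e)) + k" for e
  define b where "b e = Re (w * cnj (x j e))" for e
  have [measurable]: "L \<in> borel_measurable \<mu>" "x j \<in> borel_measurable \<mu>"
    unfolding L_def using x j by (auto intro!: borel_measurable_sum borel_measurable_times cnj_measurable borel_measurable_add measurable_compose[OF _ borel_measurable_Re])
  have [measurable]: "b \<in> borel_measurable \<mu>" unfolding b_def by measurable
  have b: "\<bar>b e\<bar> \<le> cmod w" if "e \<in> space \<mu>" for e
  proof -
    have "\<bar>b e\<bar> \<le> cmod w * cmod (x j e)"
      unfolding b_def using abs_Re_le_cmod[of "w * cnj (x j e)"] by (simp add: norm_mult)
    also have "\<dots> \<le> cmod w * 1" using bd[OF j that] by (intro mult_left_mono) auto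
    finally show ?thesis by simp
  qed
  have sh: "Re (\<Sum>i<n. (\<theta>(j := \<theta> j + w * of_real r)) i * cnj (x i e)) + k = L e + r * b e" for r e
  proof -
    have "(\<Sum>i<n. (\<theta>(j := \<theta> j + w * of_real r)) i * cnj (x i e))
      = (\<Sum>i<n. \<theta> i * cnj (x i e) + (if i = j then of_real r * (w * cnj (x j e)) else 0))"
      by (intro sum.cong) (auto simp: algebra_simps)
    also have "\<dots> = (\<Sum>i<n. \<theta> i * cnj (x i e)) + of_real r * (w * cnj (x j e))"
      using j by (simp add: sum.distrib)
    finally show ?thesis
      by (simp add: L_def b_def algebra_simps)
  qed
  have i1: "integrable \<mu> (\<lambda>e. c e * of_real (cos (L e + r * b e)))" for r
    using c by (intro integrable_const_bound[where B=1] AE_I2) (auto simp: norm_mult intro!: mult_le_one)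
  have i2: "integrable \<mu> (\<lambda>e. c e * of_real (b e) * of_real (cos (L e + pi / 2)))"
  proof (intro integrable_const_bound[where B="cmod w"] AE_I2)
    fix e assume e: "e \<in> space \<mu>"
    have "cmod (c e * of_real (b e) * of_real (cos (L e + pi / 2))) \<le> 1 * cmod w * 1"
      unfolding norm_mult norm_of_real using c[OF e] b[OF e] by (intro mult_mono) auto
    then show "cmod (c e * of_real (b e) * of_real (cos (L e + pi / 2))) \<le> cmod w" by simp
  qed measurable
  define V where "V = measure \<mu> (space \<mu>)"
  define I' where "I' = (\<integral>e. c e * of_real (b e) * of_real (cos (L e + pi / 2)) \<partial>\<mu>)"
  define J where "J r = (\<integral>e. c e * of_real (cos (L e + r * b e)) \<partial>\<mu>)" for r
  have est: "cmod (J r - J 0 - r *\<^sub>R I') \<le> r\<^sup>2 * ((cmod w)\<^sup>2 * V)" for r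
  proof -
    let ?d = "\<lambda>e. c e * of_real (cos (L e + r * b e)) - c e * of_real (cos (L e))
        - of_real r * (c e * of_real (b e) * of_real (cos (L e + pi / 2)))"
    have J: "J r - J 0 - r *\<^sub>R I' = (\<integral>e. ?d e \<partial>\<mu>)"
      using i1[of r] i1[of 0] i2 by (simp add: J_def I'_def scaleR_conv_of_real)
    have "cmod (J r - J 0 - r *\<^sub>R I') \<le> (\<integral>e. cmod (?d e) \<partial>\<mu>)"
      unfolding J by (rule integral_norm_bound)
    also have "\<dots> \<le> (\<integral>e. (r * cmod w)\<^sup>2 \<partial>\<mu>)"
    proof (rule integral_mono)
      fix e assume e: "e \<in> space \<mu>"
      have "?d e = c e * of_real (cos (L e + r * b e) - cos (L e) - (r * b e) * cos (L e + pi / 2))"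
        by (simp only: of_real_diff of_real_mult right_diff_distrib mult.assoc mult.left_commute)
      then have "cmod (?d e) = cmod (c e) * \<bar>cos (L e + r * b e) - cos (L e) - (r * b e) * cos (L e + pi / 2)\<bar>"
        unfolding norm_of_real[symmetric, where 'a=complex] norm_mult[symmetric] by (rule arg_cong)
      also have "\<dots> \<le> 1 * (r * b e)\<^sup>2"
        using c[OF e] by (intro mult_mono cos_quadratic_bound) auto
      also have "\<dots> \<le> (r * cmod w)\<^sup>2"
        using mult_left_mono[OF b[OF e] abs_ge_zero[of r]]
        by (simp only: mult_1 abs_le_square_iff[symmetric] abs_mult abs_norm_cancel)
      finally show "cmod (?d e) \<le> (r * cmod w)\<^sup>2" .
    next
      have "integrable \<mu> (\<lambda>e. c e * of_real (cos (L e)))" using i1[of 0] by simp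
      then show "integrable \<mu> (\<lambda>e. cmod (?d e))"
        by (intro integrable_norm Bochner_Integration.integrable_diff integrable_mult_right i1 i2)
    qed simp
    also have "\<dots> = r\<^sup>2 * ((cmod w)\<^sup>2 * V)" by (simp add: V_def power_mult_distrib)
    finally show ?thesis .
  qed
  have "(J has_vector_derivative I') (at 0)"
    unfolding has_vector_derivative_def has_derivative_def
  proof (intro conjI bounded_linear_scaleR_left)
    show "((\<lambda>y. ((J y - J (netlimit (at 0))) - (y - netlimit (at 0)) *\<^sub>R I') /\<^sub>R norm (y - netlimit (at 0))) \<longlongrightarrow> 0) (at 0)"
    proof (rule Lim_null_comparison)
      show "\<forall>\<^sub>F y in at 0. norm (((J y - J (netlimit (at 0))) - (y - netlimit (at 0)) *\<^sub>R I') /\<^sub>R norm (y - netlimit (at 0)))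
        \<le> \<bar>y\<bar> * ((cmod w)\<^sup>2 * V)"
        unfolding eventually_at_filter
      proof (intro always_eventually allI impI)
        fix y :: real assume "y \<noteq> 0"
        have "norm ((J y - J 0 - y *\<^sub>R I') /\<^sub>R \<bar>y\<bar>) = cmod (J y - J 0 - y *\<^sub>R I') / \<bar>y\<bar>"
          by (simp add: divide_inverse)
        also have "\<dots> \<le> (y\<^sup>2 * ((cmod w)\<^sup>2 * V)) / \<bar>y\<bar>"
          by (rule divide_right_mono[OF est]) simp
        also have "\<dots> = \<bar>y\<bar> * ((cmod w)\<^sup>2 * V)"
          using \<open>y \<noteq> 0\<close> by (simp add: power2_eq_square abs_if)
        finally show "norm (((J y - J (netlimit (at 0))) - (y - netlimit (at 0)) *\<^sub>R I') /\<^sub>R norm (y - netlimit (at 0)))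
        \<le> \<bar>y\<bar> * ((cmod w)\<^sup>2 * V)" by simp
      qed
      show "((\<lambda>y. \<bar>y\<bar> * ((cmod w)\<^sup>2 * V)) \<longlongrightarrow> 0) (at 0)"
        by (auto intro!: tendsto_eq_intros)
    qed
  qed
  then show ?thesis
    unfolding cos_integral_def sh J_def I'_def b_def[symmetric] by (simp add: L_def add.assoc)
qed

text \<open>The derivatives in the directions 1 and \<i> bring down the real and the imaginary part
  of x_j; added with factor \<i> they form x_j, subtracted they form its conjugate. The conjugate
  derivative can be applied to an identity valid for all \<theta>, which is why vanishing everywhere
  is assumed in the second claim.\<close>

lemma
  assumes \<mu>: "finite_measure \<mu>" and x: "\<And>i. i < n \<Longrightarrow> x i \<in> borel_measurable \<mu>"
    and c_meas [measurable]: "c \<in> borel_measurable \<mu>"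
    and bd: "\<And>i e. i < n \<Longrightarrow> e \<in> space \<mu> \<Longrightarrow> cmod (x i e) \<le> 1"
    and c: "\<And>e. e \<in> space \<mu> \<Longrightarrow> cmod (c e) \<le> 1"
    and j: "j < n"
  shows dbar_cos_integral:
      "dbar j (cos_integral \<mu> n x c k) = cos_integral \<mu> n x (\<lambda>e. c e * x j e) (k + pi / 2)"
    and cos_integral_eq_0_conj:
      "(\<And>\<theta>. cos_integral \<mu> n x c k \<theta> = 0) \<Longrightarrow>
        cos_integral \<mu> n x (\<lambda>e. c e * cnj (x j e)) (k + pi / 2) \<theta> = 0"
proof -
  interpret finite_measure \<mu> by fact
  note der = cos_integral_has_vector_derivative[where x=x and n=n and k=k, OF \<mu> x c_meas bd c j]
  let ?C = "\<lambda>\<theta> e. of_real (cos (Re (\<Sum>i<n. \<theta> i * cnj (x i e)) + (k + pi / 2))) :: complex"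
  have [measurable]: "x j \<in> borel_measurable \<mu>" using x j by simp
  have [measurable]: "?C \<theta> \<in> borel_measurable \<mu>" for \<theta>
  proof -
    have [measurable]: "(\<lambda>e. \<Sum>i<n. \<theta> i * cnj (x i e)) \<in> borel_measurable \<mu>"
      using x by (auto intro!: borel_measurable_sum borel_measurable_times cnj_measurable)
    show ?thesis by measurable
  qed
  have int: "integrable \<mu> (\<lambda>e. c e * of_real (Re (w * cnj (x j e))) * ?C \<theta> e)" for w \<theta>
  proof (intro integrable_const_bound[where B="cmod w"] AE_I2)
    fix e assume e: "e \<in> space \<mu>"
    have "\<bar>Re (w * cnj (x j e))\<bar> \<le> cmod w * cmod (x j e)"
      using abs_Re_le_cmod[of "w * cnj (x j e)"] by (simp add: norm_mult)
    also have "\<dots> \<le> cmod w * 1" using bd[OF j e] by (intro mult_left_mono) auto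
    finally have "cmod (c e * of_real (Re (w * cnj (x j e))) * ?C \<theta> e) \<le> 1 * cmod w * 1"
      unfolding norm_mult norm_of_real using c[OF e] by (intro mult_mono) auto
    then show "cmod (c e * of_real (Re (w * cnj (x j e))) * ?C \<theta> e) \<le> cmod w" by simp
  qed measurable
  have x_Re: "x j e = of_real (Re (1 * cnj (x j e))) + \<i> * of_real (Re (\<i> * cnj (x j e)))"
    and x_cnj: "cnj (x j e) = of_real (Re (1 * cnj (x j e))) - \<i> * of_real (Re (\<i> * cnj (x j e)))" for e
    by (simp_all add: complex_eq_iff)
  show "dbar j (cos_integral \<mu> n x c k) = cos_integral \<mu> n x (\<lambda>e. c e * x j e) (k + pi / 2)"
  proof
    fix \<theta>
    have "dbar j (cos_integral \<mu> n x c k) \<theta>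
      = (\<integral>e. c e * of_real (Re (1 * cnj (x j e))) * ?C \<theta> e \<partial>\<mu>)
        + \<i> * (\<integral>e. c e * of_real (Re (\<i> * cnj (x j e))) * ?C \<theta> e \<partial>\<mu>)"
      unfolding dbar_def using vector_derivative_at[OF der[where \<theta>=\<theta> and w=1]] vector_derivative_at[OF der[where \<theta>=\<theta> and w=\<i>]]
      by simp
    also have "\<dots> = (\<integral>e. c e * of_real (Re (1 * cnj (x j e))) * ?C \<theta> e
        + \<i> * (c e * of_real (Re (\<i> * cnj (x j e))) * ?C \<theta> e) \<partial>\<mu>)"
      by (subst Bochner_Integration.integral_add[OF int integrable_mult_right[OF int]]) simp
    also have "\<dots> = cos_integral \<mu> n x (\<lambda>e. c e * x j e) (k + pi / 2) \<theta>"
      unfolding cos_integral_def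
      by (intro Bochner_Integration.integral_cong refl, rule sym, subst x_Re) (simp only: algebra_simps)
    finally show "dbar j (cos_integral \<mu> n x c k) \<theta> = cos_integral \<mu> n x (\<lambda>e. c e * x j e) (k + pi / 2) \<theta>" .
  qed
  assume z: "\<And>\<theta>. cos_integral \<mu> n x c k \<theta> = 0"
  have zw: "(\<integral>e. c e * of_real (Re (w * cnj (x j e))) * ?C \<theta> e \<partial>\<mu>) = 0" for w
    using vector_derivative_at[OF der[where \<theta>=\<theta> and w=w]] by (simp only: z vector_derivative_const_at)
  have "cos_integral \<mu> n x (\<lambda>e. c e * cnj (x j e)) (k + pi / 2) \<theta>
      = (\<integral>e. c e * of_real (Re (1 * cnj (x j e))) * ?C \<theta> e
        - \<i> * (c e * of_real (Re (\<i> * cnj (x j e))) * ?C \<theta> e) \<partial>\<mu>)"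
    unfolding cos_integral_def
    by (intro Bochner_Integration.integral_cong refl, subst x_cnj) (simp only: algebra_simps)
  also have "\<dots> = 0"
    by (subst Bochner_Integration.integral_diff[OF int integrable_mult_right[OF int]]) (simp only: integral_mult_right_zero zw, simp)
  finally show "cos_integral \<mu> n x (\<lambda>e. c e * cnj (x j e)) (k + pi / 2) \<theta> = 0" .
qed

text \<open>Condition \<open>\<A>\<close> with \<open>i = j = a\<close>, \<open>k = b\<close> says that \<open>\<integral> s\<^sub>a\<^sup>2 s\<^sub>b sin (Re \<langle>\<theta>, s\<rangle>) d\<Gamma>\<close> vanishes
  identically; three conjugate derivatives at \<open>\<theta> = 0\<close> give \<open>\<integral> |s\<^sub>a|\<^sup>4 |s\<^sub>b|\<^sup>2 d\<Gamma> = 0\<close>.\<close>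

lemma AE_products_zero:
  assumes \<mu>: "finite_measure \<mu>" and x: "\<And>i. i < n \<Longrightarrow> x i \<in> borel_measurable \<mu>"
    and bd: "\<And>i e. i < n \<Longrightarrow> e \<in> space \<mu> \<Longrightarrow> cmod (x i e) \<le> 1"
    and ab: "a < n" "b < n"
    and d: "\<And>\<theta>. dbar a (dbar a (dbar b (\<lambda>\<theta>. of_real (\<integral>e. cos (Re (\<Sum>i<n. \<theta> i * cnj (x i e))) \<partial>\<mu>)))) \<theta> = 0"
  shows "AE e in \<mu>. x a e * x b e = 0"
proof -
  interpret finite_measure \<mu> by fact
  have [measurable]: "x a \<in> borel_measurable \<mu>" "x b \<in> borel_measurable \<mu>" using x ab by auto
  note le = bd[OF ab(1)] bd[OF ab(2)]
  have bnd: "cmod (u * v) \<le> 1" if "cmod u \<le> 1" "cmod v \<le> 1" for u v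
    using that by (simp add: norm_mult mult_le_one)
  have dd: "dbar j (cos_integral \<mu> n x c k) = cos_integral \<mu> n x (\<lambda>e. c e * x j e) (k + pi / 2)"
    if "c \<in> borel_measurable \<mu>" "\<And>e. e \<in> space \<mu> \<Longrightarrow> cmod (c e) \<le> 1" "j < n" for c k j
    by (rule dbar_cos_integral[OF \<mu>]) (use x bd that in auto)
  have cc: "cos_integral \<mu> n x (\<lambda>e. c e * cnj (x j e)) (k + pi / 2) \<theta> = 0"
    if "c \<in> borel_measurable \<mu>" "\<And>e. e \<in> space \<mu> \<Longrightarrow> cmod (c e) \<le> 1" "j < n"
      "\<And>\<theta>. cos_integral \<mu> n x c k \<theta> = 0" for c k j \<theta>
    by (rule cos_integral_eq_0_conj[OF \<mu>]) (use x bd that in auto)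
  have 0: "(\<lambda>\<theta>. of_real (\<integral>e. cos (Re (\<Sum>i<n. \<theta> i * cnj (x i e))) \<partial>\<mu>)) = cos_integral \<mu> n x (\<lambda>_. 1) 0"
    by (auto simp: cos_integral_def)
  have 1: "dbar b (cos_integral \<mu> n x (\<lambda>_. 1) 0) = cos_integral \<mu> n x (\<lambda>e. 1 * x b e) (0 + pi / 2)"
    using ab by (intro dd) auto
  have 2: "dbar a (cos_integral \<mu> n x (\<lambda>e. 1 * x b e) (0 + pi / 2))
    = cos_integral \<mu> n x (\<lambda>e. 1 * x b e * x a e) (0 + pi / 2 + pi / 2)"
    using ab le by (intro dd) auto
  have 3: "dbar a (cos_integral \<mu> n x (\<lambda>e. 1 * x b e * x a e) (0 + pi / 2 + pi / 2))
    = cos_integral \<mu> n x (\<lambda>e. 1 * x b e * x a e * x a e) (0 + pi / 2 + pi / 2 + pi / 2)"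
    by (rule dd) (measurable, use ab le in \<open>intro bnd; simp\<close>, use ab in simp)
  have z0: "cos_integral \<mu> n x (\<lambda>e. 1 * x b e * x a e * x a e) (0 + pi / 2 + pi / 2 + pi / 2) \<theta> = 0" for \<theta>
    using d[of \<theta>] unfolding 0 1 2 3 .
  \<comment> \<open>Conjugate derivatives in b, a and a pair each factor with its conjugate.\<close>
  have z1: "cos_integral \<mu> n x (\<lambda>e. 1 * x b e * x a e * x a e * cnj (x b e))
      (0 + pi / 2 + pi / 2 + pi / 2 + pi / 2) \<theta> = 0" for \<theta>
    by (rule cc[OF _ _ _ z0]) (measurable, use ab le in \<open>intro bnd; simp\<close>, use ab in simp)
  have z2: "cos_integral \<mu> n x (\<lambda>e. 1 * x b e * x a e * x a e * cnj (x b e) * cnj (x a e))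
      (0 + pi / 2 + pi / 2 + pi / 2 + pi / 2 + pi / 2) \<theta> = 0" for \<theta>
    by (rule cc[OF _ _ _ z1]) (measurable, use ab le in \<open>intro bnd; simp\<close>, use ab in simp)
  have "cos_integral \<mu> n x (\<lambda>e. 1 * x b e * x a e * x a e * cnj (x b e) * cnj (x a e) * cnj (x a e))
      (0 + pi / 2 + pi / 2 + pi / 2 + pi / 2 + pi / 2 + pi / 2) \<theta> = 0" for \<theta>
    by (rule cc[OF _ _ _ z2]) (measurable, use ab le in \<open>intro bnd; simp\<close>, use ab in simp)
  from this[of "\<lambda>_. 0"] have "(\<integral>e. 1 * x b e * x a e * x a e * cnj (x b e) * cnj (x a e) * cnj (x a e)
      * of_real (cos (0 + pi / 2 + pi / 2 + pi / 2 + pi / 2 + pi / 2 + pi / 2)) \<partial>\<mu>) = 0"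
    unfolding cos_integral_def by simp
  \<comment> \<open>Six derivatives shift the phase by 3 pi in total, and at \<theta> = 0 nothing
    else is left in the cosine.\<close>
  moreover have "cos (0 + pi / 2 + pi / 2 + pi / 2 + pi / 2 + pi / 2 + pi / 2) = -1"
    using cos_periodic_pi[of "2 * pi"] by simp
  moreover have "1 * x b e * x a e * x a e * cnj (x b e) * cnj (x a e) * cnj (x a e) * of_real (-1)
     = of_real (- ((cmod (x b e) * cmod (x a e) * cmod (x a e))\<^sup>2))" for e
  proof -
    have "1 * x b e * x a e * x a e * cnj (x b e) * cnj (x a e) * cnj (x a e)
      = (x b e * x a e * x a e) * cnj (x b e * x a e * x a e)" by (simp add: algebra_simps)
    also have "\<dots> = of_real ((cmod (x b e * x a e * x a e))\<^sup>2)" by (simp only: complex_norm_square)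
    finally show ?thesis by (simp add: norm_mult)
  qed
  ultimately have "(\<integral>e. complex_of_real (- ((cmod (x b e) * cmod (x a e) * cmod (x a e))\<^sup>2)) \<partial>\<mu>) = 0"
    by (simp only:)
  then have "(\<integral>e. (cmod (x b e) * cmod (x a e) * cmod (x a e))\<^sup>2 \<partial>\<mu>) = 0"
    unfolding integral_complex_of_real by simp
  moreover have "integrable \<mu> (\<lambda>e. (cmod (x b e) * cmod (x a e) * cmod (x a e))\<^sup>2)"
    using le by (intro integrable_const_bound[where B=1] AE_I2) (auto intro!: power_le_one mult_le_one)
  ultimately have "AE e in \<mu>. (cmod (x b e) * cmod (x a e) * cmod (x a e))\<^sup>2 = 0"
    by (subst (asm) integral_nonneg_eq_0_iff_AE) auto
  then show ?thesis by eventually_elim auto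
qed

section \<open>Convergence in probability\<close>

context prob_space
begin

lemma conv_in_prob_cong_AE:
  assumes "conv_in_prob M X Z F"
    and [measurable]: "\<And>n. X n \<in> borel_measurable M" "\<And>n. X' n \<in> borel_measurable M"
      "Z \<in> borel_measurable M" "Z' \<in> borel_measurable M"
    and "\<And>n. AE \<omega> in M. X n \<omega> = X' n \<omega>" "AE \<omega> in M. Z \<omega> = Z' \<omega>"
  shows "conv_in_prob M X' Z' F"
proof -
  have "measure M {\<omega> \<in> space M. cmod (X' n \<omega> - Z' \<omega>) > \<epsilon>} = measure M {\<omega> \<in> space M. cmod (X n \<omega> - Z \<omega>) > \<epsilon>}" for n \<epsilon>
    using assms(6)[of n] assms(7) by (intro measure_eq_AE) auto
  then show ?thesis using assms(1) by (simp add: conv_in_prob_def)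
qed

lemma conv_in_prob_const: "conv_in_prob M (\<lambda>_. Z) Z F"
  by (auto simp: conv_in_prob_def)

lemma conv_in_prob_compose:
  "conv_in_prob M X Z F \<Longrightarrow> filterlim r F G \<Longrightarrow> conv_in_prob M (\<lambda>n. X (r n)) Z G"
  unfolding conv_in_prob_def by (auto intro: filterlim_compose)

lemma conv_in_prob_add:
  assumes "conv_in_prob M X Z F" "conv_in_prob M Y W F"
    and [measurable]: "\<And>n. X n \<in> borel_measurable M" "\<And>n. Y n \<in> borel_measurable M"
      "Z \<in> borel_measurable M" "W \<in> borel_measurable M"
  shows "conv_in_prob M (\<lambda>n \<omega>. X n \<omega> + Y n \<omega>) (\<lambda>\<omega>. Z \<omega> + W \<omega>) F"
  unfolding conv_in_prob_def
proof (intro allI impI)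
  fix \<epsilon> :: real assume "0 < \<epsilon>"
  let ?P = "\<lambda>n. measure M {\<omega> \<in> space M. cmod (X n \<omega> - Z \<omega>) > \<epsilon> / 2}"
  let ?Q = "\<lambda>n. measure M {\<omega> \<in> space M. cmod (Y n \<omega> - W \<omega>) > \<epsilon> / 2}"
  have lim: "((\<lambda>n. ?P n + ?Q n) \<longlongrightarrow> 0) F"
    using assms(1,2) half_gt_zero[OF \<open>0 < \<epsilon>\<close>] unfolding conv_in_prob_def
    by (intro tendsto_add_zero) blast+
  have le: "measure M {\<omega> \<in> space M. cmod ((X n \<omega> + Y n \<omega>) - (Z \<omega> + W \<omega>)) > \<epsilon>} \<le> ?P n + ?Q n" for n
  proof -
    have tri: "cmod ((X n \<omega> + Y n \<omega>) - (Z \<omega> + W \<omega>)) \<le> cmod (X n \<omega> - Z \<omega>) + cmod (Y n \<omega> - W \<omega>)" for \<omega>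
      unfolding add_diff_add by (rule norm_triangle_ineq)
    have "\<epsilon> / 2 < cmod (X n \<omega> - Z \<omega>) \<or> \<epsilon> / 2 < cmod (Y n \<omega> - W \<omega>)"
      if "\<epsilon> < cmod ((X n \<omega> + Y n \<omega>) - (Z \<omega> + W \<omega>))" for \<omega>
      using tri[of \<omega>] that by argo
    then have "measure M {\<omega> \<in> space M. cmod ((X n \<omega> + Y n \<omega>) - (Z \<omega> + W \<omega>)) > \<epsilon>}
      \<le> measure M ({\<omega> \<in> space M. cmod (X n \<omega> - Z \<omega>) > \<epsilon> / 2} \<union> {\<omega> \<in> space M. cmod (Y n \<omega> - W \<omega>) > \<epsilon> / 2})"
      by (intro finite_measure_mono) auto
    also have "\<dots> \<le> ?P n + ?Q n"
      by (rule measure_Un_le) measurable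
    finally show ?thesis .
  qed
  show "((\<lambda>n. measure M {\<omega> \<in> space M. cmod ((X n \<omega> + Y n \<omega>) - (Z \<omega> + W \<omega>)) > \<epsilon>}) \<longlongrightarrow> 0) F"
    by (rule tendsto_sandwich[OF _ _ tendsto_const lim]) (use le in auto)
qed

lemma conv_in_prob_cmult:
  assumes "conv_in_prob M X Z F"
  shows "conv_in_prob M (\<lambda>n \<omega>. c * X n \<omega>) (\<lambda>\<omega>. c * Z \<omega>) F"
proof (cases "c = 0")
  case False
  have "cmod (c * X n \<omega> - c * Z \<omega>) > \<epsilon> \<longleftrightarrow> cmod (X n \<omega> - Z \<omega>) > \<epsilon> / cmod c" for n \<omega> \<epsilon>
    unfolding right_diff_distrib[symmetric] norm_mult using False
    by (simp add: pos_divide_less_eq mult.commute)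
  then show ?thesis using assms False by (simp add: conv_in_prob_def)
qed (auto simp: conv_in_prob_def)

text \<open>The event |Z| > Y + \<epsilon> lies, up to a null set, in |X_n - Z| > \<epsilon> for
  every n from n0 on, hence is null; \<epsilon> then runs through 1 / (k + 1). The bound Y may be
  infinite, as it later is a series of moduli.\<close>

lemma conv_in_prob_AE_bound:
  fixes Y :: "'a \<Rightarrow> ennreal"
  assumes "conv_in_prob M X Z sequentially"
    and [measurable]: "\<And>n. X n \<in> borel_measurable M" "Z \<in> borel_measurable M" "Y \<in> borel_measurable M"
    and le: "\<And>n. n0 \<le> n \<Longrightarrow> AE \<omega> in M. ennreal (cmod (X n \<omega>)) \<le> Y \<omega>"
  shows "AE \<omega> in M. ennreal (cmod (Z \<omega>)) \<le> Y \<omega>"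
proof -
  have null: "AE \<omega> in M. ennreal (cmod (Z \<omega>)) \<le> Y \<omega> + ennreal \<epsilon>" if "0 < \<epsilon>" for \<epsilon> :: real
  proof -
    let ?B = "{\<omega> \<in> space M. \<not> ennreal (cmod (Z \<omega>)) \<le> Y \<omega> + ennreal \<epsilon>}"
    have "measure M ?B \<le> measure M {\<omega> \<in> space M. cmod (X n \<omega> - Z \<omega>) > \<epsilon>}" if "n0 \<le> n" for n
    proof (rule finite_measure_mono_AE)
      show "AE \<omega> in M. \<omega> \<in> ?B \<longrightarrow> \<omega> \<in> {\<omega> \<in> space M. cmod (X n \<omega> - Z \<omega>) > \<epsilon>}"
        using le[OF that] AE_space
      proof eventually_elim
        case (elim \<omega>)
        have "ennreal (cmod (Z \<omega>)) \<le> Y \<omega> + ennreal \<epsilon>" if "cmod (X n \<omega> - Z \<omega>) \<le> \<epsilon>"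
        proof -
          have "cmod (Z \<omega>) \<le> cmod (X n \<omega>) + \<epsilon>"
            using that norm_triangle_ineq2[of "Z \<omega>" "X n \<omega>"] by (simp add: norm_minus_commute)
          then have "ennreal (cmod (Z \<omega>)) \<le> ennreal (cmod (X n \<omega>)) + ennreal \<epsilon>"
            using \<open>0 < \<epsilon>\<close> by (simp add: ennreal_plus[symmetric] ennreal_leI del: ennreal_plus)
          then show ?thesis using elim(1) by (meson add_right_mono order_trans)
        qed
        then show ?case using elim(2) by (auto simp: not_le[symmetric])
      qed
    qed auto
    then have "measure M ?B \<le> 0"
      using assms(1) \<open>0 < \<epsilon>\<close> unfolding conv_in_prob_def
      by (intro tendsto_lowerbound[where F=sequentially and f="\<lambda>n. measure M {\<omega> \<in> space M. cmod (X n \<omega> - Z \<omega>) > \<epsilon>}"])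
         (auto intro!: eventually_sequentiallyI[of n0])
    then have "emeasure M ?B = 0"
      by (simp add: emeasure_eq_measure measure_le_0_iff)
    then show ?thesis by (subst AE_iff_measurable[OF _ refl]) auto
  qed
  have "AE \<omega> in M. \<forall>k. ennreal (cmod (Z \<omega>)) \<le> Y \<omega> + ennreal (inverse (real (Suc k)))"
    unfolding AE_all_countable using null by auto
  then show ?thesis
  proof eventually_elim
    case (elim \<omega>)
    show ?case
    proof (rule ennreal_le_epsilon)
      fix e :: real assume "0 < e"
      then obtain k where "inverse (real (Suc k)) < e" using reals_Archimedean by blast
      then have "ennreal (inverse (real (Suc k))) \<le> ennreal e" by (intro ennreal_leI) simp
      then show "ennreal (cmod (Z \<omega>)) \<le> Y \<omega> + ennreal e"
        using elim by (meson add_left_mono order_trans)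
    qed
  qed
qed

text \<open>\<open>conv_in_prob_AE_bound\<close> with bound 0, applied to the difference with V. It
  turns the additivity in probability of \<open>D\<close> into almost sure identities for finite
  unions.\<close>

lemma conv_in_prob_unique:
  assumes X: "conv_in_prob M X Z sequentially"
    and [measurable]: "\<And>n. X n \<in> borel_measurable M" "Z \<in> borel_measurable M" "V \<in> borel_measurable M"
    and eq: "\<And>n. n0 \<le> n \<Longrightarrow> AE \<omega> in M. X n \<omega> = V \<omega>"
  shows "AE \<omega> in M. Z \<omega> = V \<omega>"
proof -
  have "conv_in_prob M (\<lambda>n \<omega>. X n \<omega> + (-1) * V \<omega>) (\<lambda>\<omega>. Z \<omega> + (-1) * V \<omega>) sequentially"
    by (rule conv_in_prob_add[OF X conv_in_prob_const]) measurable
  then have "AE \<omega> in M. ennreal (cmod (Z \<omega> + (-1) * V \<omega>)) \<le> 0"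
  proof (rule conv_in_prob_AE_bound[where ?n0.0=n0])
    show "AE \<omega> in M. ennreal (cmod (X n \<omega> + (-1) * V \<omega>)) \<le> 0" if "n0 \<le> n" for n
      using eq[OF that] by eventually_elim simp
  qed measurable
  then show ?thesis by eventually_elim simp
qed

lemma cmod_iexp_diff_le: "cmod (iexp x - iexp y) \<le> \<bar>x - y\<bar>"
proof -
  have "iexp x = iexp y * iexp (x - y)"
    by (subst exp_add[symmetric]) (simp add: algebra_simps)
  then have "iexp x - iexp y = iexp y * (iexp (x - y) - 1)"
    by (simp only: right_diff_distrib mult_1_right)
  then show ?thesis using iexp_approx1[of "x - y" 0] by (simp add: norm_mult)
qed

lemma integrable_iexp_Re [intro]: "X \<in> borel_measurable M \<Longrightarrow> integrable M (\<lambda>\<omega>. iexp (Re (X \<omega>)))"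
  by (intro integrable_const_bound[where B=1]) auto

text \<open>Outside the event |X_n - Z| > \<epsilon> the integrands differ by at most \<epsilon>, on
  it by at most 2.\<close>

lemma conv_in_prob_iexp:
  assumes "conv_in_prob M X Z sequentially"
    and [measurable]: "\<And>n. X n \<in> borel_measurable M" "Z \<in> borel_measurable M"
  shows "(\<lambda>n. \<integral>\<omega>. iexp (Re (X n \<omega>)) \<partial>M) \<longlonglongrightarrow> (\<integral>\<omega>. iexp (Re (Z \<omega>)) \<partial>M)"
proof (rule LIMSEQ_I)
  fix r :: real assume "0 < r"
  \<comment> \<open>The total error is below \<epsilon> + 2 \<epsilon>, which r / 4 keeps below
    r.\<close>
  define \<epsilon> where "\<epsilon> = r / 4"
  have "0 < \<epsilon>" using \<open>0 < r\<close> by (simp add: \<epsilon>_def)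
  let ?P = "\<lambda>n. {\<omega> \<in> space M. cmod (X n \<omega> - Z \<omega>) > \<epsilon>}"
  have "(\<lambda>n. measure M (?P n)) \<longlonglongrightarrow> 0"
    using assms(1) \<open>0 < \<epsilon>\<close> by (simp add: conv_in_prob_def)
  then obtain n0 where n0: "\<And>n. n0 \<le> n \<Longrightarrow> measure M (?P n) < \<epsilon>"
    using \<open>0 < \<epsilon>\<close> by (auto simp: LIMSEQ_def dist_real_def)
  show "\<exists>no. \<forall>n\<ge>no. norm ((\<integral>\<omega>. iexp (Re (X n \<omega>)) \<partial>M) - (\<integral>\<omega>. iexp (Re (Z \<omega>)) \<partial>M)) < r"
  proof (intro exI[of _ n0] allI impI)
    fix n assume "n0 \<le> n"
    have "norm ((\<integral>\<omega>. iexp (Re (X n \<omega>)) \<partial>M) - (\<integral>\<omega>. iexp (Re (Z \<omega>)) \<partial>M))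
      = norm (\<integral>\<omega>. iexp (Re (X n \<omega>)) - iexp (Re (Z \<omega>)) \<partial>M)"
      by (subst Bochner_Integration.integral_diff) auto
    also have "\<dots> \<le> (\<integral>\<omega>. norm (iexp (Re (X n \<omega>)) - iexp (Re (Z \<omega>))) \<partial>M)"
      by (rule integral_norm_bound)
    also have "\<dots> \<le> (\<integral>\<omega>. \<epsilon> + 2 * indicator (?P n) \<omega> \<partial>M)"
    proof (rule integral_mono)
      show "integrable M (\<lambda>\<omega>. norm (iexp (Re (X n \<omega>)) - iexp (Re (Z \<omega>))))"
        by (intro integrable_norm Bochner_Integration.integrable_diff integrable_iexp_Re) auto
      fix \<omega> assume \<omega>: "\<omega> \<in> space M"
      show "norm (iexp (Re (X n \<omega>)) - iexp (Re (Z \<omega>))) \<le> \<epsilon> + 2 * indicator (?P n) \<omega>"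
      proof (cases "\<omega> \<in> ?P n")
        case True
        have "norm (iexp (Re (X n \<omega>)) - iexp (Re (Z \<omega>))) \<le> 1 + 1"
          by (rule order_trans[OF norm_triangle_ineq4]) simp
        then show ?thesis using True \<open>0 < \<epsilon>\<close> by simp
      next
        case False
        have "norm (iexp (Re (X n \<omega>)) - iexp (Re (Z \<omega>))) \<le> \<bar>Re (X n \<omega> - Z \<omega>)\<bar>"
          using cmod_iexp_diff_le by simp
        also have "\<dots> \<le> cmod (X n \<omega> - Z \<omega>)" by (rule abs_Re_le_cmod)
        also have "\<dots> \<le> \<epsilon>" using False \<omega> by simp
        finally show ?thesis using False by simp
      qed
    qed (auto simp: emeasure_eq_measure)
    also have "\<dots> = \<epsilon> + 2 * measure M (?P n)"
      by (subst Bochner_Integration.integral_add) (auto simp: emeasure_eq_measure prob_space)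
    also have "\<dots> < r" using n0[OF \<open>n0 \<le> n\<close>] \<open>0 < r\<close> unfolding \<epsilon>_def by linarith
    finally show "norm ((\<integral>\<omega>. iexp (Re (X n \<omega>)) \<partial>M) - (\<integral>\<omega>. iexp (Re (Z \<omega>)) \<partial>M)) < r" .
  qed
qed

lemma conv_in_prob_of_AE_tendsto:
  assumes lim: "AE \<omega> in M. (\<lambda>n. X n \<omega>) \<longlonglongrightarrow> Z \<omega>"
    and [measurable]: "\<And>n. X n \<in> borel_measurable M" "Z \<in> borel_measurable M"
  shows "conv_in_prob M X Z sequentially"
  unfolding conv_in_prob_def
proof (intro allI impI)
  fix \<epsilon> :: real assume "0 < \<epsilon>"
  let ?P = "\<lambda>n. {\<omega> \<in> space M. cmod (X n \<omega> - Z \<omega>) > \<epsilon>}"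
  have "(\<lambda>n. \<integral>\<omega>. indicator (?P n) \<omega> \<partial>M) \<longlonglongrightarrow> (\<integral>\<omega>. (0::real) \<partial>M)"
  proof (rule integral_dominated_convergence[where w="\<lambda>_. 1"])
    show "AE \<omega> in M. (\<lambda>n. indicator (?P n) \<omega>) \<longlonglongrightarrow> (0::real)"
      using lim
    proof eventually_elim
      case (elim \<omega>)
      then have "(\<lambda>n. cmod (X n \<omega> - Z \<omega>)) \<longlonglongrightarrow> 0"
        by (intro tendsto_norm_zero) (simp add: LIM_zero_iff)
      then have "\<forall>\<^sub>F n in sequentially. cmod (X n \<omega> - Z \<omega>) < \<epsilon>"
        using \<open>0 < \<epsilon>\<close> by (rule order_tendstoD)
      then have "\<forall>\<^sub>F n in sequentially. indicator (?P n) \<omega> = (0::real)"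
        by eventually_elim auto
      then show ?case by (rule tendsto_eventually)
    qed
  qed auto
  then show "(\<lambda>n. measure M (?P n)) \<longlonglongrightarrow> 0" by simp
qed

end

section \<open>The independently scattered random measure and its control measure\<close>

locale stable_random_measure = prob_space M for M :: "'w measure" +
  fixes \<alpha> :: real and D :: "real set \<Rightarrow> 'w \<Rightarrow> complex"
  assumes \<alpha>: "1 < \<alpha>"
    and SaS: "SaS_random_measure M \<alpha> D"
    and cond_A: "cond_A M \<alpha> D"
begin

lemma D_measurable [measurable]:
  assumes "A \<in> sets borel" shows "D A \<in> borel_measurable M"
proof -
  have "SaS_vector M \<alpha> 1 (\<lambda>_. D A)"
    using SaS assms unfolding SaS_random_measure_def by (auto dest!: conjunct1 spec[of _ 1] spec[of _ "\<lambda>_. A"])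
  then have m: "\<And>i. i < 2 \<Longrightarrow> real_parts (\<lambda>_. D A) i \<in> borel_measurable M"
    by (simp add: SaS_vector_def SaS_real_vector_def)
  have [measurable]: "(\<lambda>\<omega>. Re (D A \<omega>)) \<in> borel_measurable M" "(\<lambda>\<omega>. Im (D A \<omega>)) \<in> borel_measurable M"
    using m[of 0] m[of 1] by (simp_all add: real_parts_def[abs_def])
  have "D A = (\<lambda>\<omega>. of_real (Re (D A \<omega>)) + \<i> * of_real (Im (D A \<omega>)))"
    by (auto simp: complex_eq_iff)
  also have "\<dots> \<in> borel_measurable M" by measurable
  finally show ?thesis .
qed

lemma conv_in_prob_UN:
  "range A \<subseteq> sets borel \<Longrightarrow> disjoint_family A \<Longrightarrow>
    conv_in_prob M (\<lambda>n \<omega>. \<Sum>i<n. D (A i) \<omega>) (D (\<Union>i. A i)) sequentially"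
  using SaS by (simp add: SaS_random_measure_def)

text \<open>The constant sequence {} is disjoint, and its n-th partial sum is n times
  \<open>D {}\<close>. Consecutive partial sums have the same limit in probability, yet always
  differ by \<open>D {}\<close>.\<close>

lemma D_empty: "AE \<omega> in M. D {} \<omega> = 0"
proof -
  have c: "conv_in_prob M (\<lambda>n \<omega>. \<Sum>i<n. D {} \<omega>) (D {}) sequentially"
    using conv_in_prob_UN[of "\<lambda>_. {}"] by (simp add: disjoint_family_on_def)
  have "conv_in_prob M (\<lambda>n \<omega>. (\<Sum>i<Suc n. D {} \<omega>) + (-1) * (\<Sum>i<n. D {} \<omega>))
     (\<lambda>\<omega>. D {} \<omega> + (-1) * D {} \<omega>) sequentially"
    by (rule conv_in_prob_add[OF conv_in_prob_compose[OF c filterlim_Suc] conv_in_prob_cmult[OF c]])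
       measurable
  then have "AE \<omega> in M. D {} \<omega> + (-1) * D {} \<omega> = D {} \<omega>"
  proof (rule conv_in_prob_unique[where ?n0.0=0])
    show "AE \<omega> in M. (\<Sum>i<Suc n. D {} \<omega>) + (-1) * (\<Sum>i<n. D {} \<omega>) = D {} \<omega>" for n
      by (rule AE_I2) (simp only: sum.lessThan_Suc, simp)
  qed measurable
  then show ?thesis by eventually_elim simp
qed

lemma D_Un:
  assumes [measurable]: "A \<in> sets borel" "B \<in> sets borel" and "A \<inter> B = {}"
  shows "AE \<omega> in M. D (A \<union> B) \<omega> = D A \<omega> + D B \<omega>"
proof -
  let ?C = "\<lambda>i::nat. if i = 0 then A else if i = 1 then B else {}"
  have U: "(\<Union>i. ?C i) = A \<union> B"
    by (auto split: if_splits)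
  have "conv_in_prob M (\<lambda>n \<omega>. \<Sum>i<n. D (?C i) \<omega>) (D (\<Union>i. ?C i)) sequentially"
    by (rule conv_in_prob_UN) (use assms in \<open>auto simp: disjoint_family_on_def\<close>)
  then show ?thesis unfolding U
  proof (rule conv_in_prob_unique[where ?n0.0=2])
    show "(\<lambda>\<omega>. \<Sum>i<n. D (?C i) \<omega>) \<in> borel_measurable M" for n
      by (intro borel_measurable_sum D_measurable) auto
    show "AE \<omega> in M. (\<Sum>i<n. D (?C i) \<omega>) = D A \<omega> + D B \<omega>" if "2 \<le> n" for n
      using D_empty
    proof eventually_elim
      case (elim \<omega>)
      have "(\<Sum>i<n. D (?C i) \<omega>) = (\<Sum>i\<in>{0, 1}. D (?C i) \<omega>)"
        using that elim by (intro sum.mono_neutral_right) auto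
      then show ?case by simp
    qed
  qed measurable
qed

lemma D_UN_finite:
  assumes "finite I" "\<And>i. i \<in> I \<Longrightarrow> A i \<in> sets borel" "disjoint_family_on A I"
  shows "AE \<omega> in M. D (\<Union>i\<in>I. A i) \<omega> = (\<Sum>i\<in>I. D (A i) \<omega>)"
  using assms
proof (induction I rule: finite_induct)
  case empty then show ?case using D_empty by simp
next
  case (insert i I)
  have *: "A i \<inter> (\<Union>j\<in>I. A j) = {}"
    using insert.prems(2) insert.hyps(2) by (force simp: disjoint_family_on_def)
  have "AE \<omega> in M. D (A i \<union> (\<Union>j\<in>I. A j)) \<omega> = D (A i) \<omega> + D (\<Union>j\<in>I. A j) \<omega>"
    using insert.prems insert.hyps * by (intro D_Un sets.finite_UN) auto
  moreover have "AE \<omega> in M. D (\<Union>j\<in>I. A j) \<omega> = (\<Sum>j\<in>I. D (A j) \<omega>)"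
    using insert.prems by (intro insert.IH) (auto simp: disjoint_family_on_def)
  ultimately show ?case
    by eventually_elim (use insert.hyps in simp)
qed

section \<open>Spectral measures and characteristic functions of finite families\<close>

definition spectral :: "nat \<Rightarrow> (nat \<Rightarrow> real set) \<Rightarrow> (nat \<Rightarrow> real) measure" where
  "spectral n A = cspectral_measure M \<alpha> n (\<lambda>i. D (A i))"

lemma is_spectral:
  assumes "\<And>i. i < n \<Longrightarrow> A i \<in> sets borel"
  shows "is_spectral_measure M \<alpha> (2 * n) (real_parts (\<lambda>i. D (A i))) (spectral n A)"
proof -
  have "SaS_vector M \<alpha> n (\<lambda>i. D (A i))"
    using SaS assms by (simp add: SaS_random_measure_def)
  then show ?thesis
    unfolding SaS_vector_def SaS_real_vector_def spectral_def cspectral_measure_def spectral_measure_def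
    by (blast intro: someI_ex)
qed

lemma
  assumes "\<And>i. i < n \<Longrightarrow> A i \<in> sets borel"
  shows spectral_finite: "finite_measure (spectral n A)"
    and spectral_cx_measurable: "j < n \<Longrightarrow> (\<lambda>s. cx s j) \<in> borel_measurable (spectral n A)"
    and spectral_cmod_le: "j < n \<Longrightarrow> s \<in> space (spectral n A) \<Longrightarrow> cmod (cx s j) \<le> 1"
    and spectral_iexp: "(\<integral>\<omega>. iexp (Re (\<Sum>j<n. cnj (\<theta> j) * D (A j) \<omega>)) \<partial>M)
      = of_real (exp (- (\<integral>s. \<bar>Re (\<Sum>j<n. cnj (\<theta> j) * cx s j)\<bar> powr \<alpha> \<partial>spectral n A)))"
proof -
  have "is_spectral_measure M \<alpha> (2 * n) (real_parts (\<lambda>i. D (A i))) (spectral n A)"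
    by (rule is_spectral) (rule assms)
  note D = is_spectral_measureD[OF this]
  show "finite_measure (spectral n A)" by (rule D(2))
  show "(\<integral>\<omega>. iexp (Re (\<Sum>j<n. cnj (\<theta> j) * D (A j) \<omega>)) \<partial>M)
      = of_real (exp (- (\<integral>s. \<bar>Re (\<Sum>j<n. cnj (\<theta> j) * cx s j)\<bar> powr \<alpha> \<partial>spectral n A)))"
    by (rule D(4))
  show "j < n \<Longrightarrow> (\<lambda>s. cx s j) \<in> borel_measurable (spectral n A)"
    by (rule cx_measurable_sphere[OF D(1)]) simp
  show "j < n \<Longrightarrow> s \<in> space (spectral n A) \<Longrightarrow> cmod (cx s j) \<le> 1"
    unfolding D(3) by (rule cmod_cx_le_1[where d="2 * n"]) (assumption, simp)
qed

text \<open>The point where condition A enters, at the index triple (i, i, j).\<close>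

lemma spectral_products_zero:
  assumes A: "\<And>i. i < n \<Longrightarrow> A i \<in> sets borel" and disj: "disjoint_family_on A {..<n}"
  shows "AE s in spectral n A. \<forall>i<n. \<forall>j<n. i \<noteq> j \<longrightarrow> cx s i * cx s j = 0"
proof -
  have "AE s in spectral n A. cx s i * cx s j = 0" if ij: "i < n" "j < n" "i \<noteq> j" for i j
  proof (rule AE_products_zero[where n=n and x="\<lambda>i s. cx s i"])
    have "2 \<le> n" using ij by linarith
    have "\<forall>\<theta>. dbar i (dbar i (dbar j (phi M \<alpha> n (\<lambda>l. D (A l))))) \<theta> = 0"
      using cond_A[unfolded cond_A_def, rule_format, OF \<open>2 \<le> n\<close> A disj ij(1) ij(1) ij(2)] ij by auto
    then show "dbar i (dbar i (dbar j (\<lambda>\<theta>. of_real (\<integral>s. cos (Re (\<Sum>i<n. \<theta> i * cnj (cx s i))) \<partial>spectral n A)))) \<theta> = 0" for \<theta>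
      unfolding phi_def[abs_def] spectral_def by blast
  qed (use spectral_finite[where n=n and A=A, OF A] spectral_cx_measurable[where n=n and A=A, OF A] spectral_cmod_le[where n=n and A=A, OF A] ij in auto)
  then have "AE s in spectral n A. \<forall>i\<in>{..<n}. \<forall>j\<in>{..<n}. i \<noteq> j \<longrightarrow> cx s i * cx s j = 0"
    by (intro AE_finite_allI) auto
  then show ?thesis by eventually_elim auto
qed

text \<open>Minus the logarithm of the characteristic function of \<open>D A\<close> at \<theta>,
  hence nonnegative.\<close>

definition log_cf :: "real set \<Rightarrow> complex \<Rightarrow> real" where
  "log_cf A \<theta> = (\<integral>s. \<bar>Re (cnj \<theta> * cx s 0)\<bar> powr \<alpha> \<partial>spectral 1 (\<lambda>_. A))"

lemma iexp_log_cf: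
  "A \<in> sets borel \<Longrightarrow> (\<integral>\<omega>. iexp (Re (cnj \<theta> * D A \<omega>)) \<partial>M) = of_real (exp (- log_cf A \<theta>))"
  using spectral_iexp[of 1 "\<lambda>_. A" "\<lambda>_. \<theta>"] by (simp add: log_cf_def)

lemma log_cf_nonneg: "0 \<le> log_cf A \<theta>"
  unfolding log_cf_def by (intro Bochner_Integration.integral_nonneg) simp

lemma log_cf_eqI:
  assumes "A \<in> sets borel" "(\<integral>\<omega>. iexp (Re (cnj \<theta> * D A \<omega>)) \<partial>M) = of_real (exp (- x))"
  shows "log_cf A \<theta> = x"
  using assms iexp_log_cf[OF assms(1), of \<theta>] by (simp only: of_real_eq_iff exp_inj_iff neg_equal_iff_equal)

text \<open>Vanishing products leave at most one nonzero coordinate, so each sum reduces to at most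
  one term.\<close>

lemma powr_sum_orthogonal:
  fixes s :: "nat \<Rightarrow> complex"
  assumes "\<forall>i<n. \<forall>j<n. i \<noteq> j \<longrightarrow> s i * s j = (0::complex)"
  shows "\<bar>Re (\<Sum>j<n. c j * s j)\<bar> powr \<alpha> = (\<Sum>j<n. \<bar>Re (c j * s j)\<bar> powr \<alpha>)"
proof (cases "\<exists>i<n. s i \<noteq> 0")
  case True
  then obtain i where i: "i < n" "s i \<noteq> 0" by blast
  then have z: "s j = 0" if "j < n" "j \<noteq> i" for j
    using assms[rule_format, of i j] i that by auto
  have "(\<Sum>j<n. c j * s j) = (\<Sum>j\<in>{i}. c j * s j)"
    using i z by (intro sum.mono_neutral_right) auto
  moreover have "(\<Sum>j<n. \<bar>Re (c j * s j)\<bar> powr \<alpha>) = (\<Sum>j\<in>{i}. \<bar>Re (c j * s j)\<bar> powr \<alpha>)"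
    using i z by (intro sum.mono_neutral_right) auto
  ultimately show ?thesis by simp
next
  case False
  then have "s j = 0" if "j < n" for j using that by blast
  then show ?thesis by simp
qed

lemma spectral_integrable:
  assumes A: "\<And>i. i < n \<Longrightarrow> A i \<in> sets borel" and "j < n"
  shows "integrable (spectral n A) (\<lambda>s. \<bar>Re (c * cx s j)\<bar> powr \<alpha>)"
proof -
  interpret finite_measure "spectral n A" by (rule spectral_finite) (rule A)
  have [measurable]: "(\<lambda>s. cx s j) \<in> borel_measurable (spectral n A)"
    using spectral_cx_measurable[where n=n and A=A, OF A] assms by blast
  show ?thesis
  proof (intro integrable_const_bound[where B="cmod c powr \<alpha>"] AE_I2)
    fix s assume s: "s \<in> space (spectral n A)"
    have "\<bar>Re (c * cx s j)\<bar> \<le> cmod c * cmod (cx s j)"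
      using abs_Re_le_cmod[of "c * cx s j"] by (simp add: norm_mult)
    also have "\<dots> \<le> cmod c * 1"
      using spectral_cmod_le[where n=n and A=A, OF A assms(2) s] by (intro mult_left_mono) auto
    finally show "norm (\<bar>Re (c * cx s j)\<bar> powr \<alpha>) \<le> cmod c powr \<alpha>"
      using \<alpha> by (auto intro!: powr_mono2)
  qed measurable
qed

text \<open>The j-th coordinate of the joint spectral measure is compared with the spectral measure
  of \<open>D (A j)\<close> alone through the characteristic function, taken at a frequency
  supported on j.\<close>

lemma spectral_log_cf:
  assumes A: "\<And>i. i < n \<Longrightarrow> A i \<in> sets borel" and "j < n"
  shows "(\<integral>s. \<bar>Re (cnj \<theta> * cx s j)\<bar> powr \<alpha> \<partial>spectral n A) = log_cf (A j) \<theta>"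
proof (rule log_cf_eqI[symmetric])
  have *: "(\<Sum>i<n. cnj (if i = j then \<theta> else 0) * u i) = cnj \<theta> * u j" for u
  proof -
    have "(\<Sum>i<n. cnj (if i = j then \<theta> else 0) * u i) = (\<Sum>i<n. if i = j then cnj \<theta> * u j else 0)"
      by (intro sum.cong) auto
    then show ?thesis using \<open>j < n\<close> by simp
  qed
  show "(\<integral>\<omega>. iexp (Re (cnj \<theta> * D (A j) \<omega>)) \<partial>M)
      = of_real (exp (- (\<integral>s. \<bar>Re (cnj \<theta> * cx s j)\<bar> powr \<alpha> \<partial>spectral n A)))"
    using spectral_iexp[where n=n and A=A and \<theta>="\<lambda>i. if i = j then \<theta> else 0", OF A] unfolding * .
qed (use assms in auto)

text \<open>Independent scattering in the language of characteristic functions: as at most one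
  coordinate is nonzero, the \<alpha>-th powers add up and the joint characteristic function is a
  product.\<close>

lemma iexp_sum_disjoint:
  fixes n :: nat
  assumes A: "\<And>i. i < n \<Longrightarrow> A i \<in> sets borel" and disj: "disjoint_family_on A {..<n}"
  shows "(\<integral>\<omega>. iexp (Re (\<Sum>j<n. cnj (\<theta> j) * D (A j) \<omega>)) \<partial>M) = of_real (exp (- (\<Sum>j<n. log_cf (A j) (\<theta> j))))"
proof -
  have [measurable]: "(\<lambda>s. cx s j) \<in> borel_measurable (spectral n A)" if "j < n" for j :: nat
    using spectral_cx_measurable[where n=n and A=A, OF A] that by blast
  have m: "(\<lambda>s. \<Sum>j<n. cnj (\<theta> j) * cx s j) \<in> borel_measurable (spectral n A)"
    by (intro borel_measurable_sum borel_measurable_times) auto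
  have "(\<integral>s. \<bar>Re (\<Sum>j<n. cnj (\<theta> j) * cx s j)\<bar> powr \<alpha> \<partial>spectral n A)
      = (\<integral>s. (\<Sum>j<n. \<bar>Re (cnj (\<theta> j) * cx s j)\<bar> powr \<alpha>) \<partial>spectral n A)"
  proof (rule integral_cong_AE)
    show "AE s in spectral n A. \<bar>Re (\<Sum>j<n. cnj (\<theta> j) * cx s j)\<bar> powr \<alpha> = (\<Sum>j<n. \<bar>Re (cnj (\<theta> j) * cx s j)\<bar> powr \<alpha>)"
    proof -
      have "AE s in spectral n A. \<forall>i<n. \<forall>j<n. i \<noteq> j \<longrightarrow> cx s i * cx s j = 0"
        by (rule spectral_products_zero) (use A disj in auto)
      then show ?thesis by eventually_elim (rule powr_sum_orthogonal)
    qed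
    show "(\<lambda>s. \<bar>Re (\<Sum>j<n. cnj (\<theta> j) * cx s j)\<bar> powr \<alpha>) \<in> borel_measurable (spectral n A)"
      using m by measurable
    show "(\<lambda>s. \<Sum>j<n. \<bar>Re (cnj (\<theta> j) * cx s j)\<bar> powr \<alpha>) \<in> borel_measurable (spectral n A)"
      by (intro borel_measurable_sum borel_measurable_integrable spectral_integrable) (use A in auto)
  qed
  also have "\<dots> = (\<Sum>j<n. \<integral>s. \<bar>Re (cnj (\<theta> j) * cx s j)\<bar> powr \<alpha> \<partial>spectral n A)"
    by (rule Bochner_Integration.integral_sum, rule spectral_integrable) (use A in auto)
  also have "\<dots> = (\<Sum>j<n. log_cf (A j) (\<theta> j))"
    by (intro sum.cong refl spectral_log_cf) (use A in auto)
  finally show ?thesis using spectral_iexp[where n=n and A=A, OF A] by simp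
qed

text \<open>The countable additivity of \<open>D\<close> in probability passes to characteristic
  functions. These are exponentials of real numbers, so logarithms can be taken in the
  limit.\<close>

lemma log_cf_sums:
  assumes A: "range A \<subseteq> sets borel" and disj: "disjoint_family A"
  shows "(\<lambda>i. log_cf (A i) \<theta>) sums log_cf (\<Union>i. A i) \<theta>"
proof -
  have Ai: "A i \<in> sets borel" for i using A by auto
  have "(\<lambda>n. \<integral>\<omega>. iexp (Re (cnj \<theta> * (\<Sum>i<n. D (A i) \<omega>))) \<partial>M)
     \<longlonglongrightarrow> (\<integral>\<omega>. iexp (Re (cnj \<theta> * D (\<Union>i. A i) \<omega>)) \<partial>M)"
    by (intro conv_in_prob_iexp conv_in_prob_cmult conv_in_prob_UN A disj borel_measurable_times
        borel_measurable_sum borel_measurable_const D_measurable Ai sets.countable_UN)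
  moreover have "(\<integral>\<omega>. iexp (Re (cnj \<theta> * (\<Sum>i<n. D (A i) \<omega>))) \<partial>M)
     = of_real (exp (- (\<Sum>i<n. log_cf (A i) \<theta>)))" for n
    using iexp_sum_disjoint[of n A "\<lambda>_. \<theta>"] Ai disjoint_family_on_mono[OF subset_UNIV disj]
    by (simp only: sum_distrib_left)
  ultimately have "(\<lambda>n. complex_of_real (exp (- (\<Sum>i<n. log_cf (A i) \<theta>))))
     \<longlonglongrightarrow> complex_of_real (exp (- log_cf (\<Union>i. A i) \<theta>))"
    using Ai by (simp only: iexp_log_cf sets.countable_UN[OF A])
  then have "(\<lambda>n. exp (- (\<Sum>i<n. log_cf (A i) \<theta>))) \<longlonglongrightarrow> exp (- log_cf (\<Union>i. A i) \<theta>)"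
    by (simp only: tendsto_of_real_iff)
  then have "(\<lambda>n. ln (exp (- (\<Sum>i<n. log_cf (A i) \<theta>)))) \<longlonglongrightarrow> ln (exp (- log_cf (\<Union>i. A i) \<theta>))"
    by (rule tendsto_ln) simp
  then show ?thesis
    unfolding sums_def ln_exp by (rule tendsto_minus_cancel)
qed

text \<open>The \<alpha>-th power of the covariation norm of \<open>D A\<close>, as
  \<open>covariation_self\<close> shows.\<close>

definition mass :: "real set \<Rightarrow> real" where
  "mass A = measure (spectral 1 (\<lambda>_. A)) (space (spectral 1 (\<lambda>_. A)))"

lemma mass_nonneg: "0 \<le> mass A" by (simp add: mass_def)

lemma spectral_cmod_eq_1:
  assumes "A \<in> sets borel" "s \<in> space (spectral 1 (\<lambda>_. A))"
  shows "cmod (cx s 0) = 1"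
  using assms(2) is_spectral_measureD(3)[OF is_spectral, of 1 "\<lambda>_. A"] assms(1)
  by (auto simp: unit_sphere_def cx_def cmod_def numeral_eq_Suc)

lemma mass_eq_integral:
  assumes "A \<in> sets borel" shows "mass A = (\<integral>s. cmod (cx s 0) powr \<alpha> \<partial>spectral 1 (\<lambda>_. A))"
proof -
  have "(\<integral>s. cmod (cx s 0) powr \<alpha> \<partial>spectral 1 (\<lambda>_. A)) = (\<integral>s. 1 \<partial>spectral 1 (\<lambda>_. A))"
    using spectral_cmod_eq_1[OF assms] by (intro Bochner_Integration.integral_cong) auto
  then show ?thesis by (simp add: mass_def)
qed

lemma log_cf_le:
  assumes A: "A \<in> sets borel" shows "log_cf A \<theta> \<le> cmod \<theta> powr \<alpha> * mass A"
proof -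
  interpret finite_measure "spectral 1 (\<lambda>_. A)" by (rule spectral_finite) (rule A)
  have "log_cf A \<theta> \<le> (\<integral>s. cmod \<theta> powr \<alpha> \<partial>spectral 1 (\<lambda>_. A))"
    unfolding log_cf_def
  proof (rule integral_mono)
    show "integrable (spectral 1 (\<lambda>_. A)) (\<lambda>s. \<bar>Re (cnj \<theta> * cx s 0)\<bar> powr \<alpha>)"
      by (rule spectral_integrable) (use A in auto)
    fix s assume "s \<in> space (spectral 1 (\<lambda>_. A))"
    then have "\<bar>Re (cnj \<theta> * cx s 0)\<bar> \<le> cmod \<theta>"
      using abs_Re_le_cmod[of "cnj \<theta> * cx s 0"] spectral_cmod_eq_1[OF A] by (simp add: norm_mult)
    then show "\<bar>Re (cnj \<theta> * cx s 0)\<bar> powr \<alpha> \<le> cmod \<theta> powr \<alpha>"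
      using \<alpha> by (intro powr_mono2) auto
  qed (rule integrable_const)
  then show ?thesis by (simp add: mass_def mult.commute)
qed

lemma log_cf_scale:
  "log_cf A (of_real t * \<theta>) = \<bar>t\<bar> powr \<alpha> * log_cf A \<theta>"
proof -
  have "\<bar>Re (cnj (of_real t * \<theta>) * z)\<bar> powr \<alpha> = \<bar>t\<bar> powr \<alpha> * \<bar>Re (cnj \<theta> * z)\<bar> powr \<alpha>" for z
  proof -
    have "Re (cnj (of_real t * \<theta>) * z) = t * Re (cnj \<theta> * z)" by (simp add: algebra_simps)
    then show ?thesis by (simp only: abs_mult powr_mult abs_ge_zero)
  qed
  then show ?thesis by (simp add: log_cf_def)
qed

text \<open>\<open>isotropic_average\<close> with u = 0, where only |q|^\<alpha> is left and q has
  modulus 1. It expresses \<open>mass\<close> by characteristic exponents.\<close>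

lemma circle_mass:
  assumes A: "A \<in> sets borel"
  shows "circle_const \<alpha> * ennreal (mass A) = (\<integral>\<^sup>+\<psi>. indicator {0..<2 * pi} \<psi> * ennreal (log_cf A (cis \<psi>)) \<partial>lborel)"
proof -
  let ?S = "spectral 1 (\<lambda>_. A)"
  have "circle_const \<alpha> * ennreal (\<integral>s. cmod (cx s 0 + 0 * cx s 0) powr \<alpha> \<partial>?S)
    = (\<integral>\<^sup>+\<psi>. indicator {0..<2 * pi} \<psi> * ennreal (\<integral>s. \<bar>Re (cnj (cnj 0 * cis \<psi>) * cx s 0
         + cnj (cis \<psi>) * cx s 0)\<bar> powr \<alpha> \<partial>?S) \<partial>lborel)"
    using \<alpha> A spectral_cx_measurable[of 1 "\<lambda>_. A" 0] spectral_cmod_le[of 1 "\<lambda>_. A" 0]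
    by (intro isotropic_average[where B=1] spectral_finite) auto
  then show ?thesis by (simp add: mass_eq_integral[OF A] log_cf_def)
qed

lemma log_cf_cis_measurable [measurable]:
  assumes A: "A \<in> sets borel" shows "(\<lambda>\<psi>. log_cf A (cis \<psi>)) \<in> borel_measurable borel"
proof -
  interpret finite_measure "spectral 1 (\<lambda>_. A)" by (rule spectral_finite) (rule A)
  have [measurable]: "(\<lambda>s. cx s 0) \<in> borel_measurable (spectral 1 (\<lambda>_. A))"
    using spectral_cx_measurable[of 1 "\<lambda>_. A" 0] A by simp
  have [measurable]: "cis \<in> borel_measurable borel"
    by (intro borel_measurable_continuous_onI continuous_intros)
  show ?thesis unfolding log_cf_def by measurable
qed

section \<open>The control measure and the bimeasure\<close>

definition control :: "real measure" where
  "control = measure_of UNIV (sets borel) (\<lambda>A. ennreal (mass A))"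

lemma sets_control [measurable_cong]: "sets control = sets borel"
  and space_control: "space control = UNIV"
  using sets.sigma_sets_eq[of "borel :: real measure"] by (auto simp: control_def sets_measure_of_conv space_measure_of_conv)

text \<open>Additivity of \<open>mass\<close> is not visible from its definition, since every set
  comes with its own spectral measure. It is inherited from \<open>log_cf\<close>: additivity at
  each direction is integrated over the circle by \<open>circle_mass\<close>, and the constant is
  cancelled.\<close>

lemma emeasure_control:
  assumes "A \<in> sets borel" shows "emeasure control A = ennreal (mass A)"
proof -
  have "mass {} = 0"
  proof -
    have "AE \<omega> in M. iexp (Re (cnj \<theta> * D {} \<omega>)) = 1" for \<theta>
      using D_empty by eventually_elim simp
    then have "(\<integral>\<omega>. iexp (Re (cnj \<theta> * D {} \<omega>)) \<partial>M) = (\<integral>\<omega>. 1 \<partial>M)" for \<theta>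
      by (intro integral_cong_AE) auto
    then have "log_cf {} \<theta> = 0" for \<theta>
      by (intro log_cf_eqI) (auto simp: prob_space)
    then show ?thesis
      using circle_mass[of "{}"] circle_const_pos[of \<alpha>] \<alpha> mass_nonneg[of "{}"] by (auto simp: ennreal_eq_0_iff)
  qed
  moreover have "countably_additive (sets borel) (\<lambda>A. ennreal (mass A))"
    unfolding countably_additive_def
  proof (intro allI impI)
    fix A :: "nat \<Rightarrow> real set"
    assume A: "range A \<subseteq> sets borel" and disj: "disjoint_family A" and "(\<Union>i. A i) \<in> sets borel"
    have [measurable]: "A i \<in> sets borel" for i using A by auto
    have "circle_const \<alpha> * (\<Sum>i. ennreal (mass (A i))) = (\<Sum>i. circle_const \<alpha> * ennreal (mass (A i)))"
      by simp
    also have "\<dots> = (\<Sum>i. \<integral>\<^sup>+\<psi>. indicator {0..<2 * pi} \<psi> * ennreal (log_cf (A i) (cis \<psi>)) \<partial>lborel)"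
      by (simp add: circle_mass)
    also have "\<dots> = (\<integral>\<^sup>+\<psi>. (\<Sum>i. indicator {0..<2 * pi} \<psi> * ennreal (log_cf (A i) (cis \<psi>))) \<partial>lborel)"
      by (rule nn_integral_suminf[symmetric]) measurable
    also have "\<dots> = (\<integral>\<^sup>+\<psi>. indicator {0..<2 * pi} \<psi> * ennreal (log_cf (\<Union>i. A i) (cis \<psi>)) \<partial>lborel)"
      using suminf_ennreal_eq[OF log_cf_nonneg log_cf_sums[OF A disj]] by simp
    also have "\<dots> = circle_const \<alpha> * ennreal (mass (\<Union>i. A i))"
      by (rule circle_mass[symmetric]) simp
    finally show "(\<Sum>i. ennreal (mass (A i))) = ennreal (mass (\<Union>i. A i))"
      using circle_const_pos[of \<alpha>] circle_const_finite[of \<alpha>] \<alpha>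
      by (auto simp: ennreal_mult_cancel_left)
  qed
  ultimately show ?thesis
    unfolding control_def using assms sets.sigma_algebra_axioms[of "borel :: real measure"]
    by (intro emeasure_measure_of_sigma) (auto simp: positive_def)
qed

lemma finite_control: "finite_measure control"
  by (rule finite_measureI) (simp add: space_control emeasure_control)

lemma measure_control: "A \<in> sets borel \<Longrightarrow> measure control A = mass A"
  by (simp add: measure_def emeasure_control mass_nonneg)

lemma covariation_self:
  assumes A: "A \<in> sets borel" shows "covariation M \<alpha> (D A) (D A) = of_real (mass A)"
proof -
  let ?S = "spectral 1 (\<lambda>_. A)"
  have "covariation M \<alpha> (D A) (D A) = (\<integral>s. cx s 0 * spow (cx s 0) (\<alpha> - 1) \<partial>?S)"
  proof (rule covariation_eq_integral[OF \<alpha>, where B=1])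
    show "(\<integral>\<omega>. iexp (Re (cnj \<theta>1 * D A \<omega> + cnj \<theta>2 * D A \<omega>)) \<partial>M)
      = of_real (exp (- (\<integral>s. \<bar>Re (cnj \<theta>1 * cx s 0 + cnj \<theta>2 * cx s 0)\<bar> powr \<alpha> \<partial>?S)))" for \<theta>1 \<theta>2
      using iexp_log_cf[OF A, of "\<theta>1 + \<theta>2"] by (simp only: log_cf_def complex_cnj_add distrib_right)
  qed (use A spectral_finite[of 1 "\<lambda>_. A"] spectral_cx_measurable[of 1 "\<lambda>_. A" 0]
         spectral_cmod_le[of 1 "\<lambda>_. A" 0] in auto)
  then show ?thesis
    by (simp only: mult_spow_self mass_eq_integral[OF A] integral_complex_of_real)
qed

text \<open>The sets are cut into A - B, B - A and their intersection. Almost everywhere at most one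
  of the three coordinates is nonzero; the coordinates of the two differences occur in different
  factors of the product, so only the coordinate of the intersection contributes.\<close>

lemma bimeas_eq_mass:
  assumes [measurable]: "A \<in> sets borel" "B \<in> sets borel"
  shows "bimeas M \<alpha> D A B = of_real (mass (A \<inter> B))"
proof -
  define C where "C i = (if i = 0 then A - B else if i = 1 then B - A else A \<inter> B)" for i :: nat
  have C: "C i \<in> sets borel" for i by (auto simp: C_def)
  have disj: "disjoint_family_on C {..<3}" by (auto simp: C_def disjoint_family_on_def)
  let ?S = "spectral 3 C"
  have AB: "(A - B) \<union> (A \<inter> B) = A" "(B - A) \<union> (A \<inter> B) = B" by auto
  have AE: "AE \<omega> in M. D A \<omega> = D (C 0) \<omega> + D (C 2) \<omega> \<and> D B \<omega> = D (C 1) \<omega> + D (C 2) \<omega>"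
    using D_Un[of "A - B" "A \<inter> B"] D_Un[of "B - A" "A \<inter> B"] unfolding AB C_def
    by (auto simp: Diff_Int_distrib)
  have meas: "(\<lambda>s. cx s j) \<in> borel_measurable ?S" if "j < 3" for j
    by (rule spectral_cx_measurable) (use C that in auto)
  have [measurable]: "(\<lambda>s. cx s 0) \<in> borel_measurable ?S" "(\<lambda>s. cx s 1) \<in> borel_measurable ?S" "(\<lambda>s. cx s 2) \<in> borel_measurable ?S"
    using meas by auto
  have le: "cmod (cx s j) \<le> 1" if "j < 3" "s \<in> space ?S" for j s
    by (rule spectral_cmod_le) (use C that in auto)
  have le2: "cmod (cx s i + cx s j) \<le> 2" if "i < 3" "j < 3" "s \<in> space ?S" for i j s
    using le[OF that(1,3)] le[OF that(2,3)] norm_triangle_ineq[of "cx s i" "cx s j"] by linarith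
  have m02: "(\<lambda>s. cx s 0 + cx s 2) \<in> borel_measurable ?S"
    and m12: "(\<lambda>s. cx s 1 + cx s 2) \<in> borel_measurable ?S" by measurable
  have fin: "finite_measure ?S" by (rule spectral_finite) (rule C)
  have cf: "(\<integral>\<omega>. iexp (Re (c0 * D (C 0) \<omega> + c1 * D (C 1) \<omega> + c2 * D (C 2) \<omega>)) \<partial>M)
      = of_real (exp (- (\<integral>s. \<bar>Re (c0 * cx s 0 + c1 * cx s 1 + c2 * cx s 2)\<bar> powr \<alpha> \<partial>?S)))" for c0 c1 c2
    using spectral_iexp[of 3 C "\<lambda>i. cnj (if i = 0 then c0 else if i = 1 then c1 else c2)"] C
    by (simp only: complex_cnj_cnj) (simp add: numeral_eq_Suc)
  have "covariation M \<alpha> (D A) (D B) = (\<integral>s. (cx s 0 + cx s 2) * spow (cx s 1 + cx s 2) (\<alpha> - 1) \<partial>?S)"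
  proof (rule covariation_eq_integral[OF \<alpha> fin, where B=2])
    fix \<theta>1 \<theta>2
    have "(\<integral>\<omega>. iexp (Re (cnj \<theta>1 * D A \<omega> + cnj \<theta>2 * D B \<omega>)) \<partial>M)
      = (\<integral>\<omega>. iexp (Re (cnj \<theta>1 * D (C 0) \<omega> + cnj \<theta>2 * D (C 1) \<omega> + (cnj \<theta>1 + cnj \<theta>2) * D (C 2) \<omega>)) \<partial>M)"
    proof (rule integral_cong_AE)
      show "AE \<omega> in M. iexp (Re (cnj \<theta>1 * D A \<omega> + cnj \<theta>2 * D B \<omega>))
        = iexp (Re (cnj \<theta>1 * D (C 0) \<omega> + cnj \<theta>2 * D (C 1) \<omega> + (cnj \<theta>1 + cnj \<theta>2) * D (C 2) \<omega>))"
        using AE by eventually_elim (simp add: algebra_simps)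
    qed (use C in measurable)
    also have "\<dots> = of_real (exp (- (\<integral>s. \<bar>Re (cnj \<theta>1 * cx s 0 + cnj \<theta>2 * cx s 1 + (cnj \<theta>1 + cnj \<theta>2) * cx s 2)\<bar> powr \<alpha> \<partial>?S)))"
      by (rule cf)
    also have "(\<lambda>s. cnj \<theta>1 * cx s 0 + cnj \<theta>2 * cx s 1 + (cnj \<theta>1 + cnj \<theta>2) * cx s 2)
      = (\<lambda>s. cnj \<theta>1 * (cx s 0 + cx s 2) + cnj \<theta>2 * (cx s 1 + cx s 2))"
      by (simp add: algebra_simps)
    finally show "(\<integral>\<omega>. iexp (Re (cnj \<theta>1 * D A \<omega> + cnj \<theta>2 * D B \<omega>)) \<partial>M)
      = of_real (exp (- (\<integral>s. \<bar>Re (cnj \<theta>1 * (cx s 0 + cx s 2) + cnj \<theta>2 * (cx s 1 + cx s 2))\<bar> powr \<alpha> \<partial>?S)))" .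
  qed (use le2 m02 m12 in auto)
  also have "\<dots> = (\<integral>s. cx s 2 * spow (cx s 2) (\<alpha> - 1) \<partial>?S)"
  proof (rule integral_cong_AE)
    show "AE s in ?S. (cx s 0 + cx s 2) * spow (cx s 1 + cx s 2) (\<alpha> - 1) = cx s 2 * spow (cx s 2) (\<alpha> - 1)"
      using spectral_products_zero[OF C disj]
    proof eventually_elim
      case (elim s)
      have p: "cx s 0 * cx s 1 = 0" "cx s 0 * cx s 2 = 0" "cx s 1 * cx s 2 = 0"
        using elim by (simp_all add: eval_nat_numeral)
      then show ?case
        by (cases "cx s 2 = 0"; cases "cx s 0 = 0"; cases "cx s 1 = 0") (auto simp: spow_def)
    qed
  qed measurable
  \<comment> \<open>The remaining integral, still over the spectral measure of three sets, is
    recognized as a covariation, which leads back to \<open>mass\<close>.\<close>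
  also have "\<dots> = covariation M \<alpha> (D (C 2)) (D (C 2))"
  proof (rule covariation_eq_integral[OF \<alpha> fin, where B=2, symmetric])
    show "(\<integral>\<omega>. iexp (Re (cnj \<theta>1 * D (C 2) \<omega> + cnj \<theta>2 * D (C 2) \<omega>)) \<partial>M)
      = of_real (exp (- (\<integral>s. \<bar>Re (cnj \<theta>1 * cx s 2 + cnj \<theta>2 * cx s 2)\<bar> powr \<alpha> \<partial>?S)))" for \<theta>1 \<theta>2
      using cf[of 0 0 "cnj \<theta>1 + cnj \<theta>2"] by (simp only: mult_zero_left add_0 distrib_right)
  qed (use le order_trans[OF le one_le_numeral] in auto)
  also have "\<dots> = of_real (mass (A \<inter> B))"
    using covariation_self[OF C, of 2] by (simp add: C_def)
  finally show ?thesis by (simp add: bimeas_def)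
qed

end

section \<open>The mean total variation\<close>

text \<open>The transform 1 / (1 + x) is strictly decreasing on all of [0, \<infinity>] and bounded
  by 1, so its expectation is finite even if the supremum under study is infinite.\<close>

lemma inverse_one_plus_le_iff:
  fixes x y :: ennreal
  shows "inverse (1 + x) \<le> inverse (1 + y) \<longleftrightarrow> y \<le> x"
proof -
  have inv: "inverse (1 + ennreal r) = ennreal (inverse (1 + r))" if "0 \<le> r" for r
  proof -
    have "1 + ennreal r = ennreal (1 + r)" using that by (metis ennreal_1 ennreal_plus zero_le_one)
    then show ?thesis using inverse_ennreal[of "1 + r"] that by (simp only:)
  qed
  show ?thesis
    by (cases x; cases y) (auto simp: inv ennreal_le_iff ennreal_eq_0_iff top_unique)
qed

lemma AE_le_of_nn_integral_eq:
  fixes f g :: "'a \<Rightarrow> ennreal"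
  assumes [measurable]: "f \<in> borel_measurable N" "g \<in> borel_measurable N"
    and le: "\<And>x. x \<in> space N \<Longrightarrow> g x \<le> f x"
    and fin: "(\<integral>\<^sup>+x. g x \<partial>N) \<noteq> \<infinity>" and eq: "(\<integral>\<^sup>+x. f x \<partial>N) \<le> (\<integral>\<^sup>+x. g x \<partial>N)"
  shows "AE x in N. f x \<le> g x"
proof -
  have "(\<integral>\<^sup>+x. f x - g x \<partial>N) = (\<integral>\<^sup>+x. f x \<partial>N) - (\<integral>\<^sup>+x. g x \<partial>N)"
    using fin le by (intro nn_integral_diff) auto
  also have "\<dots> = 0"
    using eq fin by (metis diff_eq_0_ennreal infinity_ennreal_def less_top order_le_less_trans)
  finally have "AE x in N. f x - g x = 0"
    by (subst (asm) nn_integral_0_iff_AE) auto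
  then show ?thesis by eventually_elim (rule ennreal_minus_eq_0)
qed

context prob_space
begin

text \<open>A countable subfamily whose supremum minimises the expectation of the decreasing bounded
  transform \<open>1 / (1 + sup)\<close> already has the essential supremum as its pointwise supremum.\<close>

lemma ess_sup_exists:
  assumes S: "S \<subseteq> borel_measurable M" and "S \<noteq> {}"
  shows "\<exists>v. is_ess_sup M S v"
proof -
  define CC where "CC = {C. countable C \<and> C \<subseteq> S}"
  define h where "h C = (\<integral>\<^sup>+\<omega>. inverse (1 + (SUP u\<in>C. u \<omega>)) \<partial>M)" for C :: "('a \<Rightarrow> ennreal) set"
  have meas: "(\<lambda>\<omega>. SUP u\<in>C. u \<omega>) \<in> borel_measurable M" if "C \<in> CC" for C
    using that S by (intro borel_measurable_SUP) (auto simp: CC_def)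
  have mono: "h C' \<le> h C" if "C \<subseteq> C'" for C C'
    unfolding h_def using that
    by (intro nn_integral_mono, unfold inverse_one_plus_le_iff) (rule SUP_subset_mono, auto)
  have "{} \<in> CC" by (simp add: CC_def)
  then have "h ` CC \<noteq> {}" by blast
  from ennreal_Inf_countable_INF[OF this] obtain f :: "nat \<Rightarrow> ennreal"
    where f: "decseq f \<and> range f \<subseteq> h ` CC \<and> Inf (h ` CC) = (INF i. f i)" by (rule exE)
  then have "\<forall>i. \<exists>C\<in>CC. f i = h C" by blast
  then obtain Cs where Cs: "\<And>i. Cs i \<in> CC" "\<And>i. f i = h (Cs i)" by metis
  \<comment> \<open>The union of a minimizing sequence is still countable, and by antitonicity of h
    it attains the infimum.\<close>
  define C where "C = (\<Union>i. Cs i)"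
  have "countable (Cs i)" "Cs i \<subseteq> S" for i
    using Cs(1)[of i] by (simp_all add: CC_def)
  then have C: "C \<in> CC" by (simp add: C_def CC_def UN_least)
  have hC: "h C \<le> h C'" if "C' \<in> CC" for C'
  proof -
    have "h C \<le> (INF i. f i)"
      unfolding Cs(2) C_def by (intro INF_greatest mono) auto
    also have "\<dots> \<le> h C'" unfolding f[THEN conjunct2, THEN conjunct2, symmetric] using that by (intro INF_lower)
    finally show ?thesis .
  qed
  define v where "v \<omega> = (SUP u\<in>C. u \<omega>)" for \<omega>
  have v_meas [measurable]: "v \<in> borel_measurable M"
    unfolding v_def[abs_def] by (rule meas[OF C])
  have "is_ess_sup M S v"
    unfolding is_ess_sup_def
  proof (intro conjI ballI impI v_meas)
    fix u assume u: "u \<in> S"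
    then have [measurable]: "u \<in> borel_measurable M" using S by auto
    have uC: "insert u C \<in> CC" using C u by (auto simp: CC_def)
    \<comment> \<open>Adjoining u to C cannot lower the minimal expectation, so the two integrands
      agree almost surely.\<close>
    have "AE \<omega> in M. inverse (1 + v \<omega>) \<le> inverse (1 + sup (u \<omega>) (v \<omega>))"
    proof (rule AE_le_of_nn_integral_eq)
      show "inverse (1 + sup (u \<omega>) (v \<omega>)) \<le> inverse (1 + v \<omega>)" for \<omega>
        by (simp add: inverse_one_plus_le_iff)
      show "(\<integral>\<^sup>+\<omega>. inverse (1 + v \<omega>) \<partial>M) \<le> (\<integral>\<^sup>+\<omega>. inverse (1 + sup (u \<omega>) (v \<omega>)) \<partial>M)"
        using hC[OF uC] by (simp add: h_def v_def)
      have "(\<integral>\<^sup>+\<omega>. inverse (1 + sup (u \<omega>) (v \<omega>)) \<partial>M) \<le> (\<integral>\<^sup>+\<omega>. inverse (1 + 0) \<partial>M)"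
        by (intro nn_integral_mono) (simp only: inverse_one_plus_le_iff zero_le)
      also have "\<dots> = 1" by (simp add: emeasure_space_1)
      finally show "(\<integral>\<^sup>+\<omega>. inverse (1 + sup (u \<omega>) (v \<omega>)) \<partial>M) \<noteq> \<infinity>"
        by (auto simp: top_unique)
    qed measurable
    then show "AE \<omega> in M. u \<omega> \<le> v \<omega>"
      by eventually_elim (simp add: inverse_one_plus_le_iff)
  next
    fix w assume w: "\<forall>u\<in>S. AE \<omega> in M. u \<omega> \<le> w \<omega>"
    have "AE \<omega> in M. \<forall>u\<in>C. u \<omega> \<le> w \<omega>"
      using C w by (subst AE_ball_countable) (auto simp: CC_def)
    then show "AE \<omega> in M. v \<omega> \<le> w \<omega>"
      unfolding v_def by eventually_elim (rule SUP_least, blast)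
  qed
  then show ?thesis by blast
qed

end

text \<open>\<open>partition_on\<close> forbids empty blocks; removing {} takes care of the case A =
  {}.\<close>

lemma trivial_partition: "A \<in> \<A> \<Longrightarrow> \<exists>P. finite P \<and> P \<subseteq> \<A> \<and> partition_on A P"
  by (rule exI[of _ "{A} - {{}}"]) (auto simp: partition_on_def disjoint_def)

context stable_random_measure
begin

lemma is_ess_sup_tot_variation:
  assumes A: "A \<in> sets borel"
  shows "is_ess_sup M {(\<lambda>\<omega>. ennreal (\<Sum>B\<in>P. cmod (D B \<omega>))) | P.
    finite P \<and> P \<subseteq> sets borel \<and> partition_on A P} (tot_variation M D A)" (is "is_ess_sup M ?S _")
  unfolding tot_variation_def
proof (rule someI_ex[where P="is_ess_sup M ?S"], rule ess_sup_exists)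
  show "{(\<lambda>\<omega>. ennreal (\<Sum>B\<in>P. cmod (D B \<omega>))) | P. finite P \<and> P \<subseteq> sets borel \<and> partition_on A P}
    \<subseteq> borel_measurable M"
    by (auto intro!: measurable_compose[OF _ measurable_ennreal] borel_measurable_sum measurable_compose[OF D_measurable borel_measurable_norm])
  show "{(\<lambda>\<omega>. ennreal (\<Sum>B\<in>P. cmod (D B \<omega>))) | P. finite P \<and> P \<subseteq> sets borel \<and> partition_on A P} \<noteq> {}"
    using trivial_partition[OF A] by blast
qed

lemma tot_variation_measurable [measurable]:
  "A \<in> sets borel \<Longrightarrow> tot_variation M D A \<in> borel_measurable M"
  using is_ess_sup_tot_variation by (simp add: is_ess_sup_def)

lemma tot_variation_least:
  assumes A: "A \<in> sets borel" and w: "w \<in> borel_measurable M"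
    and "\<And>P. finite P \<Longrightarrow> P \<subseteq> sets borel \<Longrightarrow> partition_on A P \<Longrightarrow>
      AE \<omega> in M. (\<Sum>B\<in>P. ennreal (cmod (D B \<omega>))) \<le> w \<omega>"
  shows "AE \<omega> in M. tot_variation M D A \<omega> \<le> w \<omega>"
  using is_ess_sup_tot_variation[OF A] assms(3) w unfolding is_ess_sup_def
  by (auto simp: sum_ennreal)

lemma tot_variation_ge_partition:
  assumes A: "A \<in> sets borel" and P: "finite P" "P \<subseteq> sets borel" "partition_on A P"
  shows "AE \<omega> in M. (\<Sum>B\<in>P. ennreal (cmod (D B \<omega>))) \<le> tot_variation M D A \<omega>"
  using is_ess_sup_tot_variation[OF A] P unfolding is_ess_sup_def
  by (auto simp: sum_ennreal)

text \<open>An indexed disjoint family may contain {} repeatedly, which a partition cannot; such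
  members contribute nothing because \<open>D {}\<close> vanishes almost surely.\<close>

lemma tot_variation_ge:
  assumes I: "finite I" "\<And>i. i \<in> I \<Longrightarrow> C i \<in> sets borel" "disjoint_family_on C I"
  shows "AE \<omega> in M. (\<Sum>i\<in>I. ennreal (cmod (D (C i) \<omega>))) \<le> tot_variation M D (\<Union>i\<in>I. C i) \<omega>"
proof -
  let ?P = "C ` I - {{}}"
  have P: "partition_on (\<Union>i\<in>I. C i) ?P"
    using I(3) by (force simp: partition_on_def disjoint_def disjoint_family_on_def)
  have U: "(\<Union>i\<in>I. C i) \<in> sets borel" using I by auto
  have "AE \<omega> in M. (\<Sum>B\<in>?P. ennreal (cmod (D B \<omega>))) \<le> tot_variation M D (\<Union>i\<in>I. C i) \<omega>"
    by (rule tot_variation_ge_partition[OF U _ _ P]) (use I in auto)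
  then show ?thesis using D_empty
  proof eventually_elim
    case (elim \<omega>)
    have "(\<Sum>i\<in>I. ennreal (cmod (D (C i) \<omega>))) = (\<Sum>B\<in>C ` I. ennreal (cmod (D B \<omega>)))"
    proof (rule sum.reindex_nontrivial[OF I(1), unfolded comp_def, symmetric])
      fix i j assume "i \<in> I" "j \<in> I" "i \<noteq> j" "C i = C j"
      then have "C i = {}" using I(3) by (auto simp: disjoint_family_on_def)
      then show "ennreal (cmod (D (C i) \<omega>)) = 0" using elim by simp
    qed
    also have "\<dots> = (\<Sum>B\<in>?P. ennreal (cmod (D B \<omega>)))"
      using I(1) elim by (intro sum.mono_neutral_right) auto
    finally show ?case using elim(1) by simp
  qed
qed

text \<open>A partition of A and one of B together partition the union. An essential supremum over
  uncountably many partitions admits no pointwise argument, so the two suprema are taken one after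
  the other: each time the remaining term is subtracted and the minimality of the essential supremum
  is applied to the difference.\<close>

lemma tot_variation_superadditive:
  assumes [measurable]: "A \<in> sets borel" "B \<in> sets borel" and AB: "A \<inter> B = {}"
  shows "AE \<omega> in M. tot_variation M D A \<omega> + tot_variation M D B \<omega> \<le> tot_variation M D (A \<union> B) \<omega>"
proof -
  let ?v = "tot_variation M D"
  let ?s = "\<lambda>P \<omega>. \<Sum>B\<in>P. ennreal (cmod (D B \<omega>))"
  have s_meas [measurable]: "?s P \<in> borel_measurable M" if "P \<subseteq> sets borel" for P
    using that by (auto intro!: borel_measurable_sum measurable_compose[OF _ measurable_ennreal]
        measurable_compose[OF D_measurable borel_measurable_norm])
  have s_fin: "?s P \<omega> \<noteq> \<infinity>" for P \<omega>
    by (simp add: sum_ennreal)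
  have 1: "AE \<omega> in M. ?s P \<omega> + ?v B \<omega> \<le> ?v (A \<union> B) \<omega>"
    if P: "finite P" "P \<subseteq> sets borel" "partition_on A P" for P
  proof -
    have PQ: "AE \<omega> in M. ?s P \<omega> + ?s Q \<omega> \<le> ?v (A \<union> B) \<omega>"
      if Q: "finite Q" "Q \<subseteq> sets borel" "partition_on B Q" for Q
    proof -
      have d: "P \<inter> Q = {}"
      proof (rule ccontr)
        assume "P \<inter> Q \<noteq> {}"
        then obtain C where C: "C \<in> P" "C \<in> Q" by blast
        then have "C \<subseteq> A \<inter> B" "C \<noteq> {}" using P(3) Q(3) by (auto simp: partition_on_def)
        then show False using AB by blast
      qed
      have "partition_on (A \<union> B) (P \<union> Q)"
        using P(3) Q(3) AB unfolding partition_on_def by (auto intro!: disjoint_union)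
      then have "AE \<omega> in M. ?s (P \<union> Q) \<omega> \<le> ?v (A \<union> B) \<omega>"
        using P Q by (intro tot_variation_ge_partition) auto
      then show ?thesis by (simp only: sum.union_disjoint[OF P(1) Q(1) d])
    qed
    have "AE \<omega> in M. ?v B \<omega> \<le> ?v (A \<union> B) \<omega> - ?s P \<omega>"
    proof (rule tot_variation_least)
      show "(\<lambda>\<omega>. ?v (A \<union> B) \<omega> - ?s P \<omega>) \<in> borel_measurable M"
        using s_meas[OF P(2)] by measurable
      fix Q assume "finite Q" "Q \<subseteq> sets borel" "partition_on B Q"
      from PQ[OF this] show "AE \<omega> in M. ?s Q \<omega> \<le> ?v (A \<union> B) \<omega> - ?s P \<omega>"
        by eventually_elim (auto simp: ennreal_le_minus_iff add.commute)
    qed simp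
    moreover have "AE \<omega> in M. ?s P \<omega> \<le> ?v (A \<union> B) \<omega>"
    proof -
      obtain Q where "finite Q" "Q \<subseteq> sets borel" "partition_on B Q"
        using trivial_partition[OF assms(2)] by auto
      from PQ[OF this] show ?thesis
        by eventually_elim (erule order_trans[rotated], simp)
    qed
    ultimately show ?thesis
    proof eventually_elim
      case (elim \<omega>)
      have "?s P \<omega> + ?v B \<omega> \<le> ?s P \<omega> + (?v (A \<union> B) \<omega> - ?s P \<omega>)"
        using elim(1) by (rule add_left_mono)
      also have "\<dots> = ?v (A \<union> B) \<omega>" using elim(2) by (rule add_diff_inverse_ennreal)
      finally show ?case .
    qed
  qed
  have "AE \<omega> in M. ?v A \<omega> \<le> ?v (A \<union> B) \<omega> - ?v B \<omega>"
  proof (rule tot_variation_least)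
    fix P assume "finite P" "P \<subseteq> sets borel" "partition_on A P"
    from 1[OF this] show "AE \<omega> in M. ?s P \<omega> \<le> ?v (A \<union> B) \<omega> - ?v B \<omega>"
      by eventually_elim (simp add: ennreal_le_minus_iff)
  qed measurable
  moreover have "AE \<omega> in M. ?v B \<omega> \<le> ?v (A \<union> B) \<omega>"
  proof -
    obtain P where "finite P" "P \<subseteq> sets borel" "partition_on A P"
      using trivial_partition[OF assms(1)] by auto
    from 1[OF this] show ?thesis
      by eventually_elim (erule order_trans[rotated], simp)
  qed
  ultimately show ?thesis
  proof eventually_elim
    case (elim \<omega>)
    have "?v A \<omega> + ?v B \<omega> \<le> (?v (A \<union> B) \<omega> - ?v B \<omega>) + ?v B \<omega>"
      using elim(1) by (rule add_right_mono)
    also have "\<dots> = ?v (A \<union> B) \<omega>" using elim(2) by (rule diff_add_cancel_ennreal)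
    finally show ?case .
  qed
qed

lemma tot_variation_mono:
  assumes [measurable]: "A \<in> sets borel" "B \<in> sets borel" and "A \<subseteq> B"
  shows "AE \<omega> in M. tot_variation M D A \<omega> \<le> tot_variation M D B \<omega>"
proof -
  have "A \<union> (B - A) = B" using assms by auto
  then show ?thesis
    using tot_variation_superadditive[of A "B - A"] by (auto elim!: eventually_mono intro: order_trans[rotated])
qed

text \<open>The triangle inequality for partial sums survives the limit in probability.\<close>

lemma cmod_D_UN_le:
  assumes C: "range C \<subseteq> sets borel" "disjoint_family C"
  shows "AE \<omega> in M. ennreal (cmod (D (\<Union>i. C i) \<omega>)) \<le> (\<Sum>i. ennreal (cmod (D (C i) \<omega>)))"
proof (rule conv_in_prob_AE_bound[OF conv_in_prob_UN[OF C], where ?n0.0=0])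
  have [measurable]: "C i \<in> sets borel" for i using C by auto
  show "(\<lambda>\<omega>. \<Sum>i<n. D (C i) \<omega>) \<in> borel_measurable M" for n by measurable
  show "D (\<Union>i. C i) \<in> borel_measurable M" by measurable
  show "(\<lambda>\<omega>. \<Sum>i. ennreal (cmod (D (C i) \<omega>))) \<in> borel_measurable M" by measurable
  show "AE \<omega> in M. ennreal (cmod (\<Sum>i<n. D (C i) \<omega>)) \<le> (\<Sum>i. ennreal (cmod (D (C i) \<omega>)))" for n
  proof (rule AE_I2)
    fix \<omega>
    have "ennreal (cmod (\<Sum>i<n. D (C i) \<omega>)) \<le> ennreal (\<Sum>i<n. cmod (D (C i) \<omega>))"
      by (intro ennreal_leI norm_sum)
    also have "\<dots> = (\<Sum>i<n. ennreal (cmod (D (C i) \<omega>)))" by (simp add: sum_ennreal)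
    also have "\<dots> \<le> (\<Sum>i. ennreal (cmod (D (C i) \<omega>)))"
      by (rule sum_le_suminf) auto
    finally show "ennreal (cmod (\<Sum>i<n. D (C i) \<omega>)) \<le> (\<Sum>i. ennreal (cmod (D (C i) \<omega>)))" .
  qed
qed

text \<open>Upper bound: every block of a partition of the union is cut along the sets A_i, and the
  pieces within A_i are bounded by the variation on A_i. Lower bound: finite superadditivity and
  monotonicity, for all n simultaneously.\<close>

lemma tot_variation_UN:
  assumes A: "range A \<subseteq> sets borel" and disj: "disjoint_family A"
  shows "AE \<omega> in M. tot_variation M D (\<Union>i. A i) \<omega> = (\<Sum>i. tot_variation M D (A i) \<omega>)"
proof -
  let ?v = "tot_variation M D"
  have [measurable]: "A i \<in> sets borel" for i using A by auto
  have "AE \<omega> in M. ?v (\<Union>i. A i) \<omega> \<le> (\<Sum>i. ?v (A i) \<omega>)"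
  proof (rule tot_variation_least)
    fix P assume P: "finite P" "P \<subseteq> sets borel" "partition_on (\<Union>i. A i) P"
    have "AE \<omega> in M. \<forall>B\<in>P. ennreal (cmod (D B \<omega>)) \<le> (\<Sum>i. ennreal (cmod (D (B \<inter> A i) \<omega>)))"
    proof (intro AE_finite_allI P(1))
      fix B assume B: "B \<in> P"
      then have "B \<subseteq> (\<Union>i. A i)" "B \<in> sets borel" using P by (auto simp: partition_on_def)
      then have "(\<Union>i. B \<inter> A i) = B" by auto
      moreover have "AE \<omega> in M. ennreal (cmod (D (\<Union>i. B \<inter> A i) \<omega>)) \<le> (\<Sum>i. ennreal (cmod (D (B \<inter> A i) \<omega>)))"
        using disj \<open>B \<in> sets borel\<close> by (intro cmod_D_UN_le) (auto simp: disjoint_family_on_def)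
      ultimately show "AE \<omega> in M. ennreal (cmod (D B \<omega>)) \<le> (\<Sum>i. ennreal (cmod (D (B \<inter> A i) \<omega>)))"
        by simp
    qed
    moreover have "AE \<omega> in M. \<forall>i. (\<Sum>B\<in>P. ennreal (cmod (D (B \<inter> A i) \<omega>))) \<le> ?v (A i) \<omega>"
      unfolding AE_all_countable
    proof
      fix i
      have "(\<Union>B\<in>P. B \<inter> A i) = A i" using P(3) by (auto simp: partition_on_def)
      moreover have "AE \<omega> in M. (\<Sum>B\<in>P. ennreal (cmod (D (B \<inter> A i) \<omega>))) \<le> ?v (\<Union>B\<in>P. B \<inter> A i) \<omega>"
      proof (rule tot_variation_ge[OF P(1)])
        show "disjoint_family_on (\<lambda>B. B \<inter> A i) P"
          using P(3) unfolding partition_on_def disjoint_def disjoint_family_on_def by blast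
      qed (use P(2) in auto)
      ultimately show "AE \<omega> in M. (\<Sum>B\<in>P. ennreal (cmod (D (B \<inter> A i) \<omega>))) \<le> ?v (A i) \<omega>" by simp
    qed
    ultimately show "AE \<omega> in M. (\<Sum>B\<in>P. ennreal (cmod (D B \<omega>))) \<le> (\<Sum>i. ?v (A i) \<omega>)"
    proof eventually_elim
      case (elim \<omega>)
      have "(\<Sum>B\<in>P. ennreal (cmod (D B \<omega>))) \<le> (\<Sum>B\<in>P. \<Sum>i. ennreal (cmod (D (B \<inter> A i) \<omega>)))"
        using elim(1) by (intro sum_mono) auto
      also have "\<dots> = (\<Sum>i. \<Sum>B\<in>P. ennreal (cmod (D (B \<inter> A i) \<omega>)))"
        by (rule suminf_sum[symmetric]) simp
      also have "\<dots> \<le> (\<Sum>i. ?v (A i) \<omega>)"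
        using elim(2) by (intro suminf_le) auto
      finally show ?case .
    qed
  qed measurable
  moreover have "AE \<omega> in M. \<forall>n. (\<Sum>i<n. ?v (A i) \<omega>) \<le> ?v (\<Union>i. A i) \<omega>"
    unfolding AE_all_countable
  proof
    fix n
    have "AE \<omega> in M. (\<Sum>i<n. ?v (A i) \<omega>) \<le> ?v (\<Union>i<n. A i) \<omega>"
    proof (induction n)
      case (Suc n)
      have d: "(\<Union>i<n. A i) \<inter> A n = {}"
      proof -
        have "A i \<inter> A n = {}" if "i < n" for i
          using disj that by (auto simp: disjoint_family_on_def)
        then show ?thesis by blast
      qed
      have "(\<Union>i<Suc n. A i) = (\<Union>i<n. A i) \<union> A n" by (auto simp: lessThan_Suc)
      moreover have "AE \<omega> in M. ?v (\<Union>i<n. A i) \<omega> + ?v (A n) \<omega> \<le> ?v ((\<Union>i<n. A i) \<union> A n) \<omega>"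
        using d by (intro tot_variation_superadditive) auto
      ultimately have "AE \<omega> in M. ?v (\<Union>i<n. A i) \<omega> + ?v (A n) \<omega> \<le> ?v (\<Union>i<Suc n. A i) \<omega>"
        by (simp only:)
      with Suc show ?case
      proof eventually_elim
        case (elim \<omega>)
        show ?case unfolding sum.lessThan_Suc
          by (rule order_trans[OF add_right_mono[OF elim(1)] elim(2)])
      qed
    qed simp
    moreover have "AE \<omega> in M. ?v (\<Union>i<n. A i) \<omega> \<le> ?v (\<Union>i. A i) \<omega>"
      by (rule tot_variation_mono) auto
    ultimately show "AE \<omega> in M. (\<Sum>i<n. ?v (A i) \<omega>) \<le> ?v (\<Union>i. A i) \<omega>"
      by eventually_elim (rule order_trans)
  qed
  ultimately show ?thesis
  proof eventually_elim
    case (elim \<omega>)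
    have "(\<Sum>i. ?v (A i) \<omega>) \<le> ?v (\<Union>i. A i) \<omega>"
      using elim(2) by (intro suminf_le_const) auto
    then show ?case using elim(1) by (rule antisym[rotated])
  qed
qed

section \<open>The mean total variation as a measure\<close>

lemma sets_nu [measurable_cong]: "sets (nu M D) = sets borel"
  and space_nu: "space (nu M D) = UNIV"
  using sets.sigma_sets_eq[of "borel :: real measure"] by (auto simp: nu_def sets_measure_of_conv space_measure_of_conv)

lemma emeasure_nu:
  assumes "A \<in> sets borel" shows "emeasure (nu M D) A = (\<integral>\<^sup>+\<omega>. tot_variation M D A \<omega> \<partial>M)"
proof -
  have "AE \<omega> in M. tot_variation M D {} \<omega> \<le> 0"
  proof (rule tot_variation_least)
    fix P :: "real set set" assume "partition_on {} P"
    then have "P = {}" by (auto simp: partition_on_def)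
    then show "AE \<omega> in M. (\<Sum>B\<in>P. ennreal (cmod (D B \<omega>))) \<le> 0" by simp
  qed auto
  then have "(\<integral>\<^sup>+\<omega>. tot_variation M D {} \<omega> \<partial>M) = 0"
    by (subst nn_integral_0_iff_AE) auto
  moreover have "countably_additive (sets borel) (\<lambda>A. \<integral>\<^sup>+\<omega>. tot_variation M D A \<omega> \<partial>M)"
    unfolding countably_additive_def
  proof (intro allI impI)
    fix A :: "nat \<Rightarrow> real set" assume A: "range A \<subseteq> sets borel" "disjoint_family A"
    have [measurable]: "A i \<in> sets borel" for i using A by auto
    have "(\<Sum>i. \<integral>\<^sup>+\<omega>. tot_variation M D (A i) \<omega> \<partial>M) = (\<integral>\<^sup>+\<omega>. (\<Sum>i. tot_variation M D (A i) \<omega>) \<partial>M)"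
      by (rule nn_integral_suminf[symmetric]) measurable
    also have "\<dots> = (\<integral>\<^sup>+\<omega>. tot_variation M D (\<Union>i. A i) \<omega> \<partial>M)"
      using tot_variation_UN[OF A] by (intro nn_integral_cong_AE) (auto elim: eventually_mono)
    finally show "(\<Sum>i. \<integral>\<^sup>+\<omega>. tot_variation M D (A i) \<omega> \<partial>M) = (\<integral>\<^sup>+\<omega>. tot_variation M D (\<Union>i. A i) \<omega> \<partial>M)" .
  qed
  ultimately show ?thesis
    unfolding nu_def using assms sets.sigma_algebra_axioms[of "borel :: real measure"]
    by (intro emeasure_measure_of_sigma) (auto simp: positive_def)
qed

lemma nn_integral_D_le_nu:
  assumes A: "A \<in> sets borel" shows "(\<integral>\<^sup>+\<omega>. ennreal (cmod (D A \<omega>)) \<partial>M) \<le> emeasure (nu M D) A"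
  unfolding emeasure_nu[OF A]
  using tot_variation_ge[of "{()}" "\<lambda>_. A"] A
  by (intro nn_integral_mono_AE) (auto simp: disjoint_family_on_def)

end

section \<open>Integrals of simple functions\<close>

text \<open>From (1 - x / 2) (1 + x) \<ge> 1 on [0, 1] and exp x \<ge> 1 + x. It converts a small
  characteristic exponent into a proportional deviation of the characteristic function from
  1.\<close>

lemma half_le_one_minus_exp: "0 \<le> x \<Longrightarrow> x \<le> 1 \<Longrightarrow> x / 2 \<le> 1 - exp (- x)" for x :: real
proof -
  assume x: "0 \<le> x" "x \<le> 1"
  have "x * x \<le> x * 1" using x by (intro mult_left_mono)
  then have "1 \<le> (1 - x / 2) * (1 + x)" by (simp add: algebra_simps)
  also have "\<dots> \<le> (1 - x / 2) * exp x" using x by (intro mult_left_mono exp_ge_add_one_self) simp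
  finally have "1 * exp (- x) \<le> (1 - x / 2) * exp x * exp (- x)" by (intro mult_right_mono) auto
  then show ?thesis by (simp add: mult.assoc exp_add[symmetric])
qed

context prob_space
begin

text \<open>Characteristic functions are Lipschitz for the distance in mean, because
  \<open>iexp\<close> is 1-Lipschitz.\<close>

lemma norm_iexp_integral_diff_le:
  assumes [measurable]: "X \<in> borel_measurable M" "Y \<in> borel_measurable M"
  shows "ennreal (cmod ((\<integral>\<omega>. iexp (Re (X \<omega>)) \<partial>M) - (\<integral>\<omega>. iexp (Re (Y \<omega>)) \<partial>M)))
    \<le> (\<integral>\<^sup>+\<omega>. ennreal (cmod (X \<omega> - Y \<omega>)) \<partial>M)"
proof -
  have i: "integrable M (\<lambda>\<omega>. iexp (Re (X \<omega>)))" "integrable M (\<lambda>\<omega>. iexp (Re (Y \<omega>)))"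
    by (auto intro: integrable_iexp_Re)
  have "(\<integral>\<omega>. iexp (Re (X \<omega>)) \<partial>M) - (\<integral>\<omega>. iexp (Re (Y \<omega>)) \<partial>M) = (\<integral>\<omega>. iexp (Re (X \<omega>)) - iexp (Re (Y \<omega>)) \<partial>M)"
    by (rule Bochner_Integration.integral_diff[OF i, symmetric])
  then have "ennreal (cmod ((\<integral>\<omega>. iexp (Re (X \<omega>)) \<partial>M) - (\<integral>\<omega>. iexp (Re (Y \<omega>)) \<partial>M)))
    \<le> (\<integral>\<^sup>+\<omega>. ennreal (cmod (iexp (Re (X \<omega>)) - iexp (Re (Y \<omega>)))) \<partial>M)"
    using integral_norm_bound_ennreal[OF Bochner_Integration.integrable_diff[OF i]] by (simp only:)
  also have "\<dots> \<le> (\<integral>\<^sup>+\<omega>. ennreal (cmod (X \<omega> - Y \<omega>)) \<partial>M)"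
  proof (intro nn_integral_mono ennreal_leI)
    fix \<omega>
    have "cmod (iexp (Re (X \<omega>)) - iexp (Re (Y \<omega>))) \<le> \<bar>Re (X \<omega>) - Re (Y \<omega>)\<bar>"
      by (rule cmod_iexp_diff_le)
    also have "\<dots> \<le> cmod (X \<omega> - Y \<omega>)"
      using abs_Re_le_cmod[of "X \<omega> - Y \<omega>"] by simp
    finally show "cmod (iexp (Re (X \<omega>)) - iexp (Re (Y \<omega>))) \<le> cmod (X \<omega> - Y \<omega>)" .
  qed
  finally show ?thesis .
qed

end

context stable_random_measure
begin

lemma mass_mono: "A \<subseteq> B \<Longrightarrow> A \<in> sets borel \<Longrightarrow> B \<in> sets borel \<Longrightarrow> mass A \<le> mass B"
  using finite_measure.finite_measure_mono[OF finite_control, of A B]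
  by (simp add: measure_control sets_control)

lemma mass_empty: "mass {} = 0"
  using measure_control[of "{}"] by simp

lemma log_cf_empty: "log_cf {} \<theta> = 0"
  using log_cf_le[of "{}" \<theta>] log_cf_nonneg[of "{}" \<theta>] by (simp add: mass_empty)

lemma log_cf_zero: "log_cf A 0 = 0"
  by (simp add: log_cf_def)

lemma log_cf_Un:
  assumes "A \<in> sets borel" "B \<in> sets borel" "A \<inter> B = {}"
  shows "log_cf (A \<union> B) \<theta> = log_cf A \<theta> + log_cf B \<theta>"
proof -
  have "(\<lambda>i. log_cf (binaryset A B i) \<theta>) sums log_cf (\<Union>i. binaryset A B i) \<theta>"
  proof (rule log_cf_sums)
    show "range (binaryset A B) \<subseteq> sets borel" using assms by (simp add: range_binaryset_eq)
    show "disjoint_family (binaryset A B)"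
      using assms(3) by (auto simp: disjoint_family_on_def binaryset_def)
  qed
  moreover have "(\<lambda>i. log_cf (binaryset A B i) \<theta>) sums (log_cf A \<theta> + log_cf B \<theta>)"
    using binaryset_sums[of "\<lambda>A. log_cf A \<theta>"] by (simp add: log_cf_empty)
  ultimately show ?thesis unfolding UN_binaryset_eq by (rule sums_unique2)
qed

text \<open>\<open>D A\<close> is compared with the variable 0, whose characteristic function is 1;
  this gives a lower bound for \<open>nu\<close>.\<close>

lemma one_minus_cf_le_nu:
  assumes [measurable]: "A \<in> sets borel"
  shows "ennreal (1 - exp (- log_cf A \<theta>)) \<le> ennreal (cmod \<theta>) * emeasure (nu M D) A"
proof -
  have "ennreal (1 - exp (- log_cf A \<theta>))
    = ennreal (cmod ((\<integral>\<omega>. iexp (Re (cnj \<theta> * D A \<omega>)) \<partial>M) - (\<integral>\<omega>. iexp (Re 0) \<partial>M)))"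
  proof -
    have "cmod (complex_of_real (exp (- log_cf A \<theta>)) - 1) = \<bar>exp (- log_cf A \<theta>) - 1\<bar>"
      by (metis norm_of_real of_real_1 of_real_diff)
    also have "\<dots> = 1 - exp (- log_cf A \<theta>)" using log_cf_nonneg[of A \<theta>] by simp
    finally show ?thesis unfolding iexp_log_cf[OF assms] by (simp add: prob_space)
  qed
  also have "\<dots> \<le> (\<integral>\<^sup>+\<omega>. ennreal (cmod (cnj \<theta> * D A \<omega> - 0)) \<partial>M)"
    by (rule norm_iexp_integral_diff_le) measurable
  also have "\<dots> = ennreal (cmod \<theta>) * (\<integral>\<^sup>+\<omega>. ennreal (cmod (D A \<omega>)) \<partial>M)"
    by (simp add: norm_mult ennreal_mult nn_integral_cmult)
  also have "\<dots> \<le> ennreal (cmod \<theta>) * emeasure (nu M D) A"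
    by (intro mult_left_mono nn_integral_D_le_nu) auto
  finally show ?thesis .
qed

text \<open>A point of A is not an atom, so by continuity from above it has a ball whose trace on A
  has mass at most \<epsilon>. The Lindelof property leaves countably many open sets, and making
  their traces disjoint only shrinks them.\<close>

lemma small_mass_partition:
  assumes A [measurable]: "A \<in> sets borel" and atomless: "\<And>x. x \<in> A \<Longrightarrow> mass {x} = 0" and "0 < \<epsilon>"
  obtains B where "range B \<subseteq> sets borel" "disjoint_family B" "(\<Union>i. B i) = A" "\<And>i::nat. mass (B i) \<le> \<epsilon>"
proof -
  interpret control: finite_measure control by (rule finite_control)
  define \<F> where "\<F> = {U. open U \<and> mass (U \<inter> A) \<le> \<epsilon>}"
  have cov: "x \<in> \<Union>\<F>" if "x \<in> A" for x
  proof -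
    let ?b = "\<lambda>k::nat. ball x (inverse (real (Suc k))) \<inter> A"
    have "(\<lambda>k. measure control (?b k)) \<longlonglongrightarrow> measure control (\<Inter>k. ?b k)"
    proof (rule control.finite_Lim_measure_decseq)
      show "decseq ?b"
        unfolding decseq_def by (intro allI impI Int_mono subset_ball le_imp_inverse_le) auto
    qed (auto simp: sets_control)
    moreover have "(\<Inter>k. ?b k) = {x}"
    proof (intro equalityI subsetI)
      fix y assume y: "y \<in> (\<Inter>k. ?b k)"
      have "\<not> 0 < dist x y"
      proof
        assume "0 < dist x y"
        then obtain k where "inverse (real (Suc k)) < dist x y" using reals_Archimedean by blast
        moreover have "dist x y < inverse (real (Suc k))" using y by (auto simp del: of_nat_Suc)
        ultimately show False by simp
      qed
      then show "y \<in> {x}" by simp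
    qed (use that in auto)
    ultimately have "(\<lambda>k. mass (?b k)) \<longlonglongrightarrow> 0"
      using atomless[OF that] by (simp add: measure_control)
    then have "\<forall>\<^sub>F k in sequentially. mass (?b k) < \<epsilon>"
      using \<open>0 < \<epsilon>\<close> by (rule order_tendstoD)
    then obtain k where "mass (?b k) < \<epsilon>" by (auto simp: eventually_sequentially)
    then have "ball x (inverse (real (Suc k))) \<in> \<F>" by (simp add: \<F>_def)
    then show ?thesis by (intro UnionI) auto
  qed
  have "openin (top_of_set UNIV) S" if "S \<in> \<F>" for S using that by (simp add: \<F>_def)
  then obtain \<F>' where F': "\<F>' \<subseteq> \<F>" "countable \<F>'" "\<Union>\<F>' = \<Union>\<F>"
    by (rule Lindelof_openin)
  have "{} \<in> \<F>" using \<open>0 < \<epsilon>\<close> by (simp add: \<F>_def mass_empty)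
  \<comment> \<open>The empty set is added so that the enumerated family is not empty.\<close>
  define G where "G = from_nat_into (insert {} \<F>')"
  have rG: "range G = insert {} \<F>'"
    unfolding G_def using F'(2) by (intro range_from_nat_into) auto
  have G: "G i \<in> \<F>" for i
  proof -
    have "G i \<in> insert {} \<F>'" unfolding rG[symmetric] by (rule rangeI)
    then show ?thesis using F'(1) \<open>{} \<in> \<F>\<close> by auto
  qed
  then have [measurable]: "G i \<in> sets borel" for i by (auto simp: \<F>_def)
  define B where "B = disjointed (\<lambda>i. G i \<inter> A)"
  have B_sub: "B i \<subseteq> G i \<inter> A" for i unfolding B_def by (rule disjointed_subset)
  have B_sets: "range B \<subseteq> sets borel" unfolding B_def by (rule sets.range_disjointed_sets) auto
  show thesis
  proof (rule that[of B])
    show "disjoint_family B" unfolding B_def by (rule disjoint_family_disjointed)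
    have "(\<Union>i. B i) = (\<Union>i. G i) \<inter> A" unfolding B_def UN_disjointed_eq by auto
    also have "(\<Union>i. G i) = \<Union>\<F>" using rG F'(3) by auto
    finally show "(\<Union>i. B i) = A" using cov by auto
    show "mass (B i) \<le> \<epsilon>" for i
      using mass_mono[OF B_sub[of i]] B_sets G[of i] by (auto simp: \<F>_def intro: order_trans)
  qed (rule B_sets)
qed

text \<open>On a set of small mass \<open>\<epsilon>\<close> the mean of \<open>|D B|\<close> is of order \<open>\<epsilon>\<^bsup>1/\<alpha>\<^esup>\<close>, much larger than \<open>\<epsilon>\<close>: hence the
  total variation has infinite mean on every set that carries an atomless part of the control measure.\<close>

lemma nu_finite_imp_null:
  assumes A [measurable]: "A \<in> sets borel" and fin: "emeasure (nu M D) A \<noteq> \<infinity>"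
    and atomless: "\<And>x. x \<in> A \<Longrightarrow> mass {x} = 0"
  shows "mass A = 0"
proof -
  define V where "V = enn2real (emeasure (nu M D) A)"
  have V: "emeasure (nu M D) A = ennreal V" "0 \<le> V"
    using fin by (auto simp: V_def less_top)
  \<comment> \<open>The frequency t is matched with pieces of mass at most t^(-\<alpha>): each
    exponent at t \<theta> is then at most 1, where \<open>half_le_one_minus_exp\<close> applies.
    Summation gives the order t^\<alpha> on the left against t on the right, which for \<alpha> > 1
    and t tending to infinity forces the exponent of A to vanish.\<close>
  have *: "t powr \<alpha> / 2 * log_cf A \<theta> \<le> t * V" if t: "0 < t" and \<theta>: "cmod \<theta> = 1" for t \<theta>
  proof -
    obtain B where B: "range B \<subseteq> sets borel" "disjoint_family B" "(\<Union>i. B i) = A"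
        "\<And>i::nat. mass (B i) \<le> t powr (- \<alpha>)"
      by (rule small_mass_partition[OF A atomless, of "t powr (- \<alpha>)"]) (use t in auto)
    have [measurable]: "B i \<in> sets borel" for i using B(1) by auto
    have piece: "ennreal (t powr \<alpha> / 2 * log_cf (B i) \<theta>) \<le> ennreal t * emeasure (nu M D) (B i)" for i
    proof -
      have sc: "log_cf (B i) (of_real t * \<theta>) = t powr \<alpha> * log_cf (B i) \<theta>"
        using t by (simp add: log_cf_scale)
      have "log_cf (B i) \<theta> \<le> t powr (- \<alpha>)"
        using log_cf_le[of "B i" \<theta>] B(4)[of i] \<theta> by simp
      then have "t powr \<alpha> * log_cf (B i) \<theta> \<le> t powr \<alpha> * t powr (- \<alpha>)"
        by (intro mult_left_mono) auto
      also have "\<dots> = 1" using t by (simp add: powr_add[symmetric])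
      finally have "t powr \<alpha> * log_cf (B i) \<theta> / 2 \<le> 1 - exp (- log_cf (B i) (of_real t * \<theta>))"
        unfolding sc by (intro half_le_one_minus_exp) (auto simp: log_cf_nonneg)
      then have "ennreal (t powr \<alpha> / 2 * log_cf (B i) \<theta>) \<le> ennreal (1 - exp (- log_cf (B i) (of_real t * \<theta>)))"
        by (intro ennreal_leI) simp
      also have "\<dots> \<le> ennreal (cmod (of_real t * \<theta>)) * emeasure (nu M D) (B i)"
        by (rule one_minus_cf_le_nu) simp
      finally show ?thesis using t \<theta> by (simp add: norm_mult)
    qed
    have "(\<lambda>i. t powr \<alpha> / 2 * log_cf (B i) \<theta>) sums (t powr \<alpha> / 2 * log_cf A \<theta>)"
      using sums_mult[OF log_cf_sums[OF B(1,2), of \<theta>]] unfolding B(3) .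
    then have "ennreal (t powr \<alpha> / 2 * log_cf A \<theta>) = (\<Sum>i. ennreal (t powr \<alpha> / 2 * log_cf (B i) \<theta>))"
      by (intro suminf_ennreal_eq[symmetric]) (auto simp: log_cf_nonneg)
    also have "\<dots> \<le> (\<Sum>i. ennreal t * emeasure (nu M D) (B i))"
      using piece by (intro suminf_le) auto
    also have "\<dots> = ennreal t * (\<Sum>i. emeasure (nu M D) (B i))"
      by (rule ennreal_suminf_cmult)
    also have "(\<Sum>i. emeasure (nu M D) (B i)) = emeasure (nu M D) A"
      using B by (subst suminf_emeasure) (auto simp: sets_nu)
    also have "ennreal t * emeasure (nu M D) A = ennreal (t * V)"
      using t V by (simp add: ennreal_mult)
    finally show ?thesis using t V by (subst (asm) ennreal_le_iff) auto
  qed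
  have "log_cf A \<theta> \<le> 0" if \<theta>: "cmod \<theta> = 1" for \<theta>
  proof (rule LIMSEQ_le_const)
    have "(\<lambda>n. real (Suc n) powr (1 - \<alpha>)) \<longlonglongrightarrow> 0"
      using \<alpha> filterlim_compose[OF filterlim_real_sequentially filterlim_Suc] by (intro tendsto_neg_powr) auto
    then show "(\<lambda>n. 2 * V * real (Suc n) powr (1 - \<alpha>)) \<longlonglongrightarrow> 0"
      by (rule tendsto_mult_right_zero)
    show "\<exists>N. \<forall>n\<ge>N. log_cf A \<theta> \<le> 2 * V * real (Suc n) powr (1 - \<alpha>)"
    proof (intro exI allI impI)
      fix n
      let ?t = "real (Suc n)"
      have t: "0 < ?t" by simp
      have "log_cf A \<theta> = 2 * ?t powr (- \<alpha>) * (?t powr \<alpha> / 2 * log_cf A \<theta>)"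
        using t by (simp add: powr_minus)
      also have "\<dots> \<le> 2 * ?t powr (- \<alpha>) * (?t * V)"
        using *[OF t \<theta>] by (intro mult_left_mono) auto
      also have "\<dots> = 2 * V * ?t powr (1 - \<alpha>)"
        using t by (simp add: powr_diff powr_minus divide_inverse)
      finally show "log_cf A \<theta> \<le> 2 * V * ?t powr (1 - \<alpha>)" .
    qed
  qed
  then have "log_cf A (cis \<psi>) = 0" for \<psi> using log_cf_nonneg[of A "cis \<psi>"] by (intro antisym) auto
  then show ?thesis
    using circle_mass[OF A] circle_const_pos[of \<alpha>] \<alpha> mass_nonneg[of A] by (auto simp: ennreal_eq_0_iff)
qed

text \<open>T is the countable set of atoms. Off T, the set where f and the simple function differ
  by at least 1 / (k + 1) has finite \<open>nu\<close> by Markov's inequality, hence mass 0 by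
  \<open>nu_finite_imp_null\<close>. Outside these sets, f has its values in the image of T or in
  the finite range of the simple function.\<close>

lemma countable_range_of_nu_approx:
  assumes [measurable]: "f \<in> borel_measurable borel" and \<phi>: "simple_function borel \<phi>"
    and fin: "(\<integral>\<^sup>+x. ennreal (cmod (\<phi> x - f x)) \<partial>nu M D) < \<infinity>"
  shows "\<exists>N\<in>sets borel. mass N = 0 \<and> countable (f ` (- N))"
proof -
  interpret control: finite_measure control by (rule finite_control)
  define T where "T = {x. mass {x} \<noteq> 0}"
  have T: "countable T"
    using control.countable_support unfolding T_def by (simp add: measure_control)
  then have [measurable]: "T \<in> sets borel"
    using sets.countable[of T borel] by simp
  have [measurable]: "\<phi> \<in> borel_measurable borel"
    using \<phi> by (rule borel_measurable_simple_function)
  define E where "E k = {x. inverse (real (Suc k)) \<le> cmod (\<phi> x - f x)} - T" for k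
  have E [measurable]: "E k \<in> sets borel" for k unfolding E_def by measurable
  have E0: "mass (E k) = 0" for k
  proof (rule nu_finite_imp_null[OF E])
    have "ennreal (inverse (real (Suc k))) * emeasure (nu M D) (E k)
      = (\<integral>\<^sup>+x. ennreal (inverse (real (Suc k))) * indicator (E k) x \<partial>nu M D)"
      by (rule nn_integral_cmult_indicator[symmetric]) (simp add: sets_nu)
    also have "\<dots> \<le> (\<integral>\<^sup>+x. ennreal (cmod (\<phi> x - f x)) \<partial>nu M D)"
      by (intro nn_integral_mono) (auto simp: E_def indicator_def intro!: ennreal_leI simp del: of_nat_Suc)
    also note fin
    finally show "emeasure (nu M D) (E k) \<noteq> \<infinity>"
      by (auto simp: ennreal_mult_less_top simp del: of_nat_Suc)
    show "mass {x} = 0" if "x \<in> E k" for x using that by (simp add: E_def T_def)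
  qed
  have "(\<Union>k. E k) \<in> null_sets control"
    by (rule null_sets_UN) (simp add: null_sets_def sets_control emeasure_control E0)
  then have m0: "mass (\<Union>k. E k) = 0"
    by (simp add: null_sets_def emeasure_control sets_control mass_nonneg ennreal_eq_0_iff antisym)
  have "f ` (- (\<Union>k. E k)) \<subseteq> f ` T \<union> range \<phi>"
  proof (rule image_subsetI)
    fix x assume x: "x \<in> - (\<Union>k. E k)"
    show "f x \<in> f ` T \<union> range \<phi>"
    proof (cases "x \<in> T")
      case False
      have "\<not> 0 < cmod (\<phi> x - f x)"
      proof
        assume "0 < cmod (\<phi> x - f x)"
        then obtain k where "inverse (real (Suc k)) < cmod (\<phi> x - f x)" using reals_Archimedean by blast
        then have "x \<in> E k" using False by (simp add: E_def)
        then show False using x by blast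
      qed
      then have "f x = \<phi> x" by simp
      then show ?thesis by simp
    qed simp
  qed
  moreover have "countable (f ` T \<union> range \<phi>)"
    using T simple_functionD(1)[OF \<phi>] by (auto intro: countable_finite)
  ultimately have "countable (f ` (- (\<Union>k. E k)))" by (rule countable_subset)
  then show ?thesis using m0 by (intro bexI[of _ "\<Union>k. E k"]) auto
qed

section \<open>Integrals over finite partitions\<close>

lemma iexp_sum_disjoint_finite:
  assumes I: "finite I" "\<And>i. i \<in> I \<Longrightarrow> C i \<in> sets borel" "disjoint_family_on C I"
  shows "(\<integral>\<omega>. iexp (Re (\<Sum>i\<in>I. a i * D (C i) \<omega>)) \<partial>M) = of_real (exp (- (\<Sum>i\<in>I. log_cf (C i) (cnj (a i)))))"
proof -
  obtain h where h: "bij_betw h {0..<card I} I"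
    using ex_bij_betw_nat_finite[OF I(1)] by blast
  then have h: "bij_betw h {..<card I} I" by (simp add: atLeast0LessThan)
  have hI: "h j \<in> I" if "j < card I" for j using h that by (auto simp: bij_betw_def)
  have "(\<integral>\<omega>. iexp (Re (\<Sum>j<card I. cnj (cnj (a (h j))) * D (C (h j)) \<omega>)) \<partial>M)
    = of_real (exp (- (\<Sum>j<card I. log_cf (C (h j)) (cnj (a (h j))))))"
  proof (rule iexp_sum_disjoint)
    show "disjoint_family_on (\<lambda>j. C (h j)) {..<card I}"
      using I(3) h unfolding disjoint_family_on_def bij_betw_def inj_on_def by blast
  qed (use I hI in auto)
  moreover have "(\<Sum>j<card I. cnj (cnj (a (h j))) * D (C (h j)) \<omega>) = (\<Sum>i\<in>I. a i * D (C i) \<omega>)" for \<omega>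
    using sum.reindex_bij_betw[OF h, of "\<lambda>i. a i * D (C i) \<omega>"] by simp
  moreover have "(\<Sum>j<card I. log_cf (C (h j)) (cnj (a (h j)))) = (\<Sum>i\<in>I. log_cf (C i) (cnj (a i)))"
    by (rule sum.reindex_bij_betw[OF h])
  ultimately show ?thesis by (simp only:)
qed

text \<open>\<open>simple_integral_rm\<close> sums over level sets; any finite partition on which
  the function is constant serves as well. The identity is only almost sure, like the additivity of
  \<open>D\<close>.\<close>

lemma simple_integral_eq_sum:
  assumes I: "finite I" "\<And>i. i \<in> I \<Longrightarrow> C i \<in> sets borel" "disjoint_family_on C I" "(\<Union>i\<in>I. C i) = UNIV"
    and a: "\<And>i x. i \<in> I \<Longrightarrow> x \<in> C i \<Longrightarrow> \<phi> x = a i"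
  shows "AE \<omega> in M. simple_integral_rm D \<phi> \<omega> = (\<Sum>i\<in>I. a i * D (C i) \<omega>)"
proof -
  have rng: "range \<phi> \<subseteq> a ` I"
  proof (rule image_subsetI)
    fix x obtain i where "i \<in> I" "x \<in> C i" using I(4) by blast
    then show "\<phi> x \<in> a ` I" using a by blast
  qed
  then have fin: "finite (range \<phi>)" using I(1) finite_subset by blast
  have pre: "\<phi> -` {z} = (\<Union>i\<in>{i \<in> I. a i = z}. C i)" for z
  proof (intro equalityI subsetI)
    fix x assume x: "x \<in> \<phi> -` {z}"
    obtain i where "i \<in> I" "x \<in> C i" using I(4) by blast
    then show "x \<in> (\<Union>i\<in>{i \<in> I. a i = z}. C i)" using a x by auto
  qed (use a in auto)
  have "AE \<omega> in M. \<forall>z\<in>range \<phi>. D (\<phi> -` {z}) \<omega> = (\<Sum>i\<in>{i \<in> I. a i = z}. D (C i) \<omega>)"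
  proof (intro AE_finite_allI fin)
    fix z
    have "disjoint_family_on C {i \<in> I. a i = z}" using I(3) by (auto simp: disjoint_family_on_def)
    then show "AE \<omega> in M. D (\<phi> -` {z}) \<omega> = (\<Sum>i\<in>{i \<in> I. a i = z}. D (C i) \<omega>)"
      unfolding pre using I by (intro D_UN_finite) auto
  qed
  with D_empty show ?thesis
  proof eventually_elim
    case (elim \<omega>)
    let ?J = "{i \<in> I. a i \<in> range \<phi> - {0}}"
    have "simple_integral_rm D \<phi> \<omega> = (\<Sum>z\<in>range \<phi> - {0}. \<Sum>i\<in>{i \<in> ?J. a i = z}. a i * D (C i) \<omega>)"
      unfolding simple_integral_rm_def
    proof (rule sum.cong[OF refl])
      fix z assume z: "z \<in> range \<phi> - {0}"
      then have J: "{i \<in> ?J. a i = z} = {i \<in> I. a i = z}" by auto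
      have "z * D (\<phi> -` {z}) \<omega> = (\<Sum>i\<in>{i \<in> I. a i = z}. z * D (C i) \<omega>)"
      proof -
        have "D (\<phi> -` {z}) \<omega> = (\<Sum>i\<in>{i \<in> I. a i = z}. D (C i) \<omega>)"
          using bspec[OF elim(2)] z by blast
        then show ?thesis by (simp only: sum_distrib_left)
      qed
      also have "\<dots> = (\<Sum>i\<in>{i \<in> ?J. a i = z}. a i * D (C i) \<omega>)"
        unfolding J by (intro sum.cong) auto
      finally show "z * D (\<phi> -` {z}) \<omega> = (\<Sum>i\<in>{i \<in> ?J. a i = z}. a i * D (C i) \<omega>)" .
    qed
    also have "\<dots> = (\<Sum>i\<in>?J. a i * D (C i) \<omega>)"
      using I(1) fin by (intro sum.group) auto
    also have "\<dots> = (\<Sum>i\<in>I. a i * D (C i) \<omega>)"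
    proof (intro sum.mono_neutral_left ballI)
      fix i assume i: "i \<in> I - ?J"
      \<comment> \<open>A coefficient that is not a nonzero value of the function is either 0 or
        belongs to an empty cell, where \<open>D\<close> vanishes.\<close>
      show "a i * D (C i) \<omega> = 0"
      proof (cases "C i = {}")
        case False
        then obtain x where "x \<in> C i" by blast
        then have "a i \<in> range \<phi>" using a[of i x] i rangeI[of \<phi> x] by simp
        then have "a i = 0" using i by simp
        then show ?thesis by simp
      qed (use elim in simp)
    qed (use I in auto)
    finally show ?case .
  qed
qed

lemma simple_integral_iexp:
  assumes I: "finite I" "\<And>i. i \<in> I \<Longrightarrow> C i \<in> sets borel" "disjoint_family_on C I" "(\<Union>i\<in>I. C i) = UNIV"
    and a: "\<And>i x. i \<in> I \<Longrightarrow> x \<in> C i \<Longrightarrow> \<phi> x = a i"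
    and [measurable]: "simple_integral_rm D \<phi> \<in> borel_measurable M"
  shows "(\<integral>\<omega>. iexp (Re (simple_integral_rm D \<phi> \<omega>)) \<partial>M) = of_real (exp (- (\<Sum>i\<in>I. log_cf (C i) (cnj (a i)))))"
proof -
  have "(\<integral>\<omega>. iexp (Re (simple_integral_rm D \<phi> \<omega>)) \<partial>M) = (\<integral>\<omega>. iexp (Re (\<Sum>i\<in>I. a i * D (C i) \<omega>)) \<partial>M)"
  proof (rule integral_cong_AE)
    show "AE \<omega> in M. iexp (Re (simple_integral_rm D \<phi> \<omega>)) = iexp (Re (\<Sum>i\<in>I. a i * D (C i) \<omega>))"
    proof -
      have "AE \<omega> in M. simple_integral_rm D \<phi> \<omega> = (\<Sum>i\<in>I. a i * D (C i) \<omega>)"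
        by (rule simple_integral_eq_sum) (use I a in auto)
      then show ?thesis by eventually_elim (simp only:)
    qed
    have "(\<lambda>\<omega>. \<Sum>i\<in>I. a i * D (C i) \<omega>) \<in> borel_measurable M"
      using I by (intro borel_measurable_sum borel_measurable_times D_measurable) auto
    then show "(\<lambda>\<omega>. iexp (Re (\<Sum>i\<in>I. a i * D (C i) \<omega>))) \<in> borel_measurable M"
      by measurable
  qed measurable
  then show ?thesis using iexp_sum_disjoint_finite[OF I(1-3), of a] by simp
qed

lemma simple_vimage:
  assumes "simple_function borel \<phi>"
  shows "finite (range \<phi>)" "\<phi> -` A \<in> sets (borel :: real measure)"
  using simple_functionD[OF assms] by auto

lemma simple_integral_measurable [measurable]:
  assumes "simple_function borel \<phi>" shows "simple_integral_rm D \<phi> \<in> borel_measurable M"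
  unfolding simple_integral_rm_def[abs_def]
  by (intro borel_measurable_sum borel_measurable_times D_measurable simple_vimage[OF assms]) auto

lemma simple_integral_linear:
  assumes \<phi>: "simple_function borel \<phi>" and \<psi>: "simple_function borel \<psi>"
  shows "AE \<omega> in M. simple_integral_rm D (\<lambda>x. a * \<phi> x + b * \<psi> x) \<omega>
    = a * simple_integral_rm D \<phi> \<omega> + b * simple_integral_rm D \<psi> \<omega>"
proof -
  define I where "I = range \<phi> \<times> range \<psi>"
  define C where "C i = \<phi> -` {fst i} \<inter> \<psi> -` {snd i}" for i
  have I: "finite I" "\<And>i. i \<in> I \<Longrightarrow> C i \<in> sets borel" "disjoint_family_on C I" "(\<Union>i\<in>I. C i) = UNIV"
    using simple_vimage[OF \<phi>] simple_vimage[OF \<psi>]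
    by (auto simp: I_def C_def disjoint_family_on_def)
  have "AE \<omega> in M. simple_integral_rm D (\<lambda>x. a * \<phi> x + b * \<psi> x) \<omega> = (\<Sum>i\<in>I. (a * fst i + b * snd i) * D (C i) \<omega>)"
    by (rule simple_integral_eq_sum[OF I]) (auto simp: C_def)
  moreover have "AE \<omega> in M. simple_integral_rm D \<phi> \<omega> = (\<Sum>i\<in>I. fst i * D (C i) \<omega>)"
    by (rule simple_integral_eq_sum[OF I]) (auto simp: C_def)
  moreover have "AE \<omega> in M. simple_integral_rm D \<psi> \<omega> = (\<Sum>i\<in>I. snd i * D (C i) \<omega>)"
    by (rule simple_integral_eq_sum[OF I]) (auto simp: C_def)
  ultimately show ?thesis
    by eventually_elim (simp add: sum_distrib_left sum.distrib[symmetric] algebra_simps)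
qed

text \<open>The integral contracts from the norm of L1(\<open>nu\<close>) to the mean, because the
  mean of |\<open>D A\<close>| is at most \<open>nu\<close> of A.\<close>

lemma nn_integral_simple_integral_le:
  assumes \<phi>: "simple_function borel \<phi>"
  shows "(\<integral>\<^sup>+\<omega>. ennreal (cmod (simple_integral_rm D \<phi> \<omega>)) \<partial>M) \<le> (\<integral>\<^sup>+x. ennreal (cmod (\<phi> x)) \<partial>nu M D)"
proof -
  note V = simple_vimage[OF \<phi>]
  have [measurable]: "D (\<phi> -` {z}) \<in> borel_measurable M" for z by (intro D_measurable V)
  have "(\<integral>\<^sup>+\<omega>. ennreal (cmod (simple_integral_rm D \<phi> \<omega>)) \<partial>M)
    \<le> (\<integral>\<^sup>+\<omega>. (\<Sum>z\<in>range \<phi> - {0}. ennreal (cmod z) * ennreal (cmod (D (\<phi> -` {z}) \<omega>))) \<partial>M)"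
  proof (intro nn_integral_mono)
    fix \<omega>
    have "ennreal (cmod (simple_integral_rm D \<phi> \<omega>)) \<le> ennreal (\<Sum>z\<in>range \<phi> - {0}. cmod (z * D (\<phi> -` {z}) \<omega>))"
      unfolding simple_integral_rm_def by (intro ennreal_leI norm_sum)
    also have "\<dots> = (\<Sum>z\<in>range \<phi> - {0}. ennreal (cmod z) * ennreal (cmod (D (\<phi> -` {z}) \<omega>)))"
      by (subst sum_ennreal[symmetric]) (auto simp: norm_mult ennreal_mult)
    finally show "ennreal (cmod (simple_integral_rm D \<phi> \<omega>))
      \<le> (\<Sum>z\<in>range \<phi> - {0}. ennreal (cmod z) * ennreal (cmod (D (\<phi> -` {z}) \<omega>)))" .
  qed
  also have "\<dots> = (\<Sum>z\<in>range \<phi> - {0}. ennreal (cmod z) * (\<integral>\<^sup>+\<omega>. ennreal (cmod (D (\<phi> -` {z}) \<omega>)) \<partial>M))"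
    by (simp add: nn_integral_sum nn_integral_cmult)
  also have "\<dots> \<le> (\<Sum>z\<in>range \<phi> - {0}. ennreal (cmod z) * emeasure (nu M D) (\<phi> -` {z}))"
    by (intro sum_mono mult_left_mono nn_integral_D_le_nu V) auto
  also have "\<dots> = (\<integral>\<^sup>+x. (\<Sum>z\<in>range \<phi> - {0}. ennreal (cmod z) * indicator (\<phi> -` {z}) x) \<partial>nu M D)"
    using V by (subst nn_integral_sum) (auto simp: sets_nu nn_integral_cmult_indicator intro!: sum.cong)
  also have "\<dots> = (\<integral>\<^sup>+x. ennreal (cmod (\<phi> x)) \<partial>nu M D)"
  proof (intro nn_integral_cong)
    fix x
    have "(\<Sum>z\<in>range \<phi> - {0}. ennreal (cmod z) * indicator (\<phi> -` {z}) x)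
      = (\<Sum>z\<in>range \<phi> - {0}. if z = \<phi> x then ennreal (cmod (\<phi> x)) else 0)"
      by (intro sum.cong) (auto simp: indicator_def)
    also have "\<dots> = ennreal (cmod (\<phi> x))" using V(1) by (subst sum.delta) auto
    finally show "(\<Sum>z\<in>range \<phi> - {0}. ennreal (cmod z) * indicator (\<phi> -` {z}) x) = ennreal (cmod (\<phi> x))" .
  qed
  finally show ?thesis .
qed

text \<open>Approximating simple functions may have infinite norm individually; it is their
  differences that have to be controlled.\<close>

lemma nn_integral_simple_integral_diff_le:
  assumes \<phi>: "simple_function borel \<phi>" and \<psi>: "simple_function borel \<psi>"
  shows "(\<integral>\<^sup>+\<omega>. ennreal (cmod (simple_integral_rm D \<phi> \<omega> - simple_integral_rm D \<psi> \<omega>)) \<partial>M)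
    \<le> (\<integral>\<^sup>+x. ennreal (cmod (\<phi> x - \<psi> x)) \<partial>nu M D)"
proof -
  have s: "simple_function borel (\<lambda>x. 1 * \<phi> x + (-1) * \<psi> x)"
    using simple_function_diff[OF \<phi> \<psi>] by simp
  have "(\<integral>\<^sup>+\<omega>. ennreal (cmod (simple_integral_rm D \<phi> \<omega> - simple_integral_rm D \<psi> \<omega>)) \<partial>M)
    = (\<integral>\<^sup>+\<omega>. ennreal (cmod (simple_integral_rm D (\<lambda>x. 1 * \<phi> x + (-1) * \<psi> x) \<omega>)) \<partial>M)"
    using simple_integral_linear[OF \<phi> \<psi>, of 1 "-1"]
    by (intro nn_integral_cong_AE) (auto elim!: eventually_mono)
  also have "\<dots> \<le> (\<integral>\<^sup>+x. ennreal (cmod (1 * \<phi> x + (-1) * \<psi> x)) \<partial>nu M D)"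
    by (rule nn_integral_simple_integral_le[OF s])
  finally show ?thesis by simp
qed

end

section \<open>Limits of integrals of simple functions\<close>

context stable_random_measure
begin

lemma L1_approxD:
  assumes "L1_approx M D \<phi> f"
  shows "simple_function borel (\<phi> n)" "\<phi> n \<in> borel_measurable borel"
    "(\<lambda>n. \<integral>\<^sup>+x. ennreal (cmod (\<phi> n x - f x)) \<partial>nu M D) \<longlonglongrightarrow> 0"
proof -
  show s: "simple_function borel (\<phi> n)"
    using assms by (simp add: L1_approx_def bounded_support_simple_def)
  show "\<phi> n \<in> borel_measurable borel" using s by (rule borel_measurable_simple_function)
  show "(\<lambda>n. \<integral>\<^sup>+x. ennreal (cmod (\<phi> n x - f x)) \<partial>nu M D) \<longlonglongrightarrow> 0"
    using assms by (simp add: L1_approx_def)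
qed

text \<open>Secures the existence behind the \<open>SOME\<close> in \<open>rm_integral\<close>. A
  subsequence with errors below (1/2)^k has integrals whose consecutive mean distances are summable,
  hence it converges almost surely, and it still approximates f.\<close>

lemma simple_integrals_converge:
  assumes \<phi>: "L1_approx M D \<phi> f" and f [measurable]: "f \<in> borel_measurable borel"
  shows "\<exists>Z \<in> borel_measurable M. \<exists>\<psi>. L1_approx M D \<psi> f \<and>
    conv_in_prob M (\<lambda>n. simple_integral_rm D (\<psi> n)) Z sequentially"
proof -
  define e where "e n = (\<integral>\<^sup>+x. ennreal (cmod (\<phi> n x - f x)) \<partial>nu M D)" for n
  have e: "e \<longlonglongrightarrow> 0" unfolding e_def[abs_def] by (rule L1_approxD(3)[OF \<phi>])
  have "\<exists>n. e n < ennreal ((1/2) ^ k)" for k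
  proof -
    have "\<forall>\<^sub>F n in sequentially. e n < ennreal ((1/2) ^ k)"
      using e by (rule order_tendstoD) simp
    then show ?thesis by (auto simp: eventually_sequentially)
  qed
  then obtain r where r: "\<And>k. e (r k) < ennreal ((1/2) ^ k)" by metis
  define \<psi> where "\<psi> k = \<phi> (r k)" for k
  have s: "simple_function borel (\<psi> k)" and [measurable]: "\<psi> k \<in> borel_measurable borel" for k
    unfolding \<psi>_def by (fact L1_approxD[OF \<phi>])+
  have \<psi>: "L1_approx M D \<psi> f"
    unfolding L1_approx_def
  proof (intro conjI allI)
    show "bounded_support_simple (\<psi> n)" for n
      using \<phi> by (simp add: L1_approx_def \<psi>_def)
    have "(\<lambda>k. ennreal ((1/2) ^ k)) \<longlonglongrightarrow> ennreal 0"
      by (intro tendsto_ennrealI LIMSEQ_power_zero) simp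
    then have "(\<lambda>k. e (r k)) \<longlonglongrightarrow> 0"
      by (intro tendsto_sandwich[OF _ _ tendsto_const, of e0 "\<lambda>k. e (r k)" for e0])
         (auto intro!: always_eventually less_imp_le r)
    then show "(\<lambda>n. \<integral>\<^sup>+x. ennreal (cmod (\<psi> n x - f x)) \<partial>nu M D) \<longlonglongrightarrow> 0"
      by (simp add: e_def \<psi>_def)
  qed
  define S where "S k = simple_integral_rm D (\<psi> k)" for k
  have [measurable]: "S k \<in> borel_measurable M" for k
    unfolding S_def by (rule simple_integral_measurable[OF s])
  \<comment> \<open>The triangle inequality through f gives (1/2)^(k + 1) + (1/2)^k, here rounded
    up.\<close>
  have step: "(\<integral>\<^sup>+\<omega>. ennreal (cmod (S (Suc k) \<omega> - S k \<omega>)) \<partial>M) \<le> ennreal (2 * (1/2) ^ k)" for k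
  proof -
    have "(\<integral>\<^sup>+\<omega>. ennreal (cmod (S (Suc k) \<omega> - S k \<omega>)) \<partial>M)
      \<le> (\<integral>\<^sup>+x. ennreal (cmod (\<psi> (Suc k) x - \<psi> k x)) \<partial>nu M D)"
      unfolding S_def by (rule nn_integral_simple_integral_diff_le[OF s s])
    also have "\<dots> \<le> (\<integral>\<^sup>+x. ennreal (cmod (\<psi> (Suc k) x - f x)) + ennreal (cmod (\<psi> k x - f x)) \<partial>nu M D)"
    proof (rule nn_integral_mono)
      fix x
      have "cmod (\<psi> (Suc k) x - \<psi> k x) \<le> cmod (\<psi> (Suc k) x - f x) + cmod (\<psi> k x - f x)"
        using norm_triangle_ineq4[of "\<psi> (Suc k) x - f x" "\<psi> k x - f x"] by simp
      then show "ennreal (cmod (\<psi> (Suc k) x - \<psi> k x)) \<le> ennreal (cmod (\<psi> (Suc k) x - f x)) + ennreal (cmod (\<psi> k x - f x))"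
        unfolding ennreal_plus[OF norm_ge_zero norm_ge_zero, symmetric] by (rule ennreal_leI)
    qed
    also have "\<dots> = e (r (Suc k)) + e (r k)"
      unfolding e_def \<psi>_def[symmetric] by (rule nn_integral_add) (simp_all add: measurable_cong_sets[OF sets_nu refl])
    also have "\<dots> \<le> ennreal ((1/2) ^ Suc k) + ennreal ((1/2) ^ k)"
      using r by (intro add_mono less_imp_le)
    also have "\<dots> = ennreal ((1/2) ^ Suc k + (1/2) ^ k)"
      by (rule ennreal_plus[symmetric]) auto
    also have "\<dots> \<le> ennreal (2 * (1/2) ^ k)"
      by (intro ennreal_leI) simp
    finally show ?thesis .
  qed
  have "(\<integral>\<^sup>+\<omega>. (\<Sum>k. ennreal (cmod (S (Suc k) \<omega> - S k \<omega>))) \<partial>M)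
    = (\<Sum>k. \<integral>\<^sup>+\<omega>. ennreal (cmod (S (Suc k) \<omega> - S k \<omega>)) \<partial>M)"
    by (rule nn_integral_suminf) measurable
  also have "\<dots> \<le> (\<Sum>k. ennreal (2 * (1/2) ^ k))"
    by (intro suminf_le step) auto
  also have "\<dots> = ennreal (\<Sum>k. 2 * (1/2) ^ k)"
    by (intro suminf_ennreal2 summable_mult summable_geometric) auto
  also have "\<dots> < \<infinity>" by simp
  finally have "AE \<omega> in M. (\<Sum>k. ennreal (cmod (S (Suc k) \<omega> - S k \<omega>))) \<noteq> \<infinity>"
    by (intro nn_integral_PInf_AE) auto
  then have lim: "AE \<omega> in M. (\<lambda>k. S k \<omega>) \<longlonglongrightarrow> lim (\<lambda>k. S k \<omega>)"
  proof eventually_elim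
    case (elim \<omega>)
    then have "summable (\<lambda>k. cmod (S (Suc k) \<omega> - S k \<omega>))"
      by (intro summable_suminf_not_top) (auto simp: top_unique)
    then have "summable (\<lambda>k. S (Suc k) \<omega> - S k \<omega>)" by (rule summable_norm_cancel)
    then have "convergent (\<lambda>n. \<Sum>k<n. S (Suc k) \<omega> - S k \<omega>)"
      by (simp only: summable_iff_convergent)
    then have "convergent (\<lambda>n. S n \<omega> - S 0 \<omega>)"
      by (simp only: sum_lessThan_telescope[of "\<lambda>k. S k \<omega>"])
    then have "convergent (\<lambda>n. (S n \<omega> - S 0 \<omega>) + S 0 \<omega>)"
      by (intro convergent_add convergent_const)
    then show ?case by (simp add: convergent_LIMSEQ_iff)
  qed
  have m: "(\<lambda>\<omega>. lim (\<lambda>k. S k \<omega>)) \<in> borel_measurable M"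
    by measurable
  have "conv_in_prob M S (\<lambda>\<omega>. lim (\<lambda>k. S k \<omega>)) sequentially"
    by (rule conv_in_prob_of_AE_tendsto[OF lim _ m]) measurable
  then show ?thesis using m \<psi> unfolding S_def by blast
qed

lemma rm_integral_props:
  assumes "f \<in> Lambda_space M D"
  shows "rm_integral M D f \<in> borel_measurable M \<and> (\<exists>\<phi>. L1_approx M D \<phi> f \<and>
    conv_in_prob M (\<lambda>n. simple_integral_rm D (\<phi> n)) (rm_integral M D f) sequentially)"
  unfolding rm_integral_def
proof (rule someI_ex[where P="\<lambda>Z. Z \<in> borel_measurable M \<and> (\<exists>\<phi>. L1_approx M D \<phi> f \<and>
    conv_in_prob M (\<lambda>n. simple_integral_rm D (\<phi> n)) Z sequentially)"])
  show "\<exists>Z. Z \<in> borel_measurable M \<and> (\<exists>\<phi>. L1_approx M D \<phi> f \<and>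
    conv_in_prob M (\<lambda>n. simple_integral_rm D (\<phi> n)) Z sequentially)"
    using assms simple_integrals_converge unfolding Lambda_space_def by blast
qed

text \<open>The parts of E outside the first K cells decrease to a subset of the null remainder, and
  \<open>log_cf_le\<close> bounds the exponent there by the mass.\<close>

lemma log_cf_Int_tendsto:
  assumes C: "\<And>j::nat. C j \<in> sets borel" and null: "mass (- (\<Union>j. C j)) = 0" and E: "E \<in> sets borel"
  shows "(\<lambda>K. log_cf (E \<inter> (\<Union>j<K. C j)) \<theta>) \<longlonglongrightarrow> log_cf E \<theta>"
proof -
  interpret control: finite_measure control by (rule finite_control)
  let ?W = "\<lambda>K. \<Union>j<K. C j"
  have [measurable]: "?W K \<in> sets borel" "E \<in> sets borel" "(\<Union>j. C j) \<in> sets borel" for K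
    using C E by auto
  have "(\<lambda>K. measure control (E - ?W K)) \<longlonglongrightarrow> measure control (\<Inter>K. E - ?W K)"
  proof (rule control.finite_Lim_measure_decseq)
    show "range (\<lambda>K. E - ?W K) \<subseteq> sets control" by (auto simp: sets_control)
    show "decseq (\<lambda>K. E - ?W K)"
      unfolding decseq_def by (auto dest: order.strict_trans2)
  qed
  moreover have "measure control (\<Inter>K. E - ?W K) = 0"
  proof -
    have i: "(\<Inter>K. E - ?W K) \<in> sets borel" by measurable
    have "(\<Inter>K. E - ?W K) \<subseteq> - (\<Union>j. C j)" by auto
    then have "mass (\<Inter>K. E - ?W K) \<le> 0"
      unfolding null[symmetric] using i by (rule mass_mono) (rule borel_comp, measurable)
    then show ?thesis using mass_nonneg measure_control[OF i] by (simp add: antisym)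
  qed
  ultimately have "(\<lambda>K. mass (E - ?W K)) \<longlonglongrightarrow> 0"
    by (simp add: measure_control)
  then have m0: "(\<lambda>K. cmod \<theta> powr \<alpha> * mass (E - ?W K)) \<longlonglongrightarrow> 0"
    by (rule tendsto_mult_right_zero)
  have "(\<lambda>K. log_cf (E - ?W K) \<theta>) \<longlonglongrightarrow> 0"
    by (rule tendsto_sandwich[OF _ _ tendsto_const m0]) (auto simp: log_cf_nonneg log_cf_le)
  then have "(\<lambda>K. log_cf E \<theta> - log_cf (E - ?W K) \<theta>) \<longlonglongrightarrow> log_cf E \<theta> - 0"
    by (intro tendsto_intros)
  moreover have "log_cf E \<theta> - log_cf (E - ?W K) \<theta> = log_cf (E \<inter> ?W K) \<theta>" for K
  proof -
    have "(E \<inter> ?W K) \<union> (E - ?W K) = E" "(E \<inter> ?W K) \<inter> (E - ?W K) = {}" by blast+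
    then show ?thesis using log_cf_Un[of "E \<inter> ?W K" "E - ?W K" \<theta>] by auto
  qed
  ultimately show ?thesis by simp
qed

lemma simple_function_cut:
  assumes "simple_function borel \<phi>" "W \<in> sets borel"
  shows "simple_function borel (\<lambda>x. if x \<in> W then \<phi> x else (0::complex))"
  using assms by (intro simple_function_If_set) (auto simp: Int_absorb1)

text \<open>The function h may take infinitely many values, so it is not simple itself. Both
  functions are cut off outside the first K cells, where h is simple and its characteristic function
  explicit. Cutting does not increase the distance in L1(\<open>nu\<close>), and both characteristic
  functions converge as K grows: one by \<open>log_cf_Int_tendsto\<close>, the other by
  summability.\<close>

lemma simple_integral_iexp_approx:
  assumes h [measurable]: "h \<in> borel_measurable borel"
    and C: "\<And>j::nat. C j \<in> sets borel" and disj: "disjoint_family C" and null: "mass (- (\<Union>j. C j)) = 0"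
    and c: "\<And>j x. x \<in> C j \<Longrightarrow> h x = c j"
    and sum: "summable (\<lambda>j. log_cf (C j) (cnj (c j)))"
    and \<phi>: "simple_function borel \<phi>"
    and \<epsilon>: "0 \<le> \<epsilon>" "(\<integral>\<^sup>+x. ennreal (cmod (\<phi> x - h x)) \<partial>nu M D) \<le> ennreal \<epsilon>"
  shows "cmod ((\<integral>\<omega>. iexp (Re (simple_integral_rm D \<phi> \<omega>)) \<partial>M)
    - of_real (exp (- (\<Sum>j. log_cf (C j) (cnj (c j)))))) \<le> \<epsilon>"
proof -
  let ?W = "\<lambda>K. \<Union>j<K. C j"
  have W [measurable]: "?W K \<in> sets borel" for K using C by auto
  define \<phi>K where "\<phi>K K x = (if x \<in> ?W K then \<phi> x else 0)" for K x
  define hK where "hK K x = (if x \<in> ?W K then h x else 0)" for K x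
  let ?cf = "\<lambda>u. \<integral>\<omega>. iexp (Re (simple_integral_rm D u \<omega>)) \<partial>M"
  have [measurable]: "\<phi> \<in> borel_measurable borel" using \<phi> by (rule borel_measurable_simple_function)
  have s\<phi>: "simple_function borel (\<phi>K K)" for K
    unfolding \<phi>K_def[abs_def] using \<phi> W by (rule simple_function_cut)
  have sh: "simple_function borel (hK K)" for K
  proof -
    have "hK K ` UNIV \<subseteq> insert 0 (c ` {..<K})"
      using c by (auto simp: hK_def)
    then have "finite (hK K ` UNIV)" by (rule finite_subset) auto
    moreover have "hK K \<in> borel_measurable borel" unfolding hK_def[abs_def] by measurable
    ultimately show ?thesis by (intro simple_function_borel_measurable) auto
  qed
  have cf_h: "?cf (hK K) = of_real (exp (- (\<Sum>j<K. log_cf (C j) (cnj (c j)))))" for K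
  proof -
    \<comment> \<open>Index K is the remainder outside the first K cells, where \<open>hK\<close> is
      0 and adds nothing to the exponent.\<close>
    define C' where "C' j = (if j < K then C j else - ?W K)" for j
    define c' where "c' j = (if j < K then c j else 0)" for j
    have "?cf (hK K) = of_real (exp (- (\<Sum>j\<in>{..K}. log_cf (C' j) (cnj (c' j)))))"
    proof (rule simple_integral_iexp)
      show "C' j \<in> sets borel" for j using C borel_comp[OF W] by (simp add: C'_def)
      show "disjoint_family_on C' {..K}"
        unfolding disjoint_family_on_def
      proof (intro ballI impI)
        fix i j assume ij: "i \<in> {..K}" "j \<in> {..K}" "i \<noteq> j"
        have "C i \<inter> C j = {}" using disj ij by (simp add: disjoint_family_on_def)
        then show "C' i \<inter> C' j = {}" using ij by (auto simp: C'_def)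
      qed
      show "(\<Union>j\<in>{..K}. C' j) = UNIV"
      proof (intro equalityI subsetI UNIV_I)
        fix x
        show "x \<in> (\<Union>j\<in>{..K}. C' j)"
        proof (cases "x \<in> ?W K")
          case True
          then obtain j where "j < K" "x \<in> C j" by blast
          then show ?thesis by (intro UN_I[of j]) (auto simp: C'_def)
        next
          case False
          then show ?thesis by (intro UN_I[of K]) (auto simp: C'_def)
        qed
      qed
      show "hK K x = c' j" if "j \<in> {..K}" "x \<in> C' j" for j x
        using that c by (auto simp: hK_def C'_def c'_def split: if_splits)
      show "simple_integral_rm D (hK K) \<in> borel_measurable M" by (rule simple_integral_measurable[OF sh])
    qed simp
    also have "(\<Sum>j\<in>{..K}. log_cf (C' j) (cnj (c' j))) = (\<Sum>j<K. log_cf (C' j) (cnj (c' j))) + log_cf (C' K) (cnj (c' K))"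
      by (simp add: lessThan_Suc_atMost[symmetric])
    also have "\<dots> = (\<Sum>j<K. log_cf (C j) (cnj (c j)))"
      by (simp add: C'_def c'_def log_cf_zero)
    finally show ?thesis .
  qed
  have cf_\<phi>: "?cf (\<phi>K K) = of_real (exp (- (\<Sum>z\<in>range \<phi>. log_cf (\<phi> -` {z} \<inter> ?W K) (cnj z))))" for K
  proof -
    \<comment> \<open>The boolean records whether the piece of a level set lies inside the first K
      cells; the pieces outside get the value 0.\<close>
    define C' where "C' i = (if snd i then \<phi> -` {fst i} \<inter> ?W K else \<phi> -` {fst i} - ?W K)" for i :: "complex \<times> bool"
    define c' where "c' i = (if snd i then fst i else 0)" for i :: "complex \<times> bool"
    let ?I = "range \<phi> \<times> UNIV"
    have "?cf (\<phi>K K) = of_real (exp (- (\<Sum>i\<in>?I. log_cf (C' i) (cnj (c' i)))))"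
    proof (rule simple_integral_iexp)
      show "C' i \<in> sets borel" for i using simple_vimage(2)[OF \<phi>, of "{fst i}"] W[of K] by (auto simp: C'_def)
      show "disjoint_family_on C' ?I"
        by (auto simp: disjoint_family_on_def C'_def split: if_splits)
      show "(\<Union>i\<in>?I. C' i) = UNIV"
      proof (intro equalityI subsetI UNIV_I)
        fix x show "x \<in> (\<Union>i\<in>?I. C' i)"
          by (rule UN_I[of "(\<phi> x, x \<in> ?W K)"]) (simp_all add: C'_def)
      qed
      show "\<phi>K K x = c' i" if "i \<in> ?I" "x \<in> C' i" for i x
        using that by (auto simp: \<phi>K_def C'_def c'_def split: if_splits)
      show "simple_integral_rm D (\<phi>K K) \<in> borel_measurable M" by (rule simple_integral_measurable[OF s\<phi>])
    qed (use simple_vimage(1)[OF \<phi>] in simp)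
    also have "(\<Sum>i\<in>?I. log_cf (C' i) (cnj (c' i))) = (\<Sum>z\<in>range \<phi>. \<Sum>b\<in>UNIV. log_cf (C' (z, b)) (cnj (c' (z, b))))"
      using simple_vimage(1)[OF \<phi>] by (simp add: sum.cartesian_product)
    also have "\<dots> = (\<Sum>z\<in>range \<phi>. log_cf (\<phi> -` {z} \<inter> ?W K) (cnj z))"
      by (simp add: UNIV_bool C'_def c'_def log_cf_zero)
    finally show ?thesis .
  qed
  have "?cf \<phi> = of_real (exp (- (\<Sum>z\<in>range \<phi>. log_cf (\<phi> -` {z}) (cnj z))))"
    by (rule simple_integral_iexp) (use simple_vimage[OF \<phi>] simple_integral_measurable[OF \<phi>] in \<open>auto simp: disjoint_family_on_def\<close>)
  moreover have "(\<lambda>K. \<Sum>z\<in>range \<phi>. log_cf (\<phi> -` {z} \<inter> ?W K) (cnj z)) \<longlonglongrightarrow> (\<Sum>z\<in>range \<phi>. log_cf (\<phi> -` {z}) (cnj z))"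
    by (intro tendsto_sum log_cf_Int_tendsto C null simple_vimage[OF \<phi>])
  ultimately have lim\<phi>: "(\<lambda>K. ?cf (\<phi>K K)) \<longlonglongrightarrow> ?cf \<phi>"
    unfolding cf_\<phi> by (auto intro!: tendsto_intros)
  have "(\<lambda>K. \<Sum>j<K. log_cf (C j) (cnj (c j))) \<longlonglongrightarrow> (\<Sum>j. log_cf (C j) (cnj (c j)))"
    using sum by (rule summable_LIMSEQ)
  then have limh: "(\<lambda>K. ?cf (hK K)) \<longlonglongrightarrow> of_real (exp (- (\<Sum>j. log_cf (C j) (cnj (c j)))))"
    unfolding cf_h by (intro tendsto_intros)
  have "cmod (?cf (\<phi>K K) - ?cf (hK K)) \<le> \<epsilon>" for K
  proof -
    have "ennreal (cmod (?cf (\<phi>K K) - ?cf (hK K)))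
      \<le> (\<integral>\<^sup>+\<omega>. ennreal (cmod (simple_integral_rm D (\<phi>K K) \<omega> - simple_integral_rm D (hK K) \<omega>)) \<partial>M)"
      by (intro norm_iexp_integral_diff_le simple_integral_measurable s\<phi> sh)
    also have "\<dots> \<le> (\<integral>\<^sup>+x. ennreal (cmod (\<phi>K K x - hK K x)) \<partial>nu M D)"
      by (rule nn_integral_simple_integral_diff_le[OF s\<phi> sh])
    also have "\<dots> \<le> (\<integral>\<^sup>+x. ennreal (cmod (\<phi> x - h x)) \<partial>nu M D)"
      by (intro nn_integral_mono) (simp add: \<phi>K_def hK_def)
    also note \<epsilon>(2)
    finally show ?thesis using \<epsilon>(1) by (simp add: ennreal_le_iff)
  qed
  then show ?thesis
    by (intro LIMSEQ_le_const2[OF tendsto_norm[OF tendsto_diff[OF lim\<phi> limh]]]) auto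
qed

text \<open>The error in \<open>simple_integral_iexp_approx\<close> is the distance in
  L1(\<open>nu\<close>), which tends to 0, while the same characteristic functions converge to that
  of Z.\<close>

lemma limit_iexp:
  assumes h [measurable]: "h \<in> borel_measurable borel"
    and C: "\<And>j::nat. C j \<in> sets borel" "disjoint_family C" "mass (- (\<Union>j. C j)) = 0"
    and c: "\<And>j x. x \<in> C j \<Longrightarrow> h x = c j"
    and sum: "summable (\<lambda>j. log_cf (C j) (cnj (c j)))"
    and \<phi>: "\<And>n. simple_function borel (\<phi> n)"
    and lim: "(\<lambda>n. \<integral>\<^sup>+x. ennreal (cmod (\<phi> n x - h x)) \<partial>nu M D) \<longlonglongrightarrow> 0"
    and Z: "conv_in_prob M (\<lambda>n. simple_integral_rm D (\<phi> n)) Z sequentially" "Z \<in> borel_measurable M"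
  shows "(\<integral>\<omega>. iexp (Re (Z \<omega>)) \<partial>M) = of_real (exp (- (\<Sum>j. log_cf (C j) (cnj (c j)))))"
proof -
  let ?L = "complex_of_real (exp (- (\<Sum>j. log_cf (C j) (cnj (c j)))))"
  let ?cf = "\<lambda>n. \<integral>\<omega>. iexp (Re (simple_integral_rm D (\<phi> n) \<omega>)) \<partial>M"
  have "?cf \<longlonglongrightarrow> (\<integral>\<omega>. iexp (Re (Z \<omega>)) \<partial>M)"
    by (intro conv_in_prob_iexp Z simple_integral_measurable \<phi>)
  moreover have "?cf \<longlonglongrightarrow> ?L"
  proof (rule LIMSEQ_I)
    fix r :: real assume "0 < r"
    have "\<forall>\<^sub>F n in sequentially. (\<integral>\<^sup>+x. ennreal (cmod (\<phi> n x - h x)) \<partial>nu M D) < ennreal (r / 2)"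
      using lim \<open>0 < r\<close> by (intro order_tendstoD) auto
    then obtain N where N: "\<And>n. N \<le> n \<Longrightarrow> (\<integral>\<^sup>+x. ennreal (cmod (\<phi> n x - h x)) \<partial>nu M D) < ennreal (r / 2)"
      by (auto simp: eventually_sequentially)
    have "cmod (?cf n - ?L) \<le> r / 2" if "N \<le> n" for n
      using \<open>0 < r\<close> less_imp_le[OF N[OF that]]
      by (intro simple_integral_iexp_approx[OF h C(1) C(2) C(3) c sum \<phi>]) auto
    then show "\<exists>no. \<forall>n\<ge>no. cmod (?cf n - ?L) < r"
      using \<open>0 < r\<close> by (intro exI[of _ N]) (fastforce intro: order_le_less_trans)
  qed
  ultimately show ?thesis by (rule LIMSEQ_unique)
qed

end

section \<open>Morse--Transue integrals and the spectral measure of a pair of integrals\<close>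

text \<open>The supremum over B \<subseteq> A is attained at the part of A where r is positive, a
  Hahn set. Both sides truncate negative values through \<open>ennreal\<close>.\<close>

lemma pos_variation_eq_density:
  fixes r :: "real \<Rightarrow> real"
  assumes m: "sets m = sets borel" and r: "integrable m r"
    and \<mu>: "\<And>A. A \<in> sets borel \<Longrightarrow> \<mu> A = (\<integral>x. indicator A x * r x \<partial>m)"
  shows "pos_variation \<mu> = density m (\<lambda>x. ennreal (r x))"
proof -
  have [measurable]: "r \<in> borel_measurable m" using r by auto
  have sup: "(SUP B \<in> {B \<in> sets borel. B \<subseteq> A}. ennreal (\<mu> B)) = emeasure (density m (\<lambda>x. ennreal (r x))) A"
    if A: "A \<in> sets borel" for A
  proof -
    have A' [measurable]: "A \<in> sets m" using A m by simp
    have i: "integrable m (\<lambda>x. indicator B x * s x)" if "B \<in> sets borel" "integrable m s" for B and s :: "real \<Rightarrow> real"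
      using integrable_mult_indicator[of B m s] that m by simp
    have ir: "integrable m (\<lambda>x. max 0 (r x))" using r by simp
    let ?G = "\<integral>x. indicator A x * max 0 (r x) \<partial>m"
    have em: "emeasure (density m (\<lambda>x. ennreal (r x))) A = ennreal ?G"
    proof -
      have "emeasure (density m (\<lambda>x. ennreal (r x))) A = (\<integral>\<^sup>+x. ennreal (r x) * indicator A x \<partial>m)"
        by (rule emeasure_density) measurable
      also have "\<dots> = (\<integral>\<^sup>+x. ennreal (indicator A x * max 0 (r x)) \<partial>m)"
        by (intro nn_integral_cong) (auto simp: indicator_def max_def ennreal_neg)
      also have "\<dots> = ennreal ?G"
        by (rule nn_integral_eq_integral[OF i[OF A ir]]) auto
      finally show ?thesis .
    qed
    show ?thesis unfolding em
    proof (rule antisym)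
      show "(SUP B \<in> {B \<in> sets borel. B \<subseteq> A}. ennreal (\<mu> B)) \<le> ennreal ?G"
      proof (rule SUP_least)
        fix B assume B: "B \<in> {B \<in> sets borel. B \<subseteq> A}"
        have "\<mu> B \<le> ?G"
          unfolding \<mu>[OF CollectD[OF B, THEN conjunct1]]
          using B by (intro integral_mono i A r ir) (auto simp: indicator_def max_def)
        then show "ennreal (\<mu> B) \<le> ennreal ?G" by (rule ennreal_leI)
      qed
      let ?B = "A \<inter> {x \<in> space m. 0 < r x}"
      have B: "?B \<in> sets borel" unfolding m[symmetric] by measurable
      have "\<mu> ?B = ?G"
        unfolding \<mu>[OF B] by (intro Bochner_Integration.integral_cong) (auto simp: indicator_def max_def)
      then have "ennreal ?G = ennreal (\<mu> ?B)" by simp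
      also have "\<dots> \<le> (SUP B \<in> {B \<in> sets borel. B \<subseteq> A}. ennreal (\<mu> B))"
        using B by (intro SUP_upper) auto
      finally show "ennreal ?G \<le> (SUP B \<in> {B \<in> sets borel. B \<subseteq> A}. ennreal (\<mu> B))" .
    qed
  qed
  have sp: "space m = UNIV" using sets_eq_imp_space_eq[OF m] by simp
  have "pos_variation \<mu> = measure_of UNIV (sets borel) (emeasure (density m (\<lambda>x. ennreal (r x))))"
    unfolding pos_variation_def
    by (rule measure_of_eq) (use sup sets.sigma_sets_eq[of "borel :: real measure"] in auto)
  also have "\<dots> = density m (\<lambda>x. ennreal (r x))"
    using measure_of_of_measure[of "density m (\<lambda>x. ennreal (r x))"] by (simp add: sp m)
  finally show ?thesis .
qed

text \<open>The Jordan parts of the real and imaginary parts have the positive and negative parts of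
  Re k and Im k as densities with respect to m; the four integrals recombine to the single
  one.\<close>

lemma cm_integral_eq:
  fixes k h :: "real \<Rightarrow> complex"
  assumes "finite_measure m" and m: "sets m = sets borel"
    and k [measurable]: "k \<in> borel_measurable borel" and kb: "\<And>x. cmod (k x) \<le> K"
    and h [measurable]: "h \<in> borel_measurable borel" and hb: "\<And>x. cmod (h x) \<le> H"
    and \<mu>: "\<And>A. A \<in> sets borel \<Longrightarrow> \<mu> A = (\<integral>x. indicator A x * k x \<partial>m)"
  shows "cm_integral \<mu> h = (\<integral>x. k x * h x \<partial>m)"
proof -
  interpret finite_measure m by fact
  have [measurable]: "k \<in> borel_measurable m" "h \<in> borel_measurable m"
    using k h by (simp_all only: measurable_cong_sets[OF m refl])
  have ik: "integrable m k" using kb by (intro integrable_const_bound[where B=K] AE_I2) auto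
  have iA: "integrable m (\<lambda>x. indicator A x * k x)" if "A \<in> sets borel" for A
    using integrable_mult_indicator[of A m k, OF _ ik] that m
    by (simp add: scaleR_conv_of_real of_real_indicator)
  have K0: "0 \<le> K" using kb[of 0] norm_ge_zero order_trans by blast
  have part: "(\<integral>x. h x \<partial>pos_variation \<mu>') - (\<integral>x. h x \<partial>pos_variation (\<lambda>A. - \<mu>' A)) = (\<integral>x. of_real (r x) * h x \<partial>m)"
    and part_i: "integrable m (\<lambda>x. of_real (r x) * h x)"
    if [measurable]: "r \<in> borel_measurable m" and rb: "\<And>x. \<bar>r x\<bar> \<le> K"
      and \<mu>': "\<And>A. A \<in> sets borel \<Longrightarrow> \<mu>' A = (\<integral>x. indicator A x * r x \<partial>m)" for r \<mu>'
  proof -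
    have ir: "integrable m r" using rb by (intro integrable_const_bound[where B=K] AE_I2) auto
    have int: "integrable m (\<lambda>x. of_real (s x) * h x)" if [measurable]: "s \<in> borel_measurable m" and "\<And>x. \<bar>s x\<bar> \<le> K" for s
      using that(2) hb K0
      by (intro integrable_const_bound[where B="K * H"] AE_I2) (auto simp: norm_mult intro!: mult_mono)
    then show "integrable m (\<lambda>x. of_real (r x) * h x)" using rb by simp
    have dens: "(\<integral>x. h x \<partial>density m (\<lambda>x. ennreal (s x))) = (\<integral>x. of_real (max 0 (s x)) * h x \<partial>m)"
      if [measurable]: "s \<in> borel_measurable m" for s
    proof -
      have "density m (\<lambda>x. ennreal (s x)) = density m (\<lambda>x. ennreal (max 0 (s x)))"
        by (intro density_cong) (auto simp: max_def ennreal_neg)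
      then show ?thesis
        by (simp only:) (subst integral_density, auto simp: scaleR_conv_of_real)
    qed
    have p1: "pos_variation \<mu>' = density m (\<lambda>x. ennreal (r x))"
      by (rule pos_variation_eq_density[OF m ir \<mu>'])
    have p2: "pos_variation (\<lambda>A. - \<mu>' A) = density m (\<lambda>x. ennreal (- r x))"
      using ir \<mu>' by (intro pos_variation_eq_density[OF m]) auto
    have "(\<integral>x. h x \<partial>pos_variation \<mu>') - (\<integral>x. h x \<partial>pos_variation (\<lambda>A. - \<mu>' A))
      = (\<integral>x. of_real (max 0 (r x)) * h x \<partial>m) - (\<integral>x. of_real (max 0 (- r x)) * h x \<partial>m)"
      unfolding p1 p2 by (simp add: dens)
    also have "\<dots> = (\<integral>x. of_real (max 0 (r x)) * h x - of_real (max 0 (- r x)) * h x \<partial>m)"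
    proof (rule Bochner_Integration.integral_diff[symmetric])
      have "\<bar>max 0 (r x)\<bar> \<le> K" "\<bar>max 0 (- r x)\<bar> \<le> K" for x using rb[of x] K0 by auto
      then show "integrable m (\<lambda>x. of_real (max 0 (r x)) * h x)" "integrable m (\<lambda>x. of_real (max 0 (- r x)) * h x)"
        by (auto intro!: int)
    qed
    also have "\<dots> = (\<integral>x. of_real (r x) * h x \<partial>m)"
      by (intro Bochner_Integration.integral_cong) (auto simp: max_def)
    finally show "(\<integral>x. h x \<partial>pos_variation \<mu>') - (\<integral>x. h x \<partial>pos_variation (\<lambda>A. - \<mu>' A)) = (\<integral>x. of_real (r x) * h x \<partial>m)" .
  qed
  have Re: "Re (\<mu> A) = (\<integral>x. indicator A x * Re (k x) \<partial>m)" and Im: "Im (\<mu> A) = (\<integral>x. indicator A x * Im (k x) \<partial>m)"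
    if A: "A \<in> sets borel" for A
  proof -
    have "Re (\<mu> A) = (\<integral>x. Re (indicator A x * k x) \<partial>m)" "Im (\<mu> A) = (\<integral>x. Im (indicator A x * k x) \<partial>m)"
      unfolding \<mu>[OF A] using iA[OF A] by (simp_all only: integral_Re integral_Im)
    moreover have "Re (indicator A x * k x) = indicator A x * Re (k x)" "Im (indicator A x * k x) = indicator A x * Im (k x)" for x
      by (auto simp: indicator_def)
    ultimately show "Re (\<mu> A) = (\<integral>x. indicator A x * Re (k x) \<partial>m)" "Im (\<mu> A) = (\<integral>x. indicator A x * Im (k x) \<partial>m)"
      by (simp_all only:)
  qed
  have b: "\<bar>Re (k x)\<bar> \<le> K" "\<bar>Im (k x)\<bar> \<le> K" for x
    using kb[of x] abs_Re_le_cmod[of "k x"] abs_Im_le_cmod[of "k x"] by linarith+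
  have mR: "(\<lambda>x. Re (k x)) \<in> borel_measurable m" and mI: "(\<lambda>x. Im (k x)) \<in> borel_measurable m" by measurable
  have "cm_integral \<mu> h = (\<integral>x. of_real (Re (k x)) * h x \<partial>m) + \<i> * (\<integral>x. of_real (Im (k x)) * h x \<partial>m)"
  proof -
    have pR: "(\<integral>x. h x \<partial>pos_variation (\<lambda>A. Re (\<mu> A))) - (\<integral>x. h x \<partial>pos_variation (\<lambda>A. - Re (\<mu> A)))
      = (\<integral>x. of_real (Re (k x)) * h x \<partial>m)" by (rule part[OF mR b(1)]) (rule Re)
    have pI: "(\<integral>x. h x \<partial>pos_variation (\<lambda>A. Im (\<mu> A))) - (\<integral>x. h x \<partial>pos_variation (\<lambda>A. - Im (\<mu> A)))
      = (\<integral>x. of_real (Im (k x)) * h x \<partial>m)" by (rule part[OF mI b(2)]) (rule Im)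
    show ?thesis by (simp only: cm_integral_def pR pI)
  qed
  also have "\<dots> = (\<integral>x. of_real (Re (k x)) * h x + \<i> * (of_real (Im (k x)) * h x) \<partial>m)"
  proof -
    have "integrable m (\<lambda>x. of_real (Re (k x)) * h x)" by (rule part_i[OF mR b(1)]) (rule Re)
    moreover have "integrable m (\<lambda>x. of_real (Im (k x)) * h x)" by (rule part_i[OF mI b(2)]) (rule Im)
    ultimately show ?thesis by simp
  qed
  also have "\<dots> = (\<integral>x. k x * h x \<partial>m)"
  proof (intro Bochner_Integration.integral_cong refl)
    fix x
    have "of_real (Re (k x)) * h x + \<i> * (of_real (Im (k x)) * h x) = (of_real (Re (k x)) + \<i> * of_real (Im (k x))) * h x"
      by (simp only: distrib_right mult.assoc)
    then show "of_real (Re (k x)) * h x + \<i> * (of_real (Im (k x)) * h x) = k x * h x"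
      by (simp only: complex_eq[symmetric])
  qed
  finally show ?thesis .
qed

context stable_random_measure
begin

text \<open>The bimeasure is the integral of a product of two indicators against the control
  measure. \<open>cm_integral_eq\<close> thus applies twice: to the inner integral with an indicator
  as density, and to the outer one with f or h as density.\<close>

lemma MT_integrals_eq:
  assumes f [measurable]: "f \<in> borel_measurable borel" and fb: "\<And>x. cmod (f x) \<le> B"
    and h [measurable]: "h \<in> borel_measurable borel" and hb: "\<And>x. cmod (h x) \<le> H"
  shows "MT_I1 (bimeas M \<alpha> D) f h = (\<integral>x. f x * h x \<partial>control)"
    and "MT_I2 (bimeas M \<alpha> D) f h = (\<integral>x. f x * h x \<partial>control)"
proof -
  interpret control: finite_measure control by (rule finite_control)
  have ind: "(indicator A :: real \<Rightarrow> complex) \<in> borel_measurable borel" "cmod (indicator A x) \<le> 1"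
    if "A \<in> sets borel" for A x
    using that by (auto simp: indicator_def)
  have F: "bimeas M \<alpha> D A B = (\<integral>x. indicator A x * indicator B x \<partial>control)"
    if "A \<in> sets borel" "B \<in> sets borel" for A B
  proof -
    have "(\<integral>x. indicator A x * indicator B x \<partial>control) = (\<integral>x. complex_of_real (indicator (A \<inter> B) x) \<partial>control)"
      by (intro Bochner_Integration.integral_cong) (auto simp: indicator_def)
    also have "\<dots> = of_real (mass (A \<inter> B))"
      using that by (simp add: integral_complex_of_real sets_control space_control measure_control)
    finally show ?thesis using bimeas_eq_mass[OF that] by simp
  qed
  have in1: "cm_integral (\<lambda>A. bimeas M \<alpha> D A B) f = (\<integral>x. indicator B x * f x \<partial>control)" if B: "B \<in> sets borel" for B
    by (rule cm_integral_eq[OF finite_control sets_control ind[OF B] f fb]) (use F B in auto)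
  have in2: "cm_integral (\<lambda>B. bimeas M \<alpha> D A B) h = (\<integral>x. indicator A x * h x \<partial>control)" if A: "A \<in> sets borel" for A
    by (rule cm_integral_eq[OF finite_control sets_control ind[OF A] h hb]) (use F A in \<open>auto simp: mult.commute\<close>)
  show "MT_I1 (bimeas M \<alpha> D) f h = (\<integral>x. f x * h x \<partial>control)"
    unfolding MT_I1_def by (rule cm_integral_eq[OF finite_control sets_control f fb h hb in1])
  have "MT_I2 (bimeas M \<alpha> D) f h = (\<integral>x. h x * f x \<partial>control)"
    unfolding MT_I2_def by (rule cm_integral_eq[OF finite_control sets_control h hb f fb in2])
  then show "MT_I2 (bimeas M \<alpha> D) f h = (\<integral>x. f x * h x \<partial>control)"
    by (simp only: mult.commute)
qed

text \<open>Probability measures are required by the infinite product in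
  \<open>spectral_representation\<close>. A cell of mass 0 gets a point mass at (1, 0); both sides
  of the identity are then 0.\<close>

lemma normalized_spectral:
  assumes A: "A \<in> sets borel"
  shows "\<exists>K. sets K = sets (sphere_algebra 2) \<and> prob_space K \<and>
    (\<forall>c. ennreal (mass A) * (\<integral>\<^sup>+s. ennreal (\<bar>Re (c * cx s 0)\<bar> powr \<alpha>) \<partial>K) = ennreal (log_cf A (cnj c)))"
proof (cases "mass A = 0")
  case True
  define s0 :: "nat \<Rightarrow> real" where "s0 = (\<lambda>i\<in>{..<2}. if i = 0 then 1 else 0)"
  have "s0 \<in> space (sphere_algebra 2)"
    by (simp add: space_sphere_algebra unit_sphere_def s0_def space_PiM numeral_eq_Suc)
  then have "prob_space (return (sphere_algebra 2) s0)" by (rule prob_space_return)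
  moreover have "log_cf A (cnj c) = 0" for c
    using log_cf_le[OF A, of "cnj c"] log_cf_nonneg[of A "cnj c"] True by simp
  ultimately show ?thesis
    using True by (intro exI[of _ "return (sphere_algebra 2) s0"]) simp
next
  case False
  then have m: "0 < mass A" using mass_nonneg[of A] by simp
  let ?S = "spectral 1 (\<lambda>_. A)"
  interpret S: finite_measure ?S by (rule spectral_finite) (rule A)
  define K where "K = scale_measure (ennreal (1 / mass A)) ?S"
  have "emeasure K (space K) = ennreal (1 / mass A) * ennreal (mass A)"
    unfolding K_def by (simp add: mass_def S.emeasure_eq_measure space_scale_measure del: One_nat_def)
  also have "\<dots> = 1" using m by (simp add: ennreal_mult[symmetric])
  finally have "prob_space K" by (rule prob_spaceI)
  moreover have "sets K = sets (sphere_algebra 2)"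
    using is_spectral_measureD(1)[OF is_spectral, of 1 "\<lambda>_. A"] A by (simp add: K_def)
  moreover have "ennreal (mass A) * (\<integral>\<^sup>+s. ennreal (\<bar>Re (c * cx s 0)\<bar> powr \<alpha>) \<partial>K) = ennreal (log_cf A (cnj c))" for c
  proof -
    have i: "integrable ?S (\<lambda>s. \<bar>Re (c * cx s 0)\<bar> powr \<alpha>)"
      by (rule spectral_integrable) (use A in auto)
    have "(\<integral>\<^sup>+s. ennreal (\<bar>Re (c * cx s 0)\<bar> powr \<alpha>) \<partial>K)
      = ennreal (1 / mass A) * (\<integral>\<^sup>+s. ennreal (\<bar>Re (c * cx s 0)\<bar> powr \<alpha>) \<partial>?S)"
      unfolding K_def using i by (intro nn_integral_scale_measure) (auto dest: borel_measurable_integrable)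
    also have "(\<integral>\<^sup>+s. ennreal (\<bar>Re (c * cx s 0)\<bar> powr \<alpha>) \<partial>?S) = ennreal (log_cf A (cnj c))"
      unfolding log_cf_def complex_cnj_cnj by (rule nn_integral_eq_integral[OF i]) simp
    finally have "ennreal (mass A) * (\<integral>\<^sup>+s. ennreal (\<bar>Re (c * cx s 0)\<bar> powr \<alpha>) \<partial>K)
      = (ennreal (mass A) * ennreal (1 / mass A)) * ennreal (log_cf A (cnj c))"
      by (simp only: mult.assoc)
    also have "ennreal (mass A) * ennreal (1 / mass A) = 1"
      using m by (simp add: ennreal_mult[symmetric])
    finally show ?thesis by simp
  qed
  ultimately show ?thesis by blast
qed

text \<open>The cells are the level sets of the pair (f, g) off the null sets. The enumeration of
  the values may repeat, so the level sets are made disjoint; repeated ones become empty, and the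
  values attached to empty cells carry no information.\<close>

lemma countable_partition:
  assumes f [measurable]: "f \<in> borel_measurable borel" and g [measurable]: "g \<in> borel_measurable borel"
    and Nf: "Nf \<in> sets borel" "mass Nf = 0" "countable (f ` (- Nf))"
    and Ng: "Ng \<in> sets borel" "mass Ng = 0" "countable (g ` (- Ng))"
  obtains C :: "nat \<Rightarrow> real set" and a b :: "nat \<Rightarrow> complex"
    where "\<And>j. C j \<in> sets borel" "disjoint_family C" "mass (- (\<Union>j. C j)) = 0"
      "\<And>j x. x \<in> C j \<Longrightarrow> f x = a j" "\<And>j x. x \<in> C j \<Longrightarrow> g x = b j"
proof -
  define N where "N = Nf \<union> Ng"
  have [measurable]: "N \<in> sets borel" using Nf Ng by (simp add: N_def)
  have "Nf \<in> null_sets control" "Ng \<in> null_sets control"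
    using Nf Ng by (auto simp: null_sets_def sets_control emeasure_control)
  then have "N \<in> null_sets control" unfolding N_def by (rule null_sets.Un)
  then have N0: "mass N = 0"
    using mass_nonneg[of N] by (simp add: null_sets_def sets_control emeasure_control ennreal_eq_0_iff antisym)
  define S where "S = (\<lambda>x. (f x, g x)) ` (- N)"
  have "S \<subseteq> f ` (- Nf) \<times> g ` (- Ng)" by (auto simp: S_def N_def)
  then have S: "countable S" using Nf(3) Ng(3) countable_SIGMA countable_subset by metis
  define e where "e = from_nat_into S"
  define G where "G j = {x. (f x, g x) = e j} - N" for j
  have [measurable]: "G j \<in> sets borel" for j
  proof -
    have "G j = ({x. f x = fst (e j)} \<inter> {x. g x = snd (e j)}) - N" by (auto simp: G_def prod_eq_iff)
    also have "\<dots> \<in> sets borel" by measurable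
    finally show ?thesis .
  qed
  have sub: "disjointed G j \<subseteq> G j" for j by (rule disjointed_subset)
  have U: "(\<Union>j. disjointed G j) = - N"
    unfolding UN_disjointed_eq
  proof (intro equalityI subsetI)
    fix x assume x: "x \<in> - N"
    then have "(f x, g x) \<in> S" by (auto simp: S_def)
    then obtain j where "e j = (f x, g x)" using from_nat_into_surj[OF S] unfolding e_def by metis
    then show "x \<in> (\<Union>j. G j)" using x by (intro UN_I[of j]) (auto simp: G_def)
  qed (auto simp: G_def)
  show thesis
  proof (rule that[of "disjointed G" "\<lambda>j. fst (e j)" "\<lambda>j. snd (e j)"])
    have "range (disjointed G) \<subseteq> sets borel" by (rule sets.range_disjointed_sets) auto
    then show "disjointed G j \<in> sets borel" for j by auto
    show "disjoint_family (disjointed G)" by (rule disjoint_family_disjointed)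
    show "mass (- (\<Union>j. disjointed G j)) = 0" unfolding U using N0 by simp
    show "f x = fst (e j)" if "x \<in> disjointed G j" for j x
      using sub[of j] that by (auto simp: G_def dest!: arg_cong[where f=fst])
    show "g x = snd (e j)" if "x \<in> disjointed G j" for j x
      using sub[of j] that by (auto simp: G_def dest!: arg_cong[where f=snd])
  qed
qed

lemma log_cf_summable:
  assumes C: "\<And>j::nat. C j \<in> sets borel" "disjoint_family C" and c: "\<And>j. cmod (c j) \<le> B"
  shows "summable (\<lambda>j. log_cf (C j) (cnj (c j)))"
proof (rule summable_comparison_test')
  interpret control: finite_measure control by (rule finite_control)
  have "(\<lambda>j. measure control (C j)) sums measure control (\<Union>j. C j)"
    using C by (intro control.finite_measure_UNION) (auto simp: sets_control)
  then show "summable (\<lambda>j. B powr \<alpha> * mass (C j))"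
    using C by (intro summable_mult) (simp add: measure_control sums_iff)
  fix j
  have "log_cf (C j) (cnj (c j)) \<le> cmod (c j) powr \<alpha> * mass (C j)"
    using log_cf_le[OF C(1), of j "cnj (c j)"] by simp
  also have "\<dots> \<le> B powr \<alpha> * mass (C j)"
    using c[of j] \<alpha> by (intro mult_right_mono powr_mono2 mass_nonneg) auto
  finally show "norm (log_cf (C j) (cnj (c j))) \<le> B powr \<alpha> * mass (C j)"
    by (simp add: log_cf_nonneg)
qed

text \<open>The spectral measure of a pair of integrals is represented on \<open>\<real> \<times> \<Prod>\<^sub>j S\<^sub>1\<close>: a point \<open>x\<close> is drawn from
  the control measure and, if \<open>x\<close> lies in the \<open>j\<close>-th cell, the direction is the \<open>j\<close>-th component of a
  sequence drawn from the product of the normalized spectral measures of the cells.\<close>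

lemma spectral_representation:
  assumes C: "\<And>j::nat. C j \<in> sets borel" "disjoint_family C" "mass (- (\<Union>j. C j)) = 0"
  obtains P :: "(nat \<Rightarrow> nat \<Rightarrow> real) measure" and u :: "real \<times> (nat \<Rightarrow> nat \<Rightarrow> real) \<Rightarrow> complex"
    where "prob_space P" "u \<in> borel_measurable (control \<Otimes>\<^sub>M P)"
      "\<And>z. z \<in> space (control \<Otimes>\<^sub>M P) \<Longrightarrow> cmod (u z) = 1"
      "\<forall>h c B. h \<in> borel_measurable borel \<longrightarrow> (\<forall>x. cmod (h x) \<le> B) \<longrightarrow> (\<forall>j. \<forall>x\<in>C j. h x = c j) \<longrightarrow>
        (\<forall>j. cmod (c j) \<le> B) \<longrightarrow>
        (\<integral>z. \<bar>Re (h (fst z) * u z)\<bar> powr \<alpha> \<partial>(control \<Otimes>\<^sub>M P)) = (\<Sum>j. log_cf (C j) (cnj (c j)))"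
proof -
  interpret control: finite_measure control by (rule finite_control)
  have "\<forall>j. \<exists>K. sets K = sets (sphere_algebra 2) \<and> prob_space K \<and>
    (\<forall>c. ennreal (mass (C j)) * (\<integral>\<^sup>+s. ennreal (\<bar>Re (c * cx s 0)\<bar> powr \<alpha>) \<partial>K) = ennreal (log_cf (C j) (cnj c)))"
    using normalized_spectral C(1) by blast
  then obtain K where K: "\<And>j. sets (K j) = sets (sphere_algebra 2)" "\<And>j. prob_space (K j)"
    "\<And>j c. ennreal (mass (C j)) * (\<integral>\<^sup>+s. ennreal (\<bar>Re (c * cx s 0)\<bar> powr \<alpha>) \<partial>K j) = ennreal (log_cf (C j) (cnj c))"
    by metis
  define P where "P = Pi\<^sub>M UNIV K"
  have P: "prob_space P" unfolding P_def by (rule prob_space_PiM) (rule K)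
  interpret P: prob_space P by (rule P)
  \<comment> \<open>Off the cells the index is an unspecified number. This concerns a null set only,
    and \<open>u\<close> still takes a component on the unit circle there.\<close>
  define idx where "idx x = (LEAST j. x \<in> C j)" for x
  have idx: "idx x = j" if "x \<in> C j" for x j
    unfolding idx_def
  proof (rule Least_equality)
    fix i assume "x \<in> C i"
    then show "j \<le> i" using that C(2) by (cases "i = j") (auto simp: disjoint_family_on_def)
  qed (rule that)
  have idx_meas: "idx \<in> measurable control (count_space UNIV)"
    unfolding idx_def[abs_def] using C(1) by (intro measurable_Least) (simp add: pred_def sets_control space_control)
  define u where "u z = cx (snd z (idx (fst z))) 0" for z :: "real \<times> (nat \<Rightarrow> nat \<Rightarrow> real)"
  have cxK: "(\<lambda>s. cx s 0) \<in> borel_measurable (K j)" for j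
    by (rule cx_measurable_sphere[OF K(1)]) simp
  have comp: "(\<lambda>\<sigma>. \<sigma> j) \<in> measurable P (K j)" for j
    unfolding P_def by (rule measurable_component_singleton) simp
  have comp_cx: "(\<lambda>\<sigma>. cx (\<sigma> j) 0) \<in> borel_measurable P" for j
    by (rule measurable_compose[OF comp cxK])
  have u_meas: "u \<in> borel_measurable (control \<Otimes>\<^sub>M P)"
    unfolding u_def[abs_def]
    by (rule measurable_compose_countable[where f="\<lambda>j z. cx (snd z j) 0" and g="\<lambda>z. idx (fst z)"])
       (auto intro: measurable_compose[OF measurable_snd comp_cx] measurable_compose[OF measurable_fst idx_meas])
  have u1: "cmod (u z) = 1" if "z \<in> space (control \<Otimes>\<^sub>M P)" for z
  proof -
    have "snd z (idx (fst z)) \<in> space (K (idx (fst z)))"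
      using that by (auto simp: space_pair_measure P_def space_PiM)
    then have "snd z (idx (fst z)) \<in> unit_sphere 2"
      using sets_eq_imp_space_eq[OF K(1)] by (simp add: space_sphere_algebra)
    then show ?thesis by (simp add: u_def unit_sphere_def cx_def cmod_def numeral_eq_Suc)
  qed
  have main: "(\<integral>z. \<bar>Re (h (fst z) * u z)\<bar> powr \<alpha> \<partial>(control \<Otimes>\<^sub>M P)) = (\<Sum>j. log_cf (C j) (cnj (c j)))"
    if h: "h \<in> borel_measurable borel" and hB: "\<And>x. cmod (h x) \<le> B"
      and c: "\<And>j x. x \<in> C j \<Longrightarrow> h x = c j" and cB: "\<And>j. cmod (c j) \<le> B" for h c B
  proof -
    have mm [measurable]: "(\<lambda>z. \<bar>Re (h (fst z) * u z)\<bar> powr \<alpha>) \<in> borel_measurable (control \<Otimes>\<^sub>M P)"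
    proof -
      have [measurable]: "u \<in> borel_measurable (control \<Otimes>\<^sub>M P)" by (rule u_meas)
      have [measurable]: "h \<in> borel_measurable control" using h by (simp add: measurable_cong_sets[OF sets_control refl])
      show ?thesis by measurable
    qed
    let ?I = "\<lambda>x. \<integral>\<^sup>+\<sigma>. ennreal (\<bar>Re (h x * u (x, \<sigma>))\<bar> powr \<alpha>) \<partial>P"
    define L where "L j = (\<integral>\<^sup>+s. ennreal (\<bar>Re (c j * cx s 0)\<bar> powr \<alpha>) \<partial>K j)" for j
    have I: "?I x = L j" if "x \<in> C j" for x j
    proof -
      have m: "(\<lambda>s. ennreal (\<bar>Re (c j * cx s 0)\<bar> powr \<alpha>)) \<in> borel_measurable (K j)"
        using cxK[of j] by measurable
      have "?I x = (\<integral>\<^sup>+\<sigma>. ennreal (\<bar>Re (c j * cx (\<sigma> j) 0)\<bar> powr \<alpha>) \<partial>P)"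
        using that by (simp add: u_def idx c)
      also have "\<dots> = (\<integral>\<^sup>+s. ennreal (\<bar>Re (c j * cx s 0)\<bar> powr \<alpha>) \<partial>distr P (K j) (\<lambda>\<sigma>. \<sigma> j))"
        by (subst nn_integral_distr[OF comp[of j]]) (use m in simp_all)
      also have "distr P (K j) (\<lambda>\<sigma>. \<sigma> j) = K j"
        unfolding P_def by (rule distr_PiM_component) (auto simp: K)
      finally show ?thesis by (simp add: L_def)
    qed
    have ae: "AE x in control. x \<in> (\<Union>j. C j)"
    proof (rule AE_I)
      show "- (\<Union>j. C j) \<in> sets control" using C(1) by (simp add: sets_control borel_comp)
      show "emeasure control (- (\<Union>j. C j)) = 0"
        using C(1,3) by (subst emeasure_control) (auto intro!: borel_comp)
    qed auto
    have "(\<integral>\<^sup>+z. ennreal (\<bar>Re (h (fst z) * u z)\<bar> powr \<alpha>) \<partial>(control \<Otimes>\<^sub>M P)) = (\<integral>\<^sup>+x. ?I x \<partial>control)"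
      using P.nn_integral_fst[OF measurable_compose[OF mm measurable_ennreal]] by simp
    also have "\<dots> = (\<integral>\<^sup>+x. (\<Sum>j. L j * indicator (C j) x) \<partial>control)"
    proof (rule nn_integral_cong_AE)
      show "AE x in control. ?I x = (\<Sum>j. L j * indicator (C j) x)"
        using ae
      proof eventually_elim
        case (elim x)
        then obtain j where j: "x \<in> C j" by blast
        have "(\<Sum>i. L i * indicator (C i) x) = (\<Sum>i\<in>{j}. L i * indicator (C i) x)"
        proof (rule suminf_finite)
          fix i assume "i \<notin> {j}"
          then have "C i \<inter> C j = {}" using C(2) by (simp add: disjoint_family_on_def)
          then have "x \<notin> C i" using j by blast
          then show "L i * indicator (C i) x = 0" by simp
        qed simp
        then show ?case using I[OF j] j by simp
      qed
    qed
    also have "\<dots> = (\<Sum>j. \<integral>\<^sup>+x. L j * indicator (C j) x \<partial>control)"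
      using C(1) by (intro nn_integral_suminf) (simp add: sets_control)
    also have "\<dots> = (\<Sum>j. ennreal (log_cf (C j) (cnj (c j))))"
    proof (rule suminf_cong)
      fix j
      have "(\<integral>\<^sup>+x. L j * indicator (C j) x \<partial>control) = L j * emeasure control (C j)"
        by (rule nn_integral_cmult_indicator) (simp add: sets_control C(1))
      also have "\<dots> = ennreal (mass (C j)) * L j"
        by (simp only: emeasure_control[OF C(1)] mult.commute)
      also have "\<dots> = ennreal (log_cf (C j) (cnj (c j)))"
        unfolding L_def by (rule K(3))
      finally show "(\<integral>\<^sup>+x. L j * indicator (C j) x \<partial>control) = ennreal (log_cf (C j) (cnj (c j)))" .
    qed
    also have "\<dots> = ennreal (\<Sum>j. log_cf (C j) (cnj (c j)))"
      by (intro suminf_ennreal2 log_cf_nonneg log_cf_summable[OF C(1,2) cB])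
    finally have nn: "(\<integral>\<^sup>+z. ennreal (\<bar>Re (h (fst z) * u z)\<bar> powr \<alpha>) \<partial>(control \<Otimes>\<^sub>M P))
      = ennreal (\<Sum>j. log_cf (C j) (cnj (c j)))" .
    have "0 \<le> (\<Sum>j. log_cf (C j) (cnj (c j)))"
      by (intro suminf_nonneg log_cf_nonneg log_cf_summable[OF C(1,2) cB])
    then show ?thesis
      by (subst integral_eq_nn_integral[OF mm]) (simp_all only: nn enn2real_ennreal, simp)
  qed
  have all: "\<forall>h c B. h \<in> borel_measurable borel \<longrightarrow> (\<forall>x. cmod (h x) \<le> B) \<longrightarrow> (\<forall>j. \<forall>x\<in>C j. h x = c j) \<longrightarrow>
      (\<forall>j. cmod (c j) \<le> B) \<longrightarrow>
      (\<integral>z. \<bar>Re (h (fst z) * u z)\<bar> powr \<alpha> \<partial>(control \<Otimes>\<^sub>M P)) = (\<Sum>j. log_cf (C j) (cnj (c j)))"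
    by (intro allI impI, rule main) auto
  show thesis by (rule that[OF P u_meas u1 all])
qed

lemma Lambda_countable_range:
  assumes f: "f \<in> borel_measurable borel" and \<phi>: "L1_approx M D \<phi> f"
  shows "\<exists>N\<in>sets borel. mass N = 0 \<and> countable (f ` (- N))"
proof -
  have "\<forall>\<^sub>F n in sequentially. (\<integral>\<^sup>+x. ennreal (cmod (\<phi> n x - f x)) \<partial>nu M D) < 1"
    using L1_approxD(3)[OF \<phi>] by (rule order_tendstoD) simp
  then obtain n where "(\<integral>\<^sup>+x. ennreal (cmod (\<phi> n x - f x)) \<partial>nu M D) < 1"
    by (auto simp: eventually_sequentially)
  then have "(\<integral>\<^sup>+x. ennreal (cmod (\<phi> n x - f x)) \<partial>nu M D) < \<infinity>"
    by (rule order.strict_trans) simp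
  then show ?thesis by (rule countable_range_of_nu_approx[OF f L1_approxD(1)[OF \<phi>]])
qed

text \<open>The pair of integrals is represented by (f u, g u) on the product space. The modulus of
  u is 1, so u cancels between the first factor and the signed power, and the directions can be
  integrated out.\<close>

lemma covariation_rm_integrals:
  assumes f: "f \<in> Lambda_space M D" and fB: "\<And>x. cmod (f x) \<le> B"
    and g: "g \<in> Lambda_space M D" and gB: "\<And>x. cmod (g x) \<le> B"
  shows "covariation M \<alpha> (rm_integral M D f) (rm_integral M D g)
    = (\<integral>x. f x * spow (g x) (\<alpha> - 1) \<partial>control)"
proof -
  let ?X = "rm_integral M D f" and ?Y = "rm_integral M D g"
  have B0: "0 \<le> B" using fB[of 0] norm_ge_zero order_trans by blast
  have f_meas [measurable]: "f \<in> borel_measurable borel" and g_meas [measurable]: "g \<in> borel_measurable borel"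
    using f g by (auto simp: Lambda_space_def)
  obtain \<phi> where X [measurable]: "?X \<in> borel_measurable M" and \<phi>: "L1_approx M D \<phi> f"
    and X_lim: "conv_in_prob M (\<lambda>n. simple_integral_rm D (\<phi> n)) ?X sequentially"
    using rm_integral_props[OF f] by blast
  obtain \<psi> where Y [measurable]: "?Y \<in> borel_measurable M" and \<psi>: "L1_approx M D \<psi> g"
    and Y_lim: "conv_in_prob M (\<lambda>n. simple_integral_rm D (\<psi> n)) ?Y sequentially"
    using rm_integral_props[OF g] by blast
  note s\<phi> = L1_approxD(1)[OF \<phi>] and s\<psi> = L1_approxD(1)[OF \<psi>]
  have [measurable]: "\<phi> n \<in> borel_measurable borel" "\<psi> n \<in> borel_measurable borel" for n
    using L1_approxD(2)[OF \<phi>] L1_approxD(2)[OF \<psi>] by auto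
  have [measurable]: "simple_integral_rm D (\<phi> n) \<in> borel_measurable M" "simple_integral_rm D (\<psi> n) \<in> borel_measurable M" for n
    by (rule simple_integral_measurable[OF s\<phi>], rule simple_integral_measurable[OF s\<psi>])
  obtain Nf where Nf: "Nf \<in> sets borel" "mass Nf = 0" "countable (f ` (- Nf))"
    using Lambda_countable_range[OF f_meas \<phi>] by blast
  obtain Ng where Ng: "Ng \<in> sets borel" "mass Ng = 0" "countable (g ` (- Ng))"
    using Lambda_countable_range[OF g_meas \<psi>] by blast
  obtain C :: "nat \<Rightarrow> real set" and a b :: "nat \<Rightarrow> complex"
    where C: "\<And>j. C j \<in> sets borel" "disjoint_family C" "mass (- (\<Union>j. C j)) = 0"
      and ab: "\<And>j x. x \<in> C j \<Longrightarrow> f x = a j" "\<And>j x. x \<in> C j \<Longrightarrow> g x = b j"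
    by (rule countable_partition[OF f_meas g_meas Nf Ng]) (rule that)
  obtain P :: "(nat \<Rightarrow> nat \<Rightarrow> real) measure" and u :: "real \<times> (nat \<Rightarrow> nat \<Rightarrow> real) \<Rightarrow> complex"
    where P: "prob_space P" and u: "u \<in> borel_measurable (control \<Otimes>\<^sub>M P)"
      and u1: "\<And>z. z \<in> space (control \<Otimes>\<^sub>M P) \<Longrightarrow> cmod (u z) = 1"
      and rep: "\<forall>h c B. h \<in> borel_measurable borel \<longrightarrow> (\<forall>x. cmod (h x) \<le> B) \<longrightarrow>
        (\<forall>j. \<forall>x\<in>C j. h x = c j) \<longrightarrow> (\<forall>j. cmod (c j) \<le> B) \<longrightarrow>
        (\<integral>z. \<bar>Re (h (fst z) * u z)\<bar> powr \<alpha> \<partial>(control \<Otimes>\<^sub>M P)) = (\<Sum>j. log_cf (C j) (cnj (c j)))"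
    by (rule spectral_representation[OF C]) (rule that)
  interpret P: prob_space P by (rule P)
  interpret control: finite_measure control by (rule finite_control)
  have fin: "finite_measure (control \<Otimes>\<^sub>M P)"
    by (intro finite_measure_pair_measure finite_control P.finite_measure_axioms)
  have cf: "(\<integral>\<omega>. iexp (Re (cnj \<theta>1 * ?X \<omega> + cnj \<theta>2 * ?Y \<omega>)) \<partial>M)
    = of_real (exp (- (\<integral>z. \<bar>Re (cnj \<theta>1 * (f (fst z) * u z) + cnj \<theta>2 * (g (fst z) * u z))\<bar> powr \<alpha> \<partial>(control \<Otimes>\<^sub>M P))))"
    for \<theta>1 \<theta>2
  proof -
    \<comment> \<open>The joint characteristic function at a pair of frequencies is that of the
      integral of the single function h.\<close>
    define h where "h x = cnj \<theta>1 * f x + cnj \<theta>2 * g x" for x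
    \<comment> \<open>On empty cells a and b are arbitrary; the value 0 restores the bound H
      there.\<close>
    define c where "c j = (if C j = {} then 0 else cnj \<theta>1 * a j + cnj \<theta>2 * b j)" for j
    define \<zeta> where "\<zeta> n x = cnj \<theta>1 * \<phi> n x + cnj \<theta>2 * \<psi> n x" for n x
    define H where "H = cmod \<theta>1 * B + cmod \<theta>2 * B"
    have h_meas: "h \<in> borel_measurable borel" unfolding h_def[abs_def] by measurable
    have hH: "cmod (h x) \<le> H" for x
      unfolding h_def H_def using fB[of x] gB[of x]
      by (intro norm_triangle_le add_mono) (auto simp: norm_mult intro!: mult_left_mono)
    have hc: "h x = c j" if "x \<in> C j" for x j
      using that ab by (auto simp: h_def c_def)
    have cH: "cmod (c j) \<le> H" for j
    proof (cases "C j = {}")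
      case True
      then show ?thesis using B0 by (simp add: c_def H_def)
    next
      case False
      then obtain x where "x \<in> C j" by blast
      then show ?thesis using hH[of x] hc by metis
    qed
    have s\<zeta>: "simple_function borel (\<zeta> n)" for n
      unfolding \<zeta>_def[abs_def]
      by (intro simple_function_add simple_function_mult simple_function_const s\<phi> s\<psi>)
    have lim: "(\<lambda>n. \<integral>\<^sup>+x. ennreal (cmod (\<zeta> n x - h x)) \<partial>nu M D) \<longlonglongrightarrow> 0"
    proof (rule tendsto_sandwich[OF _ _ tendsto_const])
      have "(\<lambda>n. ennreal (cmod \<theta>1) * (\<integral>\<^sup>+x. ennreal (cmod (\<phi> n x - f x)) \<partial>nu M D)
          + ennreal (cmod \<theta>2) * (\<integral>\<^sup>+x. ennreal (cmod (\<psi> n x - g x)) \<partial>nu M D))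
        \<longlonglongrightarrow> ennreal (cmod \<theta>1) * 0 + ennreal (cmod \<theta>2) * 0"
        by (intro tendsto_add ennreal_tendsto_cmult L1_approxD(3)[OF \<phi>] L1_approxD(3)[OF \<psi>]) auto
      then show "(\<lambda>n. ennreal (cmod \<theta>1) * (\<integral>\<^sup>+x. ennreal (cmod (\<phi> n x - f x)) \<partial>nu M D)
          + ennreal (cmod \<theta>2) * (\<integral>\<^sup>+x. ennreal (cmod (\<psi> n x - g x)) \<partial>nu M D)) \<longlonglongrightarrow> 0"
        by simp
      show "\<forall>\<^sub>F n in sequentially. (\<integral>\<^sup>+x. ennreal (cmod (\<zeta> n x - h x)) \<partial>nu M D)
        \<le> ennreal (cmod \<theta>1) * (\<integral>\<^sup>+x. ennreal (cmod (\<phi> n x - f x)) \<partial>nu M D)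
          + ennreal (cmod \<theta>2) * (\<integral>\<^sup>+x. ennreal (cmod (\<psi> n x - g x)) \<partial>nu M D)"
      proof (rule always_eventually, rule allI)
        fix n
        have m: "(\<lambda>x. ennreal (cmod (\<phi> n x - f x))) \<in> borel_measurable (nu M D)"
          "(\<lambda>x. ennreal (cmod (\<psi> n x - g x))) \<in> borel_measurable (nu M D)"
          by measurable
        have "(\<integral>\<^sup>+x. ennreal (cmod (\<zeta> n x - h x)) \<partial>nu M D)
          \<le> (\<integral>\<^sup>+x. ennreal (cmod \<theta>1) * ennreal (cmod (\<phi> n x - f x))
            + ennreal (cmod \<theta>2) * ennreal (cmod (\<psi> n x - g x)) \<partial>nu M D)"
        proof (rule nn_integral_mono)
          fix x
          have "\<zeta> n x - h x = cnj \<theta>1 * (\<phi> n x - f x) + cnj \<theta>2 * (\<psi> n x - g x)"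
            by (simp add: \<zeta>_def h_def right_diff_distrib)
          then have "cmod (\<zeta> n x - h x) \<le> cmod (cnj \<theta>1 * (\<phi> n x - f x)) + cmod (cnj \<theta>2 * (\<psi> n x - g x))"
            by (simp only: norm_triangle_ineq)
          then have "ennreal (cmod (\<zeta> n x - h x)) \<le> ennreal (cmod \<theta>1 * cmod (\<phi> n x - f x) + cmod \<theta>2 * cmod (\<psi> n x - g x))"
            by (intro ennreal_leI) (simp add: norm_mult)
          then show "ennreal (cmod (\<zeta> n x - h x)) \<le> ennreal (cmod \<theta>1) * ennreal (cmod (\<phi> n x - f x))
            + ennreal (cmod \<theta>2) * ennreal (cmod (\<psi> n x - g x))"
            by (simp add: ennreal_mult)
        qed
        also have "\<dots> = ennreal (cmod \<theta>1) * (\<integral>\<^sup>+x. ennreal (cmod (\<phi> n x - f x)) \<partial>nu M D)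
          + ennreal (cmod \<theta>2) * (\<integral>\<^sup>+x. ennreal (cmod (\<psi> n x - g x)) \<partial>nu M D)"
          using m by (simp add: nn_integral_add nn_integral_cmult)
        finally show "(\<integral>\<^sup>+x. ennreal (cmod (\<zeta> n x - h x)) \<partial>nu M D)
          \<le> ennreal (cmod \<theta>1) * (\<integral>\<^sup>+x. ennreal (cmod (\<phi> n x - f x)) \<partial>nu M D)
            + ennreal (cmod \<theta>2) * (\<integral>\<^sup>+x. ennreal (cmod (\<psi> n x - g x)) \<partial>nu M D)" .
      qed
    qed simp
    have "conv_in_prob M (\<lambda>n \<omega>. cnj \<theta>1 * simple_integral_rm D (\<phi> n) \<omega> + cnj \<theta>2 * simple_integral_rm D (\<psi> n) \<omega>)
      (\<lambda>\<omega>. cnj \<theta>1 * ?X \<omega> + cnj \<theta>2 * ?Y \<omega>) sequentially"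
      by (rule conv_in_prob_add[OF conv_in_prob_cmult[OF X_lim] conv_in_prob_cmult[OF Y_lim]]) measurable
    then have conv: "conv_in_prob M (\<lambda>n. simple_integral_rm D (\<zeta> n)) (\<lambda>\<omega>. cnj \<theta>1 * ?X \<omega> + cnj \<theta>2 * ?Y \<omega>) sequentially"
    proof (rule conv_in_prob_cong_AE)
      show "AE \<omega> in M. cnj \<theta>1 * simple_integral_rm D (\<phi> n) \<omega> + cnj \<theta>2 * simple_integral_rm D (\<psi> n) \<omega>
        = simple_integral_rm D (\<zeta> n) \<omega>" for n
        unfolding \<zeta>_def[abs_def] using simple_integral_linear[OF s\<phi> s\<psi>] by eventually_elim (rule sym)
      show "simple_integral_rm D (\<zeta> n) \<in> borel_measurable M" for n by (rule simple_integral_measurable[OF s\<zeta>])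
    qed simp_all
    have "(\<integral>\<omega>. iexp (Re (cnj \<theta>1 * ?X \<omega> + cnj \<theta>2 * ?Y \<omega>)) \<partial>M) = of_real (exp (- (\<Sum>j. log_cf (C j) (cnj (c j)))))"
    proof (rule limit_iexp[OF h_meas C hc _ s\<zeta> lim conv])
      show "summable (\<lambda>j. log_cf (C j) (cnj (c j)))" by (rule log_cf_summable[OF C(1,2) cH])
    qed measurable
    also have "(\<Sum>j. log_cf (C j) (cnj (c j))) = (\<integral>z. \<bar>Re (h (fst z) * u z)\<bar> powr \<alpha> \<partial>(control \<Otimes>\<^sub>M P))"
      by (rule rep[rule_format, OF h_meas hH hc cH, symmetric])
    also have "(\<lambda>z. h (fst z) * u z) = (\<lambda>z. cnj \<theta>1 * (f (fst z) * u z) + cnj \<theta>2 * (g (fst z) * u z))"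
      by (simp add: h_def distrib_right mult.assoc)
    finally show ?thesis .
  qed
  have fst_meas: "k \<in> borel_measurable borel \<Longrightarrow> (\<lambda>z. k (fst z)) \<in> borel_measurable (control \<Otimes>\<^sub>M P)" for k :: "real \<Rightarrow> complex"
    by (rule measurable_compose[OF measurable_fst]) (simp add: measurable_cong_sets[OF sets_control refl])
  have "covariation M \<alpha> ?X ?Y = (\<integral>z. (f (fst z) * u z) * spow (g (fst z) * u z) (\<alpha> - 1) \<partial>(control \<Otimes>\<^sub>M P))"
    by (rule covariation_eq_integral[OF \<alpha> fin _ _ _ _ cf, where B=B])
       (use u fst_meas[OF f_meas] fst_meas[OF g_meas] fB gB u1 in \<open>auto simp: norm_mult intro!: borel_measurable_times\<close>)
  also have "\<dots> = (\<integral>z. f (fst z) * spow (g (fst z)) (\<alpha> - 1) \<partial>(control \<Otimes>\<^sub>M P))"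
  proof (rule Bochner_Integration.integral_cong[OF refl])
    fix z assume z: "z \<in> space (control \<Otimes>\<^sub>M P)"
    have "(f (fst z) * u z) * spow (g (fst z) * u z) (\<alpha> - 1) = f (fst z) * spow (g (fst z)) (\<alpha> - 1) * (u z * spow (u z) (\<alpha> - 1))"
      by (simp only: spow_mult mult.assoc mult.left_commute)
    also have "u z * spow (u z) (\<alpha> - 1) = 1" unfolding mult_spow_self using u1[OF z] by simp
    finally show "(f (fst z) * u z) * spow (g (fst z) * u z) (\<alpha> - 1) = f (fst z) * spow (g (fst z)) (\<alpha> - 1)" by simp
  qed
  also have "\<dots> = (\<integral>x. f x * spow (g x) (\<alpha> - 1) \<partial>distr (control \<Otimes>\<^sub>M P) control fst)"
    by (rule integral_distr[symmetric]) measurable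
  also have "distr (control \<Otimes>\<^sub>M P) control fst = control" by (rule P.distr_pair_fst)
  finally show ?thesis .
qed

end

theorem proposition3:
  fixes M :: "'w measure" and \<alpha> :: real
    and \<xi> :: "real \<Rightarrow> 'w \<Rightarrow> complex"
    and D :: "real set \<Rightarrow> 'w \<Rightarrow> complex"
    and f g :: "real \<Rightarrow> complex"
  assumes "prob_space M"
    and "1 < \<alpha>" and "\<alpha> < 2"
    and "SaS_process M \<alpha> \<xi>"
    and "cond_I M \<xi>"
    and "cond_II M \<alpha> \<xi>"
    and "associated_random_measure M \<alpha> \<xi> D"
    and "cond_A M \<alpha> D"
    and "cond_BV \<alpha> (bimeas M \<alpha> D)"
    and "f \<in> Lambda_space M D" and "bounded (range f)"
    and "g \<in> Lambda_space M D" and "bounded (range g)"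
  shows "MT_integrable (bimeas M \<alpha> D) f (\<lambda>x. spow (g x) (\<alpha> - 1)) \<and>
    covariation M \<alpha> (rm_integral M D f) (rm_integral M D g)
      = MT_integral (bimeas M \<alpha> D) f (\<lambda>x. spow (g x) (\<alpha> - 1))"
proof -
  interpret stable_random_measure M \<alpha> D
    using assms by (intro stable_random_measure.intro stable_random_measure_axioms.intro)
      (auto simp: associated_random_measure_def)
  obtain B1 B2 where B1: "\<And>x. cmod (f x) \<le> B1" and B2: "\<And>x. cmod (g x) \<le> B2"
    using assms(11,13) unfolding bounded_iff by auto
  define B where "B = max B1 B2"
  have fB: "cmod (f x) \<le> B" and gB: "cmod (g x) \<le> B" for x
    using B1[of x] B2[of x] by (auto simp: B_def)
  have meas: "f \<in> borel_measurable borel" "(\<lambda>x. spow (g x) (\<alpha> - 1)) \<in> borel_measurable borel"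
    using assms(10,12) by (auto simp: Lambda_space_def intro!: spow_measurable)
  have hB: "cmod (spow (g x) (\<alpha> - 1)) \<le> B powr (\<alpha> - 1)" for x
    unfolding cmod_spow using gB[of x] \<alpha> by (intro powr_mono2) auto
  note MT = MT_integrals_eq[OF meas(1) fB meas(2) hB]
  show ?thesis
    unfolding MT_integrable_def MT_integral_def MT
    using covariation_rm_integrals[OF assms(10) fB assms(12) gB] by simp
qed

end
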